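(* Let $0\to\mathfrak{h}\to\mathfrak{g}\to\mathfrak{q}\to 0$ be a short exact sequence of commutative Lie algebras over a field $\mathbb{F}$ of characteristic $2$ (so $\mathfrak{h}$ is an ideal of $\mathfrak{g}$ and $\mathfrak{q}=\mathfrak{g}/\mathfrak{h}$), and let $M$ be a $\mathfrak{g}$-module. Then the second term of the spectral sequence associated to the filtration $\mathcal{F}^pCS^\bullet(\mathfrak{g},M)$ (defined in the context by means of $\mathfrak{h}$) reads $$E_2^{p,q}=HS^p(\mathfrak{q},HS^q(\mathfrak{h},M)).$$
   Context: Let $\mathbb{F}$ be a field of characteristic $2$. A commutative Lie algebra over $\mathbb{F}$ is an $\mathbb{F}$-vector space $\mathfrak{g}$ with a bilinear bracket satisfying $[x,y]=[y,x]$ and $[x,[y,z]]+[y,[z,x]]+[z,[x,y]]=0$ for all $x,y,z$ (it is not required that $[x,x]=0$). A $\mathfrak{g}$-module is an $\mathbb{F}$-vector space $M$ with a bilinear map $\mathfrak{g}\times M\to M$ such that $[x,y]\cdot m=x\cdot(y\cdot m)+y\cdot(x\cdot m)$. Commutative cohomology: $CS^n(\mathfrak{g},M):=\mathrm{Hom}_{\mathbb{F}}(S^n\mathfrak{g},M)$, where $S^n\mathfrak{g}$ is the $n$-th symmetric power (quotient of $\mathfrak{g}^{\otimes n}$), with differential $$d^nf(x_1,\dots,x_{n+1})=\sum_{i=1}^{n+1}x_i\cdot f(x_1,\dots,\hat{x}_i,\dots,x_{n+1})+\sum_{1\le i<j\le n+1}f([x_i,x_j],x_1,\dots,\hat{x}_i,\dots,\hat{x}_j,\dots,x_{n+1}).$$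 Its cohomology is denoted $HS^\bullet(\mathfrak{g},M)$. Filtration: $\mathcal{F}^pCS^n(\mathfrak{g},M)$ is the space of $c\in CS^n(\mathfrak{g},M)$ such that $c(x_1,\dots,x_n)=0$ whenever $n-p+1$ of the elements $x_i$ belong to $\mathfrak{h}$. It is a decreasing filtration by subcomplexes, and $E_0^{p,q}=\mathcal{F}^pCS^{p+q}(\mathfrak{g},M)/\mathcal{F}^{p+1}CS^{p+q}(\mathfrak{g},M)$ for the associated spectral sequence. The $\mathfrak{q}$-module structure on $HS^q(\mathfrak{h},M)$ is induced by the action of $x\in\mathfrak{g}$ on $CS^q(\mathfrak{h},M)$ given by $(L_xf)(y_1,\dots,y_q)=x\cdot f(y_1,\dots,y_q)+\sum_{i=1}^q f(y_1,\dots,[x,y_i],\dots,y_q)$; elements of $\mathfrak{h}$ act trivially on $HS^q(\mathfrak{h},M)$. The equality sign denotes the natural identification. *)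

theory Defs
  imports "HOL-Library.Multiset" "HOL-Algebra.Module" "HOL-Algebra.AbelCoset"
begin

text \<open>
  Vector spaces over a field \<open>F\<close> are modules in the sense of the locale \<^locale>\<open>module\<close>. Of a module record
  only the additive structure and the scalar multiplication matter; the fields inherited from
  the record type of rings (\<open>mult\<close>, \<open>one\<close>) are junk and are set to \<^term>\<open>undefined\<close>.
\<close>

section \<open>Linear maps, quotient modules\<close>

definition linear_maps ::
    "('f, 'x) ring_scheme \<Rightarrow> ('f, 'v, 'y) module_scheme \<Rightarrow> ('f, 'w, 'z) module_scheme \<Rightarrow> ('v \<Rightarrow> 'w) set" where
  "linear_maps F V W = {f \<in> carrier V \<rightarrow> carrier W.
     (\<forall>u\<in>carrier V. \<forall>v\<in>carrier V. f (u \<oplus>\<^bsub>V\<^esub> v) = f u \<oplus>\<^bsub>W\<^esub> f v) \<and>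
     (\<forall>a\<in>carrier F. \<forall>v\<in>carrier V. f (a \<odot>\<^bsub>V\<^esub> v) = a \<odot>\<^bsub>W\<^esub> f v)}"

definition linear_isos ::
    "('f, 'x) ring_scheme \<Rightarrow> ('f, 'v, 'y) module_scheme \<Rightarrow> ('f, 'w, 'z) module_scheme \<Rightarrow> ('v \<Rightarrow> 'w) set" where
  "linear_isos F V W = {f \<in> linear_maps F V W. bij_betw f (carrier V) (carrier W)}"

text \<open>For a submodule \<open>N\<close> the union in the scalar multiplication is the single coset of \<open>a \<odot> x\<close>.\<close>

definition quot_module :: "('f, 'v, 'y) module_scheme \<Rightarrow> 'v set \<Rightarrow> ('f, 'v set) module" where
  "quot_module M N = \<lparr>carrier = a_rcosets\<^bsub>M\<^esub> N, mult = undefined, one = undefined,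
     zero = N, add = (<+>\<^bsub>M\<^esub>), smult = (\<lambda>a A. (\<Union>x\<in>A. (N +>\<^bsub>M\<^esub> (a \<odot>\<^bsub>M\<^esub> x))))\<rparr>"

section \<open>Commutative Lie algebras and their modules\<close>

record ('f, 'g) lie_algebra = "('f, 'g) module" +
  bracket :: "'g \<Rightarrow> 'g \<Rightarrow> 'g"

locale comm_lie_algebra = field F + module F g
  for F :: "('f, 'x) ring_scheme" and g :: "('f, 'g, 'y) lie_algebra_scheme" +
  assumes char_2: "\<one>\<^bsub>F\<^esub> \<oplus>\<^bsub>F\<^esub> \<one>\<^bsub>F\<^esub> = \<zero>\<^bsub>F\<^esub>"
    and bracket_closed: "x \<in> carrier g \<Longrightarrow> y \<in> carrier g \<Longrightarrow> bracket g x y \<in> carrier g"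
    and bracket_add: "x \<in> carrier g \<Longrightarrow> y \<in> carrier g \<Longrightarrow> z \<in> carrier g \<Longrightarrow>
      bracket g (x \<oplus>\<^bsub>g\<^esub> y) z = bracket g x z \<oplus>\<^bsub>g\<^esub> bracket g y z"
    and bracket_smult: "a \<in> carrier F \<Longrightarrow> x \<in> carrier g \<Longrightarrow> y \<in> carrier g \<Longrightarrow>
      bracket g (a \<odot>\<^bsub>g\<^esub> x) y = a \<odot>\<^bsub>g\<^esub> bracket g x y"
    and bracket_commute: "x \<in> carrier g \<Longrightarrow> y \<in> carrier g \<Longrightarrow> bracket g x y = bracket g y x"
    and jacobi: "x \<in> carrier g \<Longrightarrow> y \<in> carrier g \<Longrightarrow> z \<in> carrier g \<Longrightarrow>
      bracket g x (bracket g y z) \<oplus>\<^bsub>g\<^esub> bracket g y (bracket g z x) \<oplus>\<^bsub>g\<^esub> bracket g z (bracket g x y) = \<zero>\<^bsub>g\<^esub>"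

definition lie_homs ::
    "('f, 'x) ring_scheme \<Rightarrow> ('f, 'g, 'y) lie_algebra_scheme \<Rightarrow> ('f, 'k, 'z) lie_algebra_scheme \<Rightarrow> ('g \<Rightarrow> 'k) set" where
  "lie_homs F g k = {\<phi> \<in> linear_maps F g k.
     \<forall>x\<in>carrier g. \<forall>y\<in>carrier g. \<phi> (bracket g x y) = bracket k (\<phi> x) (\<phi> y)}"

locale comm_lie_short_exact =
  h: comm_lie_algebra F h + g: comm_lie_algebra F g + q: comm_lie_algebra F q
  for F :: "('f, 'x) ring_scheme"
    and h :: "('f, 'h, 'y1) lie_algebra_scheme"
    and g :: "('f, 'g, 'y2) lie_algebra_scheme"
    and q :: "('f, 'q, 'y3) lie_algebra_scheme"
    and \<iota> :: "'h \<Rightarrow> 'g" and \<pi> :: "'g \<Rightarrow> 'q" +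
  assumes incl_hom: "\<iota> \<in> lie_homs F h g"
    and proj_hom: "\<pi> \<in> lie_homs F g q"
    and incl_inj: "inj_on \<iota> (carrier h)"
    and exact: "\<iota> ` carrier h = {x \<in> carrier g. \<pi> x = \<zero>\<^bsub>q\<^esub>}"
    and proj_surj: "\<pi> ` carrier g = carrier q"

text \<open>The action of the Lie algebra on a module is kept as a separate argument \<open>\<rho>\<close>.\<close>

locale comm_lie_module = comm_lie_algebra F g + M: module F M
  for F :: "('f, 'x) ring_scheme" and g :: "('f, 'g, 'y) lie_algebra_scheme"
    and M :: "('f, 'm, 'z) module_scheme" and \<rho> :: "'g \<Rightarrow> 'm \<Rightarrow> 'm" +
  assumes act_closed: "x \<in> carrier g \<Longrightarrow> m \<in> carrier M \<Longrightarrow> \<rho> x m \<in> carrier M"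
    and act_add_left: "x \<in> carrier g \<Longrightarrow> y \<in> carrier g \<Longrightarrow> m \<in> carrier M \<Longrightarrow>
      \<rho> (x \<oplus>\<^bsub>g\<^esub> y) m = \<rho> x m \<oplus>\<^bsub>M\<^esub> \<rho> y m"
    and act_smult_left: "a \<in> carrier F \<Longrightarrow> x \<in> carrier g \<Longrightarrow> m \<in> carrier M \<Longrightarrow>
      \<rho> (a \<odot>\<^bsub>g\<^esub> x) m = a \<odot>\<^bsub>M\<^esub> \<rho> x m"
    and act_add_right: "x \<in> carrier g \<Longrightarrow> m \<in> carrier M \<Longrightarrow> m' \<in> carrier M \<Longrightarrow>
      \<rho> x (m \<oplus>\<^bsub>M\<^esub> m') = \<rho> x m \<oplus>\<^bsub>M\<^esub> \<rho> x m'"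
    and act_smult_right: "a \<in> carrier F \<Longrightarrow> x \<in> carrier g \<Longrightarrow> m \<in> carrier M \<Longrightarrow>
      \<rho> x (a \<odot>\<^bsub>M\<^esub> m) = a \<odot>\<^bsub>M\<^esub> \<rho> x m"
    and act_bracket: "x \<in> carrier g \<Longrightarrow> y \<in> carrier g \<Longrightarrow> m \<in> carrier M \<Longrightarrow>
      \<rho> (bracket g x y) m = \<rho> x (\<rho> y m) \<oplus>\<^bsub>M\<^esub> \<rho> y (\<rho> x m)"

section \<open>Cochain complexes and spectral sequences of filtered complexes\<close>

text \<open>A cochain complex is given by the spaces \<open>C n\<close> and the differentials
  \<open>d n\<close> from \<open>C n\<close> to \<open>C (n + 1)\<close>, for \<open>n \<ge> 0\<close>.\<close>

definition cocycles :: "(nat \<Rightarrow> ('f, 'c, 'z) module_scheme) \<Rightarrow> (nat \<Rightarrow> 'c \<Rightarrow> 'c) \<Rightarrow> nat \<Rightarrow> 'c set" where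
  "cocycles C d n = {c \<in> carrier (C n). d n c = \<zero>\<^bsub>C (Suc n)\<^esub>}"

definition coboundaries :: "(nat \<Rightarrow> ('f, 'c, 'z) module_scheme) \<Rightarrow> (nat \<Rightarrow> 'c \<Rightarrow> 'c) \<Rightarrow> nat \<Rightarrow> 'c set" where
  "coboundaries C d n = (case n of 0 \<Rightarrow> {\<zero>\<^bsub>C 0\<^esub>} | Suc m \<Rightarrow> d m ` carrier (C m))"

definition cohomology ::
    "(nat \<Rightarrow> ('f, 'c, 'z) module_scheme) \<Rightarrow> (nat \<Rightarrow> 'c \<Rightarrow> 'c) \<Rightarrow> nat \<Rightarrow> ('f, 'c set) module" where
  "cohomology C d n = quot_module ((C n)\<lparr>carrier := cocycles C d n\<rparr>) (coboundaries C d n)"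

text \<open>
  The spectral sequence of a decreasing filtration \<open>Fil p n \<subseteq> C n\<close> by subcomplexes, indexed by
  the filtration degree \<open>p\<close> and the total degree \<open>n\<close>, i.e. \<open>ss_E C d Fil r p n\<close> is \<open>E\<^sub>r\<^sup>p\<^sup>,\<^sup>n\<^sup>-\<^sup>p\<close>:
  \<open>Z\<^sub>r\<^sup>p = F\<^sup>p \<inter> d\<^sup>-\<^sup>1 F\<^sup>p\<^sup>+\<^sup>r\<close>, \<open>E\<^sub>r\<^sup>p = Z\<^sub>r\<^sup>p / (Z\<^sub>r\<^sub>-\<^sub>1\<^sup>p\<^sup>+\<^sup>1 + d Z\<^sub>r\<^sub>-\<^sub>1\<^sup>p\<^sup>-\<^sup>r\<^sup>+\<^sup>1)\<close>.
\<close>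

definition ss_Z :: "(nat \<Rightarrow> 'c \<Rightarrow> 'c) \<Rightarrow> (int \<Rightarrow> nat \<Rightarrow> 'c set) \<Rightarrow> int \<Rightarrow> int \<Rightarrow> nat \<Rightarrow> 'c set" where
  "ss_Z d Fil r p n = {c \<in> Fil p n. d n c \<in> Fil (p + r) (Suc n)}"

definition ss_B :: "(nat \<Rightarrow> ('f, 'c, 'z) module_scheme) \<Rightarrow> (nat \<Rightarrow> 'c \<Rightarrow> 'c) \<Rightarrow> (int \<Rightarrow> nat \<Rightarrow> 'c set) \<Rightarrow>
    int \<Rightarrow> int \<Rightarrow> nat \<Rightarrow> 'c set" where
  "ss_B C d Fil r p n = ss_Z d Fil (r - 1) (p + 1) n <+>\<^bsub>C n\<^esub>
     (case n of 0 \<Rightarrow> {\<zero>\<^bsub>C 0\<^esub>} | Suc m \<Rightarrow> d m ` ss_Z d Fil (r - 1) (p - r + 1) m)"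

definition ss_E :: "(nat \<Rightarrow> ('f, 'c, 'z) module_scheme) \<Rightarrow> (nat \<Rightarrow> 'c \<Rightarrow> 'c) \<Rightarrow> (int \<Rightarrow> nat \<Rightarrow> 'c set) \<Rightarrow>
    int \<Rightarrow> int \<Rightarrow> nat \<Rightarrow> ('f, 'c set) module" where
  "ss_E C d Fil r p n = quot_module ((C n)\<lparr>carrier := ss_Z d Fil r p n\<rparr>) (ss_B C d Fil r p n)"

section \<open>Commutative cohomology\<close>

definition vecs :: "('g, 'y) partial_object_scheme \<Rightarrow> nat \<Rightarrow> 'g list set" where
  "vecs g n = {xs. length xs = n \<and> set xs \<subseteq> carrier g}"

text \<open>
  A cochain, i.e. a linear map on the symmetric power \<open>S\<^sup>n g\<close>, is recorded by its values on the
  products \<open>x\<^sub>1 \<cdots> x\<^sub>n\<close>, i.e. as a symmetric \<open>n\<close>-linear map. The theorem \<open>Hom_sym_power\<close>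
  below is the comparison.
\<close>

definition CS :: "('f, 'x) ring_scheme \<Rightarrow> ('f, 'g, 'y) module_scheme \<Rightarrow> ('f, 'm, 'z) module_scheme \<Rightarrow>
    nat \<Rightarrow> ('f, 'g list \<Rightarrow> 'm) module" where
  "CS F g M n = \<lparr>carrier = {f \<in> vecs g n \<rightarrow>\<^sub>E carrier M.
       (\<forall>xs\<in>vecs g n. \<forall>i<n. \<forall>x\<in>carrier g. \<forall>y\<in>carrier g.
          f (xs[i := x \<oplus>\<^bsub>g\<^esub> y]) = f (xs[i := x]) \<oplus>\<^bsub>M\<^esub> f (xs[i := y])) \<and>
       (\<forall>xs\<in>vecs g n. \<forall>i<n. \<forall>a\<in>carrier F. \<forall>x\<in>carrier g.
          f (xs[i := a \<odot>\<^bsub>g\<^esub> x]) = a \<odot>\<^bsub>M\<^esub> f (xs[i := x])) \<and>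
       (\<forall>xs\<in>vecs g n. \<forall>ys\<in>vecs g n. mset xs = mset ys \<longrightarrow> f xs = f ys)},
     mult = undefined, one = undefined,
     zero = (\<lambda>xs\<in>vecs g n. \<zero>\<^bsub>M\<^esub>),
     add = (\<lambda>f f'. \<lambda>xs\<in>vecs g n. f xs \<oplus>\<^bsub>M\<^esub> f' xs),
     smult = (\<lambda>a f. \<lambda>xs\<in>vecs g n. a \<odot>\<^bsub>M\<^esub> f xs)\<rparr>"

definition CS_diff :: "('f, 'g, 'y) lie_algebra_scheme \<Rightarrow> ('f, 'm, 'z) module_scheme \<Rightarrow> ('g \<Rightarrow> 'm \<Rightarrow> 'm) \<Rightarrow>
    nat \<Rightarrow> ('g list \<Rightarrow> 'm) \<Rightarrow> 'g list \<Rightarrow> 'm" where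
  "CS_diff g M \<rho> n f = (\<lambda>xs\<in>vecs g (Suc n).
     finsum M (\<lambda>i. \<rho> (xs ! i) (f (nths xs (- {i})))) {..n} \<oplus>\<^bsub>M\<^esub>
     finsum M (\<lambda>(i, j). f (bracket g (xs ! i) (xs ! j) # nths xs (- {i, j}))) {(i, j). i < j \<and> j \<le> n})"

definition HS :: "('f, 'x) ring_scheme \<Rightarrow> ('f, 'g, 'y) lie_algebra_scheme \<Rightarrow> ('f, 'm, 'z) module_scheme \<Rightarrow>
    ('g \<Rightarrow> 'm \<Rightarrow> 'm) \<Rightarrow> nat \<Rightarrow> ('f, ('g list \<Rightarrow> 'm) set) module" where
  "HS F g M \<rho> n = cohomology (CS F g M) (CS_diff g M \<rho>) n"

abbreviation HS_cocycles where
  "HS_cocycles F g M \<rho> n \<equiv> cocycles (CS F g M) (CS_diff g M \<rho>) n"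

abbreviation HS_coboundaries where
  "HS_coboundaries F g M \<rho> n \<equiv> coboundaries (CS F g M) (CS_diff g M \<rho>) n"

text \<open>The filtration, with \<open>H\<close> the ideal (as a subset of \<open>carrier g\<close>). For \<open>p \<le> 0\<close> the condition is
  void, for \<open>p > n\<close> it says \<open>c = 0\<close>.\<close>

definition CS_filt :: "('f, 'x) ring_scheme \<Rightarrow> ('f, 'g, 'y) module_scheme \<Rightarrow> ('f, 'm, 'z) module_scheme \<Rightarrow>
    'g set \<Rightarrow> int \<Rightarrow> nat \<Rightarrow> ('g list \<Rightarrow> 'm) set" where
  "CS_filt F g M H p n = {c \<in> carrier (CS F g M n).
     \<forall>xs\<in>vecs g n. int (card {i. i < n \<and> xs ! i \<in> H}) \<ge> int n - p + 1 \<longrightarrow> c xs = \<zero>\<^bsub>M\<^esub>}"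

section \<open>The action of the quotient on the cohomology of the ideal\<close>

definition lie_derivative :: "('f, 'h, 'y) lie_algebra_scheme \<Rightarrow> ('f, 'g, 'y') lie_algebra_scheme \<Rightarrow> ('h \<Rightarrow> 'g) \<Rightarrow>
    ('f, 'm, 'z) module_scheme \<Rightarrow> ('g \<Rightarrow> 'm \<Rightarrow> 'm) \<Rightarrow> nat \<Rightarrow> 'g \<Rightarrow> ('h list \<Rightarrow> 'm) \<Rightarrow> 'h list \<Rightarrow> 'm" where
  "lie_derivative h g \<iota> M \<rho> n x f = (\<lambda>ys\<in>vecs h n.
     \<rho> x (f ys) \<oplus>\<^bsub>M\<^esub>
     finsum M (\<lambda>i. f (ys[i := inv_into (carrier h) \<iota> (bracket g x (\<iota> (ys ! i)))])) {..<n})"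

text \<open>The class of \<open>f\<close> is sent by \<open>\<pi> x\<close> to the class of \<open>L\<^sub>x f\<close>; the unions over all lifts \<open>x\<close> of \<open>z\<close> and
  all representatives \<open>f\<close> of \<open>A\<close> avoid choices, all the cosets being equal.\<close>

definition HS_action :: "('f, 'x) ring_scheme \<Rightarrow> ('f, 'h, 'y) lie_algebra_scheme \<Rightarrow> ('f, 'g, 'y') lie_algebra_scheme \<Rightarrow>
    ('h \<Rightarrow> 'g) \<Rightarrow> ('g \<Rightarrow> 'q) \<Rightarrow> ('f, 'm, 'z) module_scheme \<Rightarrow> ('g \<Rightarrow> 'm \<Rightarrow> 'm) \<Rightarrow> nat \<Rightarrow>
    'q \<Rightarrow> ('h list \<Rightarrow> 'm) set \<Rightarrow> ('h list \<Rightarrow> 'm) set" where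
  "HS_action F h g \<iota> \<pi> M \<rho> n z A =
     (\<Union>x\<in>{x \<in> carrier g. \<pi> x = z}. \<Union>f\<in>A.
        (HS_coboundaries F h M (\<lambda>y. \<rho> (\<iota> y)) n +>\<^bsub>CS F h M n\<^esub> lie_derivative h g \<iota> M \<rho> n x f))"

section \<open>Cochains as linear maps on the symmetric power\<close>

text \<open>The symmetric power as a quotient of the free module on all words \<open>x\<^sub>1 \<cdots> x\<^sub>n\<close>, by the relations
  of multilinearity (which alone yield the tensor power) and of symmetry.\<close>

definition free_module :: "('f, 'x) ring_scheme \<Rightarrow> 's set \<Rightarrow> ('f, 's \<Rightarrow> 'f) module" where
  "free_module F S = \<lparr>carrier = {u. range u \<subseteq> carrier F \<and> finite {s. u s \<noteq> \<zero>\<^bsub>F\<^esub>} \<and> {s. u s \<noteq> \<zero>\<^bsub>F\<^esub>} \<subseteq> S},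
     mult = undefined, one = undefined, zero = (\<lambda>s. \<zero>\<^bsub>F\<^esub>),
     add = (\<lambda>u v s. u s \<oplus>\<^bsub>F\<^esub> v s), smult = (\<lambda>a u s. a \<otimes>\<^bsub>F\<^esub> u s)\<rparr>"

definition word :: "('f, 'x) ring_scheme \<Rightarrow> 's \<Rightarrow> 's \<Rightarrow> 'f" where
  "word F s = (\<lambda>t. if t = s then \<one>\<^bsub>F\<^esub> else \<zero>\<^bsub>F\<^esub>)"

definition sym_relations :: "('f, 'x) ring_scheme \<Rightarrow> ('f, 'g, 'y) module_scheme \<Rightarrow> nat \<Rightarrow> ('g list \<Rightarrow> 'f) set" where
  "sym_relations F g n = (let T = free_module F (vecs g n) in
     {word F (xs[i := x \<oplus>\<^bsub>g\<^esub> y]) \<ominus>\<^bsub>T\<^esub> (word F (xs[i := x]) \<oplus>\<^bsub>T\<^esub> word F (xs[i := y])) | xs i x y.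
        xs \<in> vecs g n \<and> i < n \<and> x \<in> carrier g \<and> y \<in> carrier g} \<union>
     {word F (xs[i := a \<odot>\<^bsub>g\<^esub> x]) \<ominus>\<^bsub>T\<^esub> a \<odot>\<^bsub>T\<^esub> word F (xs[i := x]) | xs i a x.
        xs \<in> vecs g n \<and> i < n \<and> a \<in> carrier F \<and> x \<in> carrier g} \<union>
     {word F xs \<ominus>\<^bsub>T\<^esub> word F ys | xs ys. xs \<in> vecs g n \<and> ys \<in> vecs g n \<and> mset xs = mset ys})"

definition sym_ideal :: "('f, 'x) ring_scheme \<Rightarrow> ('f, 'g, 'y) module_scheme \<Rightarrow> nat \<Rightarrow> ('g list \<Rightarrow> 'f) set" where
  "sym_ideal F g n = \<Inter>{N. submodule N F (free_module F (vecs g n)) \<and> sym_relations F g n \<subseteq> N}"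

definition sym_power :: "('f, 'x) ring_scheme \<Rightarrow> ('f, 'g, 'y) module_scheme \<Rightarrow> nat \<Rightarrow> ('f, ('g list \<Rightarrow> 'f) set) module" where
  "sym_power F g n = quot_module (free_module F (vecs g n)) (sym_ideal F g n)"

lemma free_module_carrierI:
  assumes "\<And>s. u s \<in> carrier F" "finite A" "A \<subseteq> S" "\<And>s. s \<notin> A \<Longrightarrow> u s = \<zero>\<^bsub>F\<^esub>"
  shows "u \<in> carrier (free_module F S)"
proof -
  have "{s. u s \<noteq> \<zero>\<^bsub>F\<^esub>} \<subseteq> A" using assms(4) by blast
  then show ?thesis using assms(1-3) by (auto simp: free_module_def intro: finite_subset)
qed

lemma free_module_supp:
  assumes "u \<in> carrier (free_module F S)"
  obtains A where "finite A" "A \<subseteq> S" "\<And>s. s \<notin> A \<Longrightarrow> u s = \<zero>\<^bsub>F\<^esub>"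
proof (rule that[of "{s. u s \<noteq> \<zero>\<^bsub>F\<^esub>}"])
  show "finite {s. u s \<noteq> \<zero>\<^bsub>F\<^esub>}" "{s. u s \<noteq> \<zero>\<^bsub>F\<^esub>} \<subseteq> S" using assms by (simp_all add: free_module_def)
qed simp

lemma free_module_val: "u \<in> carrier (free_module F S) \<Longrightarrow> u s \<in> carrier F"
  by (auto simp: free_module_def)

lemma free_module_simps:
  "\<zero>\<^bsub>free_module F S\<^esub> = (\<lambda>s. \<zero>\<^bsub>F\<^esub>)"
  "u \<oplus>\<^bsub>free_module F S\<^esub> v = (\<lambda>s. u s \<oplus>\<^bsub>F\<^esub> v s)"
  "a \<odot>\<^bsub>free_module F S\<^esub> u = (\<lambda>s. a \<otimes>\<^bsub>F\<^esub> u s)"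
  by (simp_all add: free_module_def)

lemma module_free_module:
  assumes "cring F"
  shows "module F (free_module F S)"
proof -
  interpret F: cring F by fact
  note [simp] = free_module_simps
  let ?V = "free_module F S"
  have add: "(\<lambda>s. u s \<oplus>\<^bsub>F\<^esub> v s) \<in> carrier ?V" if u: "u \<in> carrier ?V" and v: "v \<in> carrier ?V" for u v
  proof -
    obtain A where A: "finite A" "A \<subseteq> S" "\<And>s. s \<notin> A \<Longrightarrow> u s = \<zero>\<^bsub>F\<^esub>" using free_module_supp[OF u] by blast
    obtain B where B: "finite B" "B \<subseteq> S" "\<And>s. s \<notin> B \<Longrightarrow> v s = \<zero>\<^bsub>F\<^esub>" using free_module_supp[OF v] by blast
    show ?thesis
      by (rule free_module_carrierI[of _ F "A \<union> B"]) (use A B free_module_val[OF u] free_module_val[OF v] in auto)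
  qed
  have smult: "(\<lambda>s. a \<otimes>\<^bsub>F\<^esub> u s) \<in> carrier ?V" if a: "a \<in> carrier F" and u: "u \<in> carrier ?V" for a u
  proof -
    obtain A where A: "finite A" "A \<subseteq> S" "\<And>s. s \<notin> A \<Longrightarrow> u s = \<zero>\<^bsub>F\<^esub>" using free_module_supp[OF u] by blast
    show ?thesis
      by (rule free_module_carrierI[of _ F A]) (use A a free_module_val[OF u] in auto)
  qed
  have inv: "\<exists>v\<in>carrier ?V. (\<lambda>s. v s \<oplus>\<^bsub>F\<^esub> u s) = (\<lambda>s. \<zero>\<^bsub>F\<^esub>)" if u: "u \<in> carrier ?V" for u
  proof -
    obtain A where A: "finite A" "A \<subseteq> S" "\<And>s. s \<notin> A \<Longrightarrow> u s = \<zero>\<^bsub>F\<^esub>" using free_module_supp[OF u] by blast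
    have "(\<lambda>s. \<ominus>\<^bsub>F\<^esub> u s) \<in> carrier ?V"
      by (rule free_module_carrierI[of _ F A]) (use A free_module_val[OF u] in auto)
    then show ?thesis using free_module_val[OF u] by (intro bexI) (auto simp: F.l_neg)
  qed
  have zero: "(\<lambda>s. \<zero>\<^bsub>F\<^esub>) \<in> carrier ?V" by (rule free_module_carrierI[of _ F "{}"]) auto
  have "abelian_group ?V"
  proof (rule abelian_groupI)
    show "u \<oplus>\<^bsub>?V\<^esub> v \<in> carrier ?V" if "u \<in> carrier ?V" "v \<in> carrier ?V" for u v
      using add that by simp
    show "\<zero>\<^bsub>?V\<^esub> \<in> carrier ?V" using zero by simp
    show "(u \<oplus>\<^bsub>?V\<^esub> v) \<oplus>\<^bsub>?V\<^esub> w = u \<oplus>\<^bsub>?V\<^esub> (v \<oplus>\<^bsub>?V\<^esub> w)"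
      if "u \<in> carrier ?V" "v \<in> carrier ?V" "w \<in> carrier ?V" for u v w
      using that[THEN free_module_val] by (simp add: F.a_assoc)
    show "u \<oplus>\<^bsub>?V\<^esub> v = v \<oplus>\<^bsub>?V\<^esub> u" if "u \<in> carrier ?V" "v \<in> carrier ?V" for u v
      using that[THEN free_module_val] by (simp add: F.a_comm)
    show "\<zero>\<^bsub>?V\<^esub> \<oplus>\<^bsub>?V\<^esub> u = u" if "u \<in> carrier ?V" for u
      using free_module_val[OF that] by simp
    show "\<exists>v\<in>carrier ?V. v \<oplus>\<^bsub>?V\<^esub> u = \<zero>\<^bsub>?V\<^esub>" if "u \<in> carrier ?V" for u
      using inv[OF that] by simp
  qed
  then show ?thesis
  proof (rule moduleI[OF assms])
    show "a \<odot>\<^bsub>?V\<^esub> u \<in> carrier ?V" if "a \<in> carrier F" "u \<in> carrier ?V" for a u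
      using smult that by simp
    show "(a \<oplus>\<^bsub>F\<^esub> b) \<odot>\<^bsub>?V\<^esub> u = a \<odot>\<^bsub>?V\<^esub> u \<oplus>\<^bsub>?V\<^esub> b \<odot>\<^bsub>?V\<^esub> u"
      "(a \<otimes>\<^bsub>F\<^esub> b) \<odot>\<^bsub>?V\<^esub> u = a \<odot>\<^bsub>?V\<^esub> (b \<odot>\<^bsub>?V\<^esub> u)"
      if "a \<in> carrier F" "b \<in> carrier F" "u \<in> carrier ?V" for a b u
      using free_module_val[OF that(3)] that(1,2) by (simp_all add: F.l_distr F.m_assoc)
    show "a \<odot>\<^bsub>?V\<^esub> (u \<oplus>\<^bsub>?V\<^esub> v) = a \<odot>\<^bsub>?V\<^esub> u \<oplus>\<^bsub>?V\<^esub> a \<odot>\<^bsub>?V\<^esub> v"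
      if "a \<in> carrier F" "u \<in> carrier ?V" "v \<in> carrier ?V" for a u v
      using free_module_val[OF that(2)] free_module_val[OF that(3)] that(1) by (simp add: F.r_distr)
    show "\<one>\<^bsub>F\<^esub> \<odot>\<^bsub>?V\<^esub> u = u" if "u \<in> carrier ?V" for u
      using free_module_val[OF that] by simp
  qed
qed

lemma word_carrier:
  assumes "cring F" "s \<in> S"
  shows "word F s \<in> carrier (free_module F S)"
proof -
  interpret F: cring F by fact
  show ?thesis
    by (rule free_module_carrierI[of _ F "{s}"]) (use assms(2) in \<open>simp_all add: word_def\<close>)
qed

lemma
  assumes "module F V" "submodule N F V"
  shows quot_module_carrier: "carrier (quot_module V N) = {N +>\<^bsub>V\<^esub> v | v. v \<in> carrier V}"
    and quot_module_add: "v \<in> carrier V \<Longrightarrow> w \<in> carrier V \<Longrightarrow>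
      (N +>\<^bsub>V\<^esub> v) \<oplus>\<^bsub>quot_module V N\<^esub> (N +>\<^bsub>V\<^esub> w) = N +>\<^bsub>V\<^esub> (v \<oplus>\<^bsub>V\<^esub> w)"
    and quot_module_smult: "a \<in> carrier F \<Longrightarrow> v \<in> carrier V \<Longrightarrow>
      a \<odot>\<^bsub>quot_module V N\<^esub> (N +>\<^bsub>V\<^esub> v) = N +>\<^bsub>V\<^esub> (a \<odot>\<^bsub>V\<^esub> v)"
    and quot_module_self: "v \<in> carrier V \<Longrightarrow> v \<in> N +>\<^bsub>V\<^esub> v"
    and quot_module_mem: "v \<in> carrier V \<Longrightarrow> w \<in> N +>\<^bsub>V\<^esub> v \<Longrightarrow> w \<in> carrier V \<and> w \<ominus>\<^bsub>V\<^esub> v \<in> N"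
    and quot_module_eqI: "v \<in> carrier V \<Longrightarrow> w \<in> carrier V \<Longrightarrow> w \<ominus>\<^bsub>V\<^esub> v \<in> N \<Longrightarrow> N +>\<^bsub>V\<^esub> w = N +>\<^bsub>V\<^esub> v"
proof -
  interpret V: module F V by fact
  interpret N: submodule N F V by fact
  interpret A: abelian_subgroup N V
    by (rule abelian_subgroupI3)
      (use N.subgroup_axioms V.M.abelian_group_axioms in \<open>auto simp: additive_subgroup_def\<close>)
  have mod: "w \<in> N +>\<^bsub>V\<^esub> v \<longleftrightarrow> w \<ominus>\<^bsub>V\<^esub> v \<in> N" if "v \<in> carrier V" "w \<in> carrier V" for v w
    using A.a_rcos_module[OF that] by (simp add: a_minus_def)
  have eqI: "N +>\<^bsub>V\<^esub> w = N +>\<^bsub>V\<^esub> v" if "v \<in> carrier V" "w \<in> carrier V" "w \<ominus>\<^bsub>V\<^esub> v \<in> N" for v w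
    using mod[OF that(1,2)] A.a_repr_independence'[of w v] that by simp
  have carr: "w \<in> carrier V" if "v \<in> carrier V" "w \<in> N +>\<^bsub>V\<^esub> v" for v w
    using V.M.a_r_coset_subset_G[OF A.a_subset that(1)] that(2) by blast
  show "carrier (quot_module V N) = {N +>\<^bsub>V\<^esub> v | v. v \<in> carrier V}"
    by (auto simp: quot_module_def A_RCOSETS_def')
  show "v \<in> carrier V \<Longrightarrow> w \<in> carrier V \<Longrightarrow>
      (N +>\<^bsub>V\<^esub> v) \<oplus>\<^bsub>quot_module V N\<^esub> (N +>\<^bsub>V\<^esub> w) = N +>\<^bsub>V\<^esub> (v \<oplus>\<^bsub>V\<^esub> w)"
    using A.a_rcos_sum[of v w] by (simp add: quot_module_def)
  show "v \<in> carrier V \<Longrightarrow> v \<in> N +>\<^bsub>V\<^esub> v" by (rule A.a_rcos_self)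
  show "v \<in> carrier V \<Longrightarrow> w \<in> carrier V \<Longrightarrow> w \<ominus>\<^bsub>V\<^esub> v \<in> N \<Longrightarrow> N +>\<^bsub>V\<^esub> w = N +>\<^bsub>V\<^esub> v"
    by (rule eqI)
  show "v \<in> carrier V \<Longrightarrow> w \<in> N +>\<^bsub>V\<^esub> v \<Longrightarrow> w \<in> carrier V \<and> w \<ominus>\<^bsub>V\<^esub> v \<in> N"
    using carr mod by blast
  show "a \<odot>\<^bsub>quot_module V N\<^esub> (N +>\<^bsub>V\<^esub> v) = N +>\<^bsub>V\<^esub> (a \<odot>\<^bsub>V\<^esub> v)"
    if a: "a \<in> carrier F" and v: "v \<in> carrier V"
  proof -
    have "N +>\<^bsub>V\<^esub> (a \<odot>\<^bsub>V\<^esub> w) = N +>\<^bsub>V\<^esub> (a \<odot>\<^bsub>V\<^esub> v)" if w: "w \<in> N +>\<^bsub>V\<^esub> v" for w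
    proof (rule eqI)
      have wc: "w \<in> carrier V" and wN: "w \<ominus>\<^bsub>V\<^esub> v \<in> N" using carr[OF v w] mod[OF v] w by auto
      show "a \<odot>\<^bsub>V\<^esub> v \<in> carrier V" "a \<odot>\<^bsub>V\<^esub> w \<in> carrier V" using a v wc by auto
      have "a \<odot>\<^bsub>V\<^esub> w \<ominus>\<^bsub>V\<^esub> a \<odot>\<^bsub>V\<^esub> v = a \<odot>\<^bsub>V\<^esub> (w \<ominus>\<^bsub>V\<^esub> v)"
        using a v wc by (simp add: a_minus_def V.smult_r_distr V.smult_r_minus)
      then show "a \<odot>\<^bsub>V\<^esub> w \<ominus>\<^bsub>V\<^esub> a \<odot>\<^bsub>V\<^esub> v \<in> N" using N.smult_closed[OF a wN] by simp
    qed
    then have "(\<Union>w\<in>N +>\<^bsub>V\<^esub> v. (N +>\<^bsub>V\<^esub> (a \<odot>\<^bsub>V\<^esub> w))) = N +>\<^bsub>V\<^esub> (a \<odot>\<^bsub>V\<^esub> v)"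
      using A.a_rcos_self[OF v] by blast
    then show ?thesis by (simp add: quot_module_def)
  qed
qed

lemma vecs_upd: "xs \<in> vecs g n \<Longrightarrow> x \<in> carrier g \<Longrightarrow> xs[i := x] \<in> vecs g n"
  by (auto simp: vecs_def dest: set_update_subset_insert[THEN subsetD])

lemma
  assumes "module F g"
  shows sym_relations_carrier: "sym_relations F g n \<subseteq> carrier (free_module F (vecs g n))"
    and submodule_sym_ideal: "submodule (sym_ideal F g n) F (free_module F (vecs g n))"
    and sym_relations_ideal: "sym_relations F g n \<subseteq> sym_ideal F g n"
proof -
  let ?T = "free_module F (vecs g n)"
  interpret g: module F g by fact
  interpret T: module F ?T by (rule module_free_module) (rule g.R.is_cring)
  have w: "word F xs \<in> carrier ?T" if "xs \<in> vecs g n" for xs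
    by (rule word_carrier[OF g.R.is_cring that])
  have add: "u \<oplus>\<^bsub>?T\<^esub> v \<in> carrier ?T" if "u \<in> carrier ?T" "v \<in> carrier ?T" for u v
    using that by (rule T.M.a_closed)
  have sm: "a \<odot>\<^bsub>?T\<^esub> u \<in> carrier ?T" if "a \<in> carrier F" "u \<in> carrier ?T" for a u
    using that by (rule T.smult_closed)
  have sub: "u \<ominus>\<^bsub>?T\<^esub> v \<in> carrier ?T" if "u \<in> carrier ?T" "v \<in> carrier ?T" for u v
    using that by (rule T.M.minus_closed)
  show rel: "sym_relations F g n \<subseteq> carrier ?T"
    unfolding sym_relations_def Let_def
    by (intro Un_least subsetI; elim CollectE exE conjE; hypsubst;
        intro sub add sm w vecs_upd g.smult_closed g.M.a_closed; assumption)
  have carr: "submodule (carrier ?T) F ?T"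
    by (rule T.submoduleI[OF subset_refl T.M.zero_closed T.M.a_inv_closed add sm])
  have I: "N \<subseteq> carrier ?T" "\<zero>\<^bsub>?T\<^esub> \<in> N" "\<And>u. u \<in> N \<Longrightarrow> \<ominus>\<^bsub>?T\<^esub> u \<in> N"
    "\<And>u v. u \<in> N \<Longrightarrow> v \<in> N \<Longrightarrow> u \<oplus>\<^bsub>?T\<^esub> v \<in> N" "\<And>a u. a \<in> carrier F \<Longrightarrow> u \<in> N \<Longrightarrow> a \<odot>\<^bsub>?T\<^esub> u \<in> N"
    if N: "submodule N F ?T" for N
  proof -
    interpret N: submodule N F ?T by fact
    show "\<zero>\<^bsub>?T\<^esub> \<in> N" using N.one_closed by simp
  qed (use T.submoduleE[OF N] in simp_all)
  show "submodule (sym_ideal F g n) F ?T"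
  proof (rule T.submoduleI)
    show "sym_ideal F g n \<subseteq> carrier ?T" unfolding sym_ideal_def using carr rel by blast
    show "\<zero>\<^bsub>?T\<^esub> \<in> sym_ideal F g n" unfolding sym_ideal_def using I(2) by blast
    show "\<And>u. u \<in> sym_ideal F g n \<Longrightarrow> \<ominus>\<^bsub>?T\<^esub> u \<in> sym_ideal F g n"
      unfolding sym_ideal_def using I(3) by blast
    show "\<And>u v. u \<in> sym_ideal F g n \<Longrightarrow> v \<in> sym_ideal F g n \<Longrightarrow> u \<oplus>\<^bsub>?T\<^esub> v \<in> sym_ideal F g n"
      unfolding sym_ideal_def using I(4) by blast
    show "\<And>a u. a \<in> carrier F \<Longrightarrow> u \<in> sym_ideal F g n \<Longrightarrow> a \<odot>\<^bsub>?T\<^esub> u \<in> sym_ideal F g n"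
      unfolding sym_ideal_def using I(5) by blast
  qed
  show "sym_relations F g n \<subseteq> sym_ideal F g n" unfolding sym_ideal_def by blast
qed

lemma linear_mapsD:
  assumes "f \<in> linear_maps F V W"
  shows "u \<in> carrier V \<Longrightarrow> f u \<in> carrier W"
    and "u \<in> carrier V \<Longrightarrow> v \<in> carrier V \<Longrightarrow> f (u \<oplus>\<^bsub>V\<^esub> v) = f u \<oplus>\<^bsub>W\<^esub> f v"
    and "a \<in> carrier F \<Longrightarrow> u \<in> carrier V \<Longrightarrow> f (a \<odot>\<^bsub>V\<^esub> u) = a \<odot>\<^bsub>W\<^esub> f u"
  using assms unfolding linear_maps_def by blast+

lemma linear_maps_free_module_eq:
  assumes V: "module F V" and M: "module F M" and N: "submodule N F (free_module F S)"
    and \<phi>: "\<phi> \<in> linear_maps F (quot_module (free_module F S) N) M"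
    and \<psi>: "\<psi> \<in> linear_maps F (quot_module (free_module F S) N) M"
    and eq: "\<And>s. s \<in> S \<Longrightarrow> \<phi> (N +>\<^bsub>free_module F S\<^esub> word F s) = \<psi> (N +>\<^bsub>free_module F S\<^esub> word F s)"
    and u: "u \<in> carrier (free_module F S)"
  shows "\<phi> (N +>\<^bsub>free_module F S\<^esub> u) = \<psi> (N +>\<^bsub>free_module F S\<^esub> u)"
proof -
  let ?T = "free_module F S" and ?Q = "quot_module (free_module F S) N"
  interpret V: module F V by fact
  interpret M: module F M by fact
  interpret T: module F ?T by (rule module_free_module) (rule V.R.is_cring)
  note Q = quot_module_carrier[OF T.module_axioms N] quot_module_add[OF T.module_axioms N]
    quot_module_smult[OF T.module_axioms N]
  have lin: "\<chi> (N +>\<^bsub>?T\<^esub> v) \<in> carrier M"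
    "\<chi> (N +>\<^bsub>?T\<^esub> (v \<oplus>\<^bsub>?T\<^esub> w)) = \<chi> (N +>\<^bsub>?T\<^esub> v) \<oplus>\<^bsub>M\<^esub> \<chi> (N +>\<^bsub>?T\<^esub> w)"
    "a \<in> carrier F \<Longrightarrow> \<chi> (N +>\<^bsub>?T\<^esub> (a \<odot>\<^bsub>?T\<^esub> v)) = a \<odot>\<^bsub>M\<^esub> \<chi> (N +>\<^bsub>?T\<^esub> v)"
    if \<chi>: "\<chi> \<in> linear_maps F ?Q M" and vw: "v \<in> carrier ?T" "w \<in> carrier ?T" for \<chi> v w a
  proof -
    have m: "N +>\<^bsub>?T\<^esub> v \<in> carrier ?Q" "N +>\<^bsub>?T\<^esub> w \<in> carrier ?Q" using vw Q(1) by auto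
    show "\<chi> (N +>\<^bsub>?T\<^esub> v) \<in> carrier M" by (rule linear_mapsD(1)[OF \<chi> m(1)])
    show "\<chi> (N +>\<^bsub>?T\<^esub> (v \<oplus>\<^bsub>?T\<^esub> w)) = \<chi> (N +>\<^bsub>?T\<^esub> v) \<oplus>\<^bsub>M\<^esub> \<chi> (N +>\<^bsub>?T\<^esub> w)"
      unfolding Q(2)[OF vw, symmetric] by (rule linear_mapsD(2)[OF \<chi> m])
    show "\<chi> (N +>\<^bsub>?T\<^esub> (a \<odot>\<^bsub>?T\<^esub> v)) = a \<odot>\<^bsub>M\<^esub> \<chi> (N +>\<^bsub>?T\<^esub> v)" if "a \<in> carrier F"
      unfolding Q(3)[OF that vw(1), symmetric] by (rule linear_mapsD(3)[OF \<chi> that m(1)])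
  qed
  have "\<phi> (N +>\<^bsub>?T\<^esub> u) = \<psi> (N +>\<^bsub>?T\<^esub> u)"
    if "finite A" "A \<subseteq> S" "u \<in> carrier ?T" "\<And>s. s \<notin> A \<Longrightarrow> u s = \<zero>\<^bsub>F\<^esub>" for A u
    using that
  proof (induction A arbitrary: u rule: finite_induct)
    case empty
    have "u = \<zero>\<^bsub>F\<^esub> \<odot>\<^bsub>?T\<^esub> u"
    proof
      show "u t = (\<zero>\<^bsub>F\<^esub> \<odot>\<^bsub>?T\<^esub> u) t" for t using empty(3)[of t] by (simp add: free_module_simps)
    qed
    then show ?case
      using lin(1,3)[OF \<phi> empty(2) empty(2)] lin(1,3)[OF \<psi> empty(2) empty(2)]
      by (metis M.smult_l_null V.R.zero_closed)
  next
    case (insert s A)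
    let ?v = "u(s := \<zero>\<^bsub>F\<^esub>)" and ?w = "u s \<odot>\<^bsub>?T\<^esub> word F s"
    have us: "u t \<in> carrier F" for t by (rule free_module_val[OF insert.prems(2)])
    have s: "s \<in> S" and w: "word F s \<in> carrier ?T"
      using insert.prems(1) word_carrier[OF V.R.is_cring] by auto
    have v: "?v \<in> carrier ?T"
    proof (rule free_module_carrierI)
      show "?v t \<in> carrier F" for t using us[of t] by simp
      show "finite A" "A \<subseteq> S" using insert.hyps insert.prems(1) by auto
      show "?v t = \<zero>\<^bsub>F\<^esub>" if "t \<notin> A" for t using insert.prems(3)[of t] that by simp
    qed
    have "u = ?v \<oplus>\<^bsub>?T\<^esub> ?w"
    proof
      show "u t = (?v \<oplus>\<^bsub>?T\<^esub> ?w) t" for t using us[of s] us[of t] by (simp add: free_module_simps word_def)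
    qed
    moreover have "\<chi> (N +>\<^bsub>?T\<^esub> (?v \<oplus>\<^bsub>?T\<^esub> ?w)) = \<chi> (N +>\<^bsub>?T\<^esub> ?v) \<oplus>\<^bsub>M\<^esub> u s \<odot>\<^bsub>M\<^esub> \<chi> (N +>\<^bsub>?T\<^esub> word F s)"
      if "\<chi> \<in> linear_maps F ?Q M" for \<chi>
      using lin(2)[OF that v T.smult_closed[OF us w]] lin(3)[OF that w w us] by simp
    moreover have "\<phi> (N +>\<^bsub>?T\<^esub> ?v) = \<psi> (N +>\<^bsub>?T\<^esub> ?v)"
    proof (rule insert.IH[OF _ v])
      show "A \<subseteq> S" using insert.prems(1) by blast
      show "?v t = \<zero>\<^bsub>F\<^esub>" if "t \<notin> A" for t using insert.prems(3)[of t] that by simp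
    qed
    ultimately show ?case using \<phi> \<psi> eq[OF s] by metis
  qed
  then show ?thesis using free_module_supp[OF u] u by metis
qed

lemma
  fixes F :: "('f, 'x) ring_scheme" and M :: "('f, 'm, 'z) module_scheme" and f :: "'s \<Rightarrow> 'm"
  defines "ev \<equiv> \<lambda>u. finsum M (\<lambda>s. u s \<odot>\<^bsub>M\<^esub> f s) {s. u s \<noteq> \<zero>\<^bsub>F\<^esub>}"
  assumes M: "module F M" and f: "f \<in> S \<rightarrow> carrier M"
  shows free_ext_closed: "u \<in> carrier (free_module F S) \<Longrightarrow> ev u \<in> carrier M"
    and free_ext_add: "u \<in> carrier (free_module F S) \<Longrightarrow> v \<in> carrier (free_module F S) \<Longrightarrow>
      ev (u \<oplus>\<^bsub>free_module F S\<^esub> v) = ev u \<oplus>\<^bsub>M\<^esub> ev v"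
    and free_ext_smult: "a \<in> carrier F \<Longrightarrow> u \<in> carrier (free_module F S) \<Longrightarrow>
      ev (a \<odot>\<^bsub>free_module F S\<^esub> u) = a \<odot>\<^bsub>M\<^esub> ev u"
    and free_ext_word: "s \<in> S \<Longrightarrow> ev (word F s) = f s"
proof -
  let ?T = "free_module F S"
  interpret M: module F M by fact
  interpret T: module F ?T by (rule module_free_module) (rule M.R.is_cring)
  have supp: "\<exists>A. finite A \<and> A \<subseteq> S \<and> {s. u s \<noteq> \<zero>\<^bsub>F\<^esub>} \<subseteq> A" if "u \<in> carrier ?T" for u
    using that by (intro exI[of _ "{s. u s \<noteq> \<zero>\<^bsub>F\<^esub>}"]) (simp add: free_module_def)
  have ev: "ev u = finsum M (\<lambda>s. u s \<odot>\<^bsub>M\<^esub> f s) A" and cl: "(\<lambda>s. u s \<odot>\<^bsub>M\<^esub> f s) \<in> A \<rightarrow> carrier M"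
    if u: "u \<in> carrier ?T" and A: "finite A" "A \<subseteq> S" "{s. u s \<noteq> \<zero>\<^bsub>F\<^esub>} \<subseteq> A" for u A
  proof -
    show c: "(\<lambda>s. u s \<odot>\<^bsub>M\<^esub> f s) \<in> A \<rightarrow> carrier M"
      using f A(2) free_module_val[OF u] by (intro Pi_I M.smult_closed) auto
    show "ev u = finsum M (\<lambda>s. u s \<odot>\<^bsub>M\<^esub> f s) A"
      unfolding ev_def
    proof (rule M.M.add.finprod_mono_neutral_cong_left[OF A(1) _ _ refl c])
      show "{s. u s \<noteq> \<zero>\<^bsub>F\<^esub>} \<subseteq> A" using A(3) by blast
      fix s assume "s \<in> A - {s. u s \<noteq> \<zero>\<^bsub>F\<^esub>}"
      then have "u s = \<zero>\<^bsub>F\<^esub>" "f s \<in> carrier M" using f A(2) by auto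
      then show "u s \<odot>\<^bsub>M\<^esub> f s = \<zero>\<^bsub>M\<^esub>" by (simp add: M.smult_l_null)
    qed
  qed
  show closed: "ev u \<in> carrier M" if u: "u \<in> carrier ?T" for u
  proof -
    obtain A where A: "finite A" "A \<subseteq> S" "{s. u s \<noteq> \<zero>\<^bsub>F\<^esub>} \<subseteq> A" using supp[OF u] by blast
    show ?thesis unfolding ev[OF u A] by (rule M.M.finsum_closed[OF cl[OF u A]])
  qed
  show "ev (u \<oplus>\<^bsub>?T\<^esub> v) = ev u \<oplus>\<^bsub>M\<^esub> ev v" if u: "u \<in> carrier ?T" and v: "v \<in> carrier ?T" for u v
  proof -
    obtain A where A: "finite A" "A \<subseteq> S" "{s. u s \<noteq> \<zero>\<^bsub>F\<^esub>} \<subseteq> A" using supp[OF u] by blast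
    obtain B where B: "finite B" "B \<subseteq> S" "{s. v s \<noteq> \<zero>\<^bsub>F\<^esub>} \<subseteq> B" using supp[OF v] by blast
    have AB: "finite (A \<union> B)" "A \<union> B \<subseteq> S" using A B by auto
    have uv: "u \<oplus>\<^bsub>?T\<^esub> v \<in> carrier ?T" by (rule T.M.a_closed[OF u v])
    have cu: "(\<lambda>s. u s \<odot>\<^bsub>M\<^esub> f s) \<in> A \<union> B \<rightarrow> carrier M" by (rule cl[OF u AB]) (use A in auto)
    have cv: "(\<lambda>s. v s \<odot>\<^bsub>M\<^esub> f s) \<in> A \<union> B \<rightarrow> carrier M" by (rule cl[OF v AB]) (use B in auto)
    have "ev (u \<oplus>\<^bsub>?T\<^esub> v) = finsum M (\<lambda>s. (u \<oplus>\<^bsub>?T\<^esub> v) s \<odot>\<^bsub>M\<^esub> f s) (A \<union> B)"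
    proof (rule ev[OF uv AB])
      have "u s \<oplus>\<^bsub>F\<^esub> v s = \<zero>\<^bsub>F\<^esub>" if "s \<notin> A \<union> B" for s
      proof -
        have "u s = \<zero>\<^bsub>F\<^esub>" "v s = \<zero>\<^bsub>F\<^esub>" using that A(3) B(3) by auto
        then show ?thesis by simp
      qed
      then show "{s. (u \<oplus>\<^bsub>?T\<^esub> v) s \<noteq> \<zero>\<^bsub>F\<^esub>} \<subseteq> A \<union> B" unfolding free_module_simps by blast
    qed
    also have "\<dots> = finsum M (\<lambda>s. u s \<odot>\<^bsub>M\<^esub> f s \<oplus>\<^bsub>M\<^esub> v s \<odot>\<^bsub>M\<^esub> f s) (A \<union> B)"
    proof (rule M.M.finsum_cong'[OF refl])
      show "(\<lambda>s. u s \<odot>\<^bsub>M\<^esub> f s \<oplus>\<^bsub>M\<^esub> v s \<odot>\<^bsub>M\<^esub> f s) \<in> A \<union> B \<rightarrow> carrier M" using cu cv by auto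
      fix s assume "s \<in> A \<union> B"
      then show "(u \<oplus>\<^bsub>?T\<^esub> v) s \<odot>\<^bsub>M\<^esub> f s = u s \<odot>\<^bsub>M\<^esub> f s \<oplus>\<^bsub>M\<^esub> v s \<odot>\<^bsub>M\<^esub> f s"
        unfolding free_module_simps
        by (intro M.smult_l_distr free_module_val[OF u] free_module_val[OF v]) (use AB f in auto)
    qed
    also have "\<dots> = finsum M (\<lambda>s. u s \<odot>\<^bsub>M\<^esub> f s) (A \<union> B) \<oplus>\<^bsub>M\<^esub> finsum M (\<lambda>s. v s \<odot>\<^bsub>M\<^esub> f s) (A \<union> B)"
      by (rule M.M.finsum_addf[OF cu cv])
    also have "finsum M (\<lambda>s. u s \<odot>\<^bsub>M\<^esub> f s) (A \<union> B) = ev u"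
      by (rule ev[OF u AB, symmetric]) (use A in auto)
    also have "finsum M (\<lambda>s. v s \<odot>\<^bsub>M\<^esub> f s) (A \<union> B) = ev v"
      by (rule ev[OF v AB, symmetric]) (use B in auto)
    finally show ?thesis .
  qed
  show "ev (a \<odot>\<^bsub>?T\<^esub> u) = a \<odot>\<^bsub>M\<^esub> ev u" if a: "a \<in> carrier F" and u: "u \<in> carrier ?T" for a u
  proof -
    obtain A where A: "finite A" "A \<subseteq> S" "{s. u s \<noteq> \<zero>\<^bsub>F\<^esub>} \<subseteq> A" using supp[OF u] by blast
    have au: "a \<odot>\<^bsub>?T\<^esub> u \<in> carrier ?T" by (rule T.smult_closed[OF a u])
    have "ev (a \<odot>\<^bsub>?T\<^esub> u) = finsum M (\<lambda>s. (a \<odot>\<^bsub>?T\<^esub> u) s \<odot>\<^bsub>M\<^esub> f s) A"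
    proof (rule ev[OF au A(1,2)])
      have "a \<otimes>\<^bsub>F\<^esub> u s = \<zero>\<^bsub>F\<^esub>" if "s \<notin> A" for s
      proof -
        have "u s = \<zero>\<^bsub>F\<^esub>" using that A(3) by auto
        then show ?thesis using a by simp
      qed
      then show "{s. (a \<odot>\<^bsub>?T\<^esub> u) s \<noteq> \<zero>\<^bsub>F\<^esub>} \<subseteq> A" unfolding free_module_simps by blast
    qed
    also have "\<dots> = finsum M (\<lambda>s. a \<odot>\<^bsub>M\<^esub> (u s \<odot>\<^bsub>M\<^esub> f s)) A"
    proof (rule M.M.finsum_cong'[OF refl])
      show "(\<lambda>s. a \<odot>\<^bsub>M\<^esub> (u s \<odot>\<^bsub>M\<^esub> f s)) \<in> A \<rightarrow> carrier M" using cl[OF u A] a by auto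
      fix s assume "s \<in> A"
      then show "(a \<odot>\<^bsub>?T\<^esub> u) s \<odot>\<^bsub>M\<^esub> f s = a \<odot>\<^bsub>M\<^esub> (u s \<odot>\<^bsub>M\<^esub> f s)"
        unfolding free_module_simps
        by (intro M.smult_assoc1 a free_module_val[OF u]) (use A f in auto)
    qed
    also have "\<dots> = a \<odot>\<^bsub>M\<^esub> ev u"
      unfolding ev[OF u A] by (rule M.finsum_smult_ldistr[OF A(1) a cl[OF u A], symmetric])
    finally show ?thesis .
  qed
  show "ev (word F s) = f s" if s: "s \<in> S" for s
  proof -
    have fs: "f s \<in> carrier M" using f s by auto
    have "ev (word F s) = finsum M (\<lambda>t. word F s t \<odot>\<^bsub>M\<^esub> f t) {s}"
      by (rule ev[OF word_carrier[OF M.R.is_cring s]]) (use s in \<open>auto simp: word_def\<close>)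
    also have "\<dots> = f s"
      using fs by (subst M.M.finsum_insert) (auto simp: word_def)
    finally show ?thesis .
  qed
qed

theorem Hom_sym_power:
  assumes g: "module F g" and M: "module F M"
  shows "bij_betw (\<lambda>\<phi>. \<lambda>xs\<in>vecs g n. \<phi> (sym_ideal F g n +>\<^bsub>free_module F (vecs g n)\<^esub> word F xs))
    (linear_maps F (sym_power F g n) M \<inter> extensional (carrier (sym_power F g n)))
    (carrier (CS F g M n))"
proof -
  let ?S = "vecs g n" and ?T = "free_module F (vecs g n)" and ?Q = "sym_power F g n" and ?R = "sym_ideal F g n"
  let ?cl = "\<lambda>u. ?R +>\<^bsub>?T\<^esub> u"
  let ?res = "\<lambda>\<phi>. \<lambda>xs\<in>?S. \<phi> (?cl (word F xs))"
  interpret g: module F g by fact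
  interpret M: module F M by fact
  interpret T: module F ?T by (rule module_free_module) (rule g.R.is_cring)
  note R = submodule_sym_ideal[OF g, of n]
  note Qc = quot_module_carrier[OF T.module_axioms R, folded sym_power_def]
    and Qa = quot_module_add[OF T.module_axioms R, folded sym_power_def]
    and Qs = quot_module_smult[OF T.module_axioms R, folded sym_power_def]
    and Qeq = quot_module_eqI[OF T.module_axioms R]
  have w: "word F xs \<in> carrier ?T" if "xs \<in> ?S" for xs by (rule word_carrier[OF g.R.is_cring that])
  have clw: "?cl u \<in> carrier ?Q" if "u \<in> carrier ?T" for u using that Qc by auto
  have rel: "word F (xs[i := x \<oplus>\<^bsub>g\<^esub> y]) \<ominus>\<^bsub>?T\<^esub> (word F (xs[i := x]) \<oplus>\<^bsub>?T\<^esub> word F (xs[i := y])) \<in> sym_relations F g n"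
    if "xs \<in> ?S" "i < n" "x \<in> carrier g" "y \<in> carrier g" for xs i x y
    unfolding sym_relations_def Let_def using that by blast
  have rel': "word F (xs[i := a \<odot>\<^bsub>g\<^esub> x]) \<ominus>\<^bsub>?T\<^esub> a \<odot>\<^bsub>?T\<^esub> word F (xs[i := x]) \<in> sym_relations F g n"
    if "xs \<in> ?S" "i < n" "a \<in> carrier F" "x \<in> carrier g" for xs i a x
    unfolding sym_relations_def Let_def using that by blast
  have rel'': "word F xs \<ominus>\<^bsub>?T\<^esub> word F ys \<in> sym_relations F g n"
    if "xs \<in> ?S" "ys \<in> ?S" "mset xs = mset ys" for xs ys
    unfolding sym_relations_def Let_def using that by blast
  note RI = sym_relations_ideal[OF g, THEN subsetD]
  have into: "?res \<phi> \<in> carrier (CS F g M n)" if \<phi>: "\<phi> \<in> linear_maps F ?Q M" for \<phi>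
  proof -
    have cl: "\<phi> (?cl u) \<in> carrier M" if "u \<in> carrier ?T" for u
      by (rule linear_mapsD(1)[OF \<phi> clw[OF that]])
    have add: "\<phi> (?cl (u \<oplus>\<^bsub>?T\<^esub> v)) = \<phi> (?cl u) \<oplus>\<^bsub>M\<^esub> \<phi> (?cl v)" if "u \<in> carrier ?T" "v \<in> carrier ?T" for u v
      unfolding Qa[OF that, symmetric] by (rule linear_mapsD(2)[OF \<phi> clw[OF that(1)] clw[OF that(2)]])
    have sm: "\<phi> (?cl (a \<odot>\<^bsub>?T\<^esub> u)) = a \<odot>\<^bsub>M\<^esub> \<phi> (?cl u)" if "a \<in> carrier F" "u \<in> carrier ?T" for a u
      unfolding Qs[OF that, symmetric] by (rule linear_mapsD(3)[OF \<phi> that(1) clw[OF that(2)]])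
    have 1: "\<phi> (?cl (word F (xs[i := x \<oplus>\<^bsub>g\<^esub> y]))) = \<phi> (?cl (word F (xs[i := x]))) \<oplus>\<^bsub>M\<^esub> \<phi> (?cl (word F (xs[i := y])))"
      if *: "xs \<in> ?S" "i < n" "x \<in> carrier g" "y \<in> carrier g" for xs i x y
    proof -
      have W: "word F (xs[i := x]) \<in> carrier ?T" "word F (xs[i := y]) \<in> carrier ?T"
        "word F (xs[i := x \<oplus>\<^bsub>g\<^esub> y]) \<in> carrier ?T" using * by (simp_all add: w vecs_upd)
      show ?thesis
        unfolding add[OF W(1,2), symmetric] Qeq[OF T.M.a_closed[OF W(1,2)] W(3) RI[OF rel[OF *]]] ..
    qed
    have 2: "\<phi> (?cl (word F (xs[i := a \<odot>\<^bsub>g\<^esub> x]))) = a \<odot>\<^bsub>M\<^esub> \<phi> (?cl (word F (xs[i := x])))"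
      if *: "xs \<in> ?S" "i < n" "a \<in> carrier F" "x \<in> carrier g" for xs i a x
    proof -
      have W: "word F (xs[i := x]) \<in> carrier ?T" "word F (xs[i := a \<odot>\<^bsub>g\<^esub> x]) \<in> carrier ?T"
        using * by (simp_all add: w vecs_upd)
      show ?thesis
        unfolding sm[OF *(3) W(1), symmetric] Qeq[OF T.smult_closed[OF *(3) W(1)] W(2) RI[OF rel'[OF *]]] ..
    qed
    have 3: "\<phi> (?cl (word F xs)) = \<phi> (?cl (word F ys))"
      if *: "xs \<in> ?S" "ys \<in> ?S" "mset xs = mset ys" for xs ys
      unfolding Qeq[OF w[OF *(2)] w[OF *(1)] RI[OF rel''[OF *]]] ..
    show ?thesis
      unfolding CS_def partial_object.simps
    proof (intro CollectI conjI ballI allI impI)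
      show "?res \<phi> \<in> ?S \<rightarrow>\<^sub>E carrier M" by (rule restrict_PiE_iff[THEN iffD2]) (use cl[OF w] in blast)
    next
      fix xs i x y assume *: "xs \<in> ?S" "i < n" "x \<in> carrier g" "y \<in> carrier g"
      then show "?res \<phi> (xs[i := x \<oplus>\<^bsub>g\<^esub> y]) = ?res \<phi> (xs[i := x]) \<oplus>\<^bsub>M\<^esub> ?res \<phi> (xs[i := y])"
        using 1[OF *] by (simp only: restrict_apply' vecs_upd g.M.a_closed)
    next
      fix xs i a x assume *: "xs \<in> ?S" "i < n" "a \<in> carrier F" "x \<in> carrier g"
      then show "?res \<phi> (xs[i := a \<odot>\<^bsub>g\<^esub> x]) = a \<odot>\<^bsub>M\<^esub> ?res \<phi> (xs[i := x])"
        using 2[OF *] by (simp only: restrict_apply' vecs_upd g.smult_closed)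
    next
      fix xs ys assume *: "xs \<in> ?S" "ys \<in> ?S" "mset xs = mset ys"
      then show "?res \<phi> xs = ?res \<phi> ys" using 3[OF *] by (simp only: restrict_apply')
    qed
  qed
  have inj: "\<phi> = \<psi>" if \<phi>: "\<phi> \<in> linear_maps F ?Q M" "\<phi> \<in> extensional (carrier ?Q)"
    and \<psi>: "\<psi> \<in> linear_maps F ?Q M" "\<psi> \<in> extensional (carrier ?Q)" and eq: "?res \<phi> = ?res \<psi>" for \<phi> \<psi>
  proof (rule extensionalityI[OF \<phi>(2) \<psi>(2)])
    fix A assume "A \<in> carrier ?Q"
    then obtain u where u: "u \<in> carrier ?T" and A: "A = ?cl u" using Qc by auto
    have "\<phi> (?cl (word F xs)) = \<psi> (?cl (word F xs))" if "xs \<in> ?S" for xs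
      using fun_cong[OF eq, of xs] that by simp
    then show "\<phi> A = \<psi> A"
      unfolding A by (rule linear_maps_free_module_eq[OF g M R \<phi>(1)[unfolded sym_power_def] \<psi>(1)[unfolded sym_power_def] _ u])
  qed
  have surj: "\<exists>\<phi>\<in>linear_maps F ?Q M \<inter> extensional (carrier ?Q). f = ?res \<phi>" if f: "f \<in> carrier (CS F g M n)" for f
  proof -
    define ev where "ev u = finsum M (\<lambda>s. u s \<odot>\<^bsub>M\<^esub> f s) {s. u s \<noteq> \<zero>\<^bsub>F\<^esub>}" for u
    have fE: "f \<in> ?S \<rightarrow>\<^sub>E carrier M"
      and f1: "\<And>xs i x y. xs \<in> ?S \<Longrightarrow> i < n \<Longrightarrow> x \<in> carrier g \<Longrightarrow> y \<in> carrier g \<Longrightarrow>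
        f (xs[i := x \<oplus>\<^bsub>g\<^esub> y]) = f (xs[i := x]) \<oplus>\<^bsub>M\<^esub> f (xs[i := y])"
      and f2: "\<And>xs i a x. xs \<in> ?S \<Longrightarrow> i < n \<Longrightarrow> a \<in> carrier F \<Longrightarrow> x \<in> carrier g \<Longrightarrow>
        f (xs[i := a \<odot>\<^bsub>g\<^esub> x]) = a \<odot>\<^bsub>M\<^esub> f (xs[i := x])"
      and f3: "\<And>xs ys. xs \<in> ?S \<Longrightarrow> ys \<in> ?S \<Longrightarrow> mset xs = mset ys \<Longrightarrow> f xs = f ys"
      using f unfolding CS_def partial_object.simps by blast+
    have fS: "f \<in> ?S \<rightarrow> carrier M" using fE by auto
    note ev_c = free_ext_closed[OF M fS, folded ev_def] and ev_a = free_ext_add[OF M fS, folded ev_def]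
      and ev_s = free_ext_smult[OF M fS, folded ev_def] and ev_w = free_ext_word[OF M fS, folded ev_def]
    have ev_z: "ev \<zero>\<^bsub>?T\<^esub> = \<zero>\<^bsub>M\<^esub>"
      using ev_s[of "\<zero>\<^bsub>F\<^esub>" "\<zero>\<^bsub>?T\<^esub>"] ev_c[of "\<zero>\<^bsub>?T\<^esub>"] by simp
    have ev_i: "ev (\<ominus>\<^bsub>?T\<^esub> u) = \<ominus>\<^bsub>M\<^esub> ev u" if "u \<in> carrier ?T" for u
      using ev_a[of "\<ominus>\<^bsub>?T\<^esub> u" u] ev_c[of u] ev_c[of "\<ominus>\<^bsub>?T\<^esub> u"] that ev_z
      by (simp add: T.M.l_neg M.M.minus_equality)
    have ev_m: "ev (u \<ominus>\<^bsub>?T\<^esub> v) = ev u \<ominus>\<^bsub>M\<^esub> ev v" if "u \<in> carrier ?T" "v \<in> carrier ?T" for u v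
      using that by (simp add: a_minus_def ev_a ev_i)
    let ?K = "{u \<in> carrier ?T. ev u = \<zero>\<^bsub>M\<^esub>}"
    have K: "submodule ?K F ?T"
      by (rule T.submoduleI) (auto simp: ev_z ev_i ev_a ev_s)
    have "sym_relations F g n \<subseteq> ?K"
    proof
      fix r assume r: "r \<in> sym_relations F g n"
      have fM: "f xs \<in> carrier M" if "xs \<in> ?S" for xs using fE that by (rule PiE_mem)
      have fw: "ev (word F xs \<ominus>\<^bsub>?T\<^esub> u) = f xs \<ominus>\<^bsub>M\<^esub> ev u" if "xs \<in> ?S" "u \<in> carrier ?T" for xs u
        using ev_m[OF w[OF that(1)] that(2)] ev_w[OF that(1)] by simp
      have m0: "m \<ominus>\<^bsub>M\<^esub> m = \<zero>\<^bsub>M\<^esub>" if "m \<in> carrier M" for m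
        using that by (simp add: a_minus_def M.M.r_neg)
      have "ev r = \<zero>\<^bsub>M\<^esub>"
        using r unfolding sym_relations_def Let_def
      proof (elim UnE CollectE exE conjE)
        fix xs i x y
        assume *: "xs \<in> ?S" "i < n" "x \<in> carrier g" "y \<in> carrier g"
          and r: "r = word F (xs[i := x \<oplus>\<^bsub>g\<^esub> y]) \<ominus>\<^bsub>?T\<^esub> (word F (xs[i := x]) \<oplus>\<^bsub>?T\<^esub> word F (xs[i := y]))"
        have S: "xs[i := x] \<in> ?S" "xs[i := y] \<in> ?S" "xs[i := x \<oplus>\<^bsub>g\<^esub> y] \<in> ?S"
          using * by (simp_all add: vecs_upd)
        show ?thesis
          unfolding r fw[OF S(3) T.M.a_closed[OF w[OF S(1)] w[OF S(2)]]] ev_a[OF w[OF S(1)] w[OF S(2)]]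
            ev_w[OF S(1)] ev_w[OF S(2)] f1[OF *]
          by (rule m0[OF M.M.a_closed[OF fM[OF S(1)] fM[OF S(2)]]])
      next
        fix xs i a x
        assume *: "xs \<in> ?S" "i < n" "a \<in> carrier F" "x \<in> carrier g"
          and r: "r = word F (xs[i := a \<odot>\<^bsub>g\<^esub> x]) \<ominus>\<^bsub>?T\<^esub> a \<odot>\<^bsub>?T\<^esub> word F (xs[i := x])"
        have S: "xs[i := x] \<in> ?S" "xs[i := a \<odot>\<^bsub>g\<^esub> x] \<in> ?S"
          using * by (simp_all add: vecs_upd)
        show ?thesis
          unfolding r fw[OF S(2) T.smult_closed[OF *(3) w[OF S(1)]]] ev_s[OF *(3) w[OF S(1)]] ev_w[OF S(1)] f2[OF *]
          by (rule m0[OF M.smult_closed[OF *(3) fM[OF S(1)]]])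
      next
        fix xs ys
        assume *: "xs \<in> ?S" "ys \<in> ?S" "mset xs = mset ys" and r: "r = word F xs \<ominus>\<^bsub>?T\<^esub> word F ys"
        show ?thesis
          unfolding r fw[OF *(1) w[OF *(2)]] ev_w[OF *(2)] f3[OF *] by (rule m0[OF fM[OF *(2)]])
      qed
      then show "r \<in> ?K" using r sym_relations_carrier[OF g] by blast
    qed
    then have RK: "?R \<subseteq> ?K" unfolding sym_ideal_def using K by blast
    define \<phi> where "\<phi> = (\<lambda>A\<in>carrier ?Q. ev (SOME u. u \<in> A))"
    have \<phi>: "\<phi> (?cl u) = ev u" if u: "u \<in> carrier ?T" for u
    proof -
      have "(SOME v. v \<in> ?cl u) \<in> ?cl u"
        by (rule someI[of "\<lambda>v. v \<in> ?cl u", OF quot_module_self[OF T.module_axioms R u]])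
      then have v: "(SOME v. v \<in> ?cl u) \<in> carrier ?T" "(SOME v. v \<in> ?cl u) \<ominus>\<^bsub>?T\<^esub> u \<in> ?R"
        using quot_module_mem[OF T.module_axioms R u] by auto
      then have "ev (SOME v. v \<in> ?cl u) \<ominus>\<^bsub>M\<^esub> ev u = \<zero>\<^bsub>M\<^esub>" using RK ev_m[OF v(1) u] by auto
      then have "ev (SOME v. v \<in> ?cl u) = ev u"
        using M.M.minus_equality[of "ev (SOME v. v \<in> ?cl u)" "\<ominus>\<^bsub>M\<^esub> ev u"] ev_c[OF v(1)] ev_c[OF u]
        by (simp add: a_minus_def)
      then show ?thesis using clw[OF u] by (simp add: \<phi>_def)
    qed
    have "\<phi> \<in> linear_maps F ?Q M"
      unfolding linear_maps_def Qc by (auto simp: \<phi> Qa Qs ev_a ev_s ev_c)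
    moreover have "\<phi> \<in> extensional (carrier ?Q)" by (simp add: \<phi>_def)
    moreover have "f = ?res \<phi>"
      by (rule extensionalityI[of _ ?S]) (use fE in \<open>auto simp: \<phi> w ev_w PiE_def\<close>)
    ultimately show ?thesis by blast
  qed
  show ?thesis
    unfolding bij_betw_def
  proof
    show "inj_on ?res (linear_maps F ?Q M \<inter> extensional (carrier ?Q))"
      by (rule inj_onI) (use inj in blast)
    show "?res ` (linear_maps F ?Q M \<inter> extensional (carrier ?Q)) = carrier (CS F g M n)"
      using into surj by blast
  qed
qed

end

theory Submission
  imports Defs
begin

text \<open>
  A cochain \<open>c\<close> of degree \<open>p + q\<close> and filtration degree \<open>p\<close> is determined, modulo filtration degree
  \<open>p + 1\<close>, by its slices: the values on words consisting of \<open>p\<close> letters from \<open>g\<close> followed by \<open>q\<close> letters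
  from \<open>h\<close>. As \<open>c\<close> vanishes when \<open>q + 1\<close> letters lie in \<open>h\<close>, a slice depends only on the images of the
  first \<open>p\<close> letters in \<open>\<qq>\<close> (\<open>slice_map_proj\<close>), so that slicing embeds \<open>E\<^sub>0\<close> into the symmetric
  \<open>p\<close>-linear maps from \<open>\<qq>\<close> to \<open>CS\<^sup>q(h, M)\<close>. Every such map is attained: the exact sequence splits
  linearly, and a shuffle sum built from \<open>\<pi>\<close> and a linear retraction \<open>g \<rightarrow> h\<close> is a preimage
  (\<open>ex_slice_eq\<close>).

  The differentials are controlled by Cartan's formula \<open>i\<^sub>x d = L\<^sub>x + d i\<^sub>x\<close>, which is used as a recursive
  description of \<open>d\<close> on words (\<open>word_diff\<close>). Induction on words then gives \<open>L\<^sub>x d = d L\<^sub>x\<close>, \<open>d d = 0\<close>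
  and the decisive formula \<open>D_slice\<close>: on a word of letters from \<open>g\<close> followed by letters from \<open>h\<close> the
  differential is the sum of an outer one, which treats the slices as coefficients acted upon by the
  Lie derivatives, and of the differential of \<open>h\<close>. In filtration degree \<open>p\<close> only the differential of \<open>h\<close>
  survives (\<open>slice_d\<close>), hence the first page consists of the cochains of \<open>\<qq>\<close> with values in
  \<open>HS\<^sup>q(h, M)\<close>. One degree further, and modulo coboundaries of \<open>h\<close>, only the outer differential survives
  (\<open>slice_d_outer_diff\<close>), and on classes it is the differential of \<open>\<qq>\<close> (\<open>dq_\<theta>\<close>).

  Let \<open>\<theta>\<close> send a cochain of filtration degree \<open>p\<close> with cocycle slices to the classes of its slices. Over a
  field the maps from cocycles to classes and from cochains to coboundaries have linear sections
  (\<open>linear_section\<close>). Therefore every cochain of \<open>\<qq>\<close> with values in \<open>HS\<^sup>q(h, M)\<close> is of the form \<open>\<theta> c\<close>,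
  and slices with values in coboundaries can be removed by adding a coboundary (\<open>ex_correction\<close>).
  It follows that \<open>\<theta>\<close> maps the numerator of the second page onto the cocycles of \<open>\<qq>\<close>, and that the
  preimage of the coboundaries of \<open>\<qq>\<close> is exactly its denominator.

  The action of \<open>\<qq>\<close> on \<open>HS\<^sup>q(h, M)\<close> needs no separate calculation. Extend a cochain of \<open>h\<close> to one of \<open>g\<close>;
  then \<open>D_slice\<close> for words with a single letter from \<open>g\<close> expresses its Lie derivatives through the
  differential of \<open>g\<close>, up to coboundaries, and the properties of the action come from \<open>d d = 0\<close>.
\<close>

section \<open>Vector spaces in characteristic two\<close>

locale char2_space = field F + module F V
  for F :: "('f, 'x) ring_scheme" and V :: "('f, 'v, 'y) module_scheme" +
  assumes char_2: "\<one>\<^bsub>F\<^esub> \<oplus>\<^bsub>F\<^esub> \<one>\<^bsub>F\<^esub> = \<zero>\<^bsub>F\<^esub>"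
begin

lemma module_V: "module F V" ..

lemma add_self: "v \<in> carrier V \<Longrightarrow> v \<oplus>\<^bsub>V\<^esub> v = \<zero>\<^bsub>V\<^esub>"
  using smult_l_distr[of "\<one>\<^bsub>F\<^esub>" "\<one>\<^bsub>F\<^esub>" v] by (simp add: char_2)

lemma add_self_left: "v \<in> carrier V \<Longrightarrow> w \<in> carrier V \<Longrightarrow> v \<oplus>\<^bsub>V\<^esub> (v \<oplus>\<^bsub>V\<^esub> w) = w"
  by (simp add: add_self M.a_assoc[symmetric])

lemma neg_eq: "v \<in> carrier V \<Longrightarrow> \<ominus>\<^bsub>V\<^esub> v = v"
  by (rule M.minus_equality) (simp_all add: add_self)

lemma minus_eq_add: "v \<in> carrier V \<Longrightarrow> w \<in> carrier V \<Longrightarrow> v \<ominus>\<^bsub>V\<^esub> w = v \<oplus>\<^bsub>V\<^esub> w"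
  by (simp add: a_minus_def neg_eq)

lemma add_eq_zero_iff: "v \<in> carrier V \<Longrightarrow> w \<in> carrier V \<Longrightarrow> v \<oplus>\<^bsub>V\<^esub> w = \<zero>\<^bsub>V\<^esub> \<longleftrightarrow> v = w"
  using M.minus_equality[of v w] by (auto simp: neg_eq add_self)

lemmas char2_simps = add_self add_self_left M.a_assoc M.a_comm M.a_lcomm

lemma submoduleI_char2:
  assumes "N \<subseteq> carrier V" "\<zero>\<^bsub>V\<^esub> \<in> N" "\<And>v w. v \<in> N \<Longrightarrow> w \<in> N \<Longrightarrow> v \<oplus>\<^bsub>V\<^esub> w \<in> N"
    "\<And>a v. a \<in> carrier F \<Longrightarrow> v \<in> N \<Longrightarrow> a \<odot>\<^bsub>V\<^esub> v \<in> N"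
  shows "submodule N F V"
  by (rule submoduleI) (use assms in \<open>auto simp: neg_eq subset_iff\<close>)

lemma submoduleD:
  assumes "submodule N F V"
  shows "N \<subseteq> carrier V" "\<zero>\<^bsub>V\<^esub> \<in> N" "\<And>v w. v \<in> N \<Longrightarrow> w \<in> N \<Longrightarrow> v \<oplus>\<^bsub>V\<^esub> w \<in> N"
    "\<And>a v. a \<in> carrier F \<Longrightarrow> v \<in> N \<Longrightarrow> a \<odot>\<^bsub>V\<^esub> v \<in> N"
proof -
  interpret N: submodule N F V by fact
  show "\<zero>\<^bsub>V\<^esub> \<in> N" using N.one_closed by simp
qed (use submoduleE[OF assms] in auto)

lemma char2_space_submodule: "submodule N F V \<Longrightarrow> char2_space F (V\<lparr>carrier := N\<rparr>)"
  by (intro char2_space.intro char2_space_axioms.intro submodule.submodule_is_module char_2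
      module_axioms field_axioms)

lemma submodule_sub:
  assumes "submodule Z F V" "submodule N F V" "N \<subseteq> Z"
  shows "submodule N F (V\<lparr>carrier := Z\<rparr>)"
proof -
  interpret Z: char2_space F "V\<lparr>carrier := Z\<rparr>" by (rule char2_space_submodule) fact
  show ?thesis
    by (rule Z.submoduleI_char2) (use submoduleD[OF assms(2)] assms(3) in auto)
qed

lemma sum_submodule:
  assumes A: "submodule A F V" and B: "submodule B F V"
  shows "submodule (A <+>\<^bsub>V\<^esub> B) F V"
proof (rule submoduleI_char2)
  note A' = submoduleD[OF A] and B' = submoduleD[OF B]
  have Ac: "\<And>a. a \<in> A \<Longrightarrow> a \<in> carrier V" and Bc: "\<And>b. b \<in> B \<Longrightarrow> b \<in> carrier V" using A'(1) B'(1) by auto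
  show "A <+>\<^bsub>V\<^esub> B \<subseteq> carrier V" using Ac Bc by (auto simp: set_add_def')
  show "\<zero>\<^bsub>V\<^esub> \<in> A <+>\<^bsub>V\<^esub> B" using A'(2) B'(2) by (force simp: set_add_def')
  show "v \<oplus>\<^bsub>V\<^esub> w \<in> A <+>\<^bsub>V\<^esub> B" if vw: "v \<in> A <+>\<^bsub>V\<^esub> B" "w \<in> A <+>\<^bsub>V\<^esub> B" for v w
  proof -
    obtain a b a' b' where *: "a \<in> A" "b \<in> B" "v = a \<oplus>\<^bsub>V\<^esub> b" "a' \<in> A" "b' \<in> B" "w = a' \<oplus>\<^bsub>V\<^esub> b'"
      using vw by (auto simp: set_add_def')
    then have "v \<oplus>\<^bsub>V\<^esub> w = (a \<oplus>\<^bsub>V\<^esub> a') \<oplus>\<^bsub>V\<^esub> (b \<oplus>\<^bsub>V\<^esub> b')" using Ac Bc by (simp add: M.a_ac)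
    then show ?thesis using A'(3)[of a a'] B'(3)[of b b'] * by (auto simp: set_add_def')
  qed
  show "c \<odot>\<^bsub>V\<^esub> v \<in> A <+>\<^bsub>V\<^esub> B" if cv: "c \<in> carrier F" "v \<in> A <+>\<^bsub>V\<^esub> B" for c v
  proof -
    obtain a b where *: "a \<in> A" "b \<in> B" "v = a \<oplus>\<^bsub>V\<^esub> b" using cv by (auto simp: set_add_def')
    then have "c \<odot>\<^bsub>V\<^esub> v = c \<odot>\<^bsub>V\<^esub> a \<oplus>\<^bsub>V\<^esub> c \<odot>\<^bsub>V\<^esub> b" using Ac Bc cv(1) by (simp add: smult_r_distr)
    then show ?thesis using A'(4)[of c a] B'(4)[of c b] * cv(1) by (auto simp: set_add_def')
  qed
qed

lemma coset_eq_iff: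
  assumes N: "submodule N F V" and v: "v \<in> carrier V" and w: "w \<in> carrier V"
  shows "N +>\<^bsub>V\<^esub> v = N +>\<^bsub>V\<^esub> w \<longleftrightarrow> v \<oplus>\<^bsub>V\<^esub> w \<in> N"
proof
  assume "N +>\<^bsub>V\<^esub> v = N +>\<^bsub>V\<^esub> w"
  then have "v \<in> N +>\<^bsub>V\<^esub> w" using quot_module_self[OF module_V N v] by simp
  from quot_module_mem[OF module_V N w this] show "v \<oplus>\<^bsub>V\<^esub> w \<in> N" using v w by (simp add: minus_eq_add)
next
  assume "v \<oplus>\<^bsub>V\<^esub> w \<in> N"
  then show "N +>\<^bsub>V\<^esub> v = N +>\<^bsub>V\<^esub> w"
    by (intro quot_module_eqI[OF module_V N w v]) (simp add: v w minus_eq_add)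
qed

lemma mem_coset_iff:
  assumes N: "submodule N F V" and v: "v \<in> carrier V"
  shows "w \<in> N +>\<^bsub>V\<^esub> v \<longleftrightarrow> w \<in> carrier V \<and> w \<oplus>\<^bsub>V\<^esub> v \<in> N"
  using quot_module_mem[OF module_V N v, of w] coset_eq_iff[OF N, of w v] v
    quot_module_self[OF module_V N, of w] by (auto simp: minus_eq_add)

lemma quot_zero: "submodule N F V \<Longrightarrow> N +>\<^bsub>V\<^esub> \<zero>\<^bsub>V\<^esub> = \<zero>\<^bsub>quot_module V N\<^esub>"
  by (simp add: quot_module_def M.a_coset_add_zero submoduleD(1))

lemma coset_eq_zero_iff:
  assumes "submodule N F V" "v \<in> carrier V"
  shows "N +>\<^bsub>V\<^esub> v = \<zero>\<^bsub>quot_module V N\<^esub> \<longleftrightarrow> v \<in> N"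
  using coset_eq_iff[OF assms M.zero_closed] assms by (simp add: quot_zero)

lemma char2_space_quot:
  assumes N: "submodule N F V"
  shows "char2_space F (quot_module V N)"
proof -
  let ?Q = "quot_module V N"
  note Q = quot_module_carrier[OF module_V N] quot_module_add[OF module_V N]
    quot_module_smult[OF module_V N] quot_zero[OF N, symmetric]
  have rep: thesis if "A \<in> carrier ?Q" "\<And>v. v \<in> carrier V \<Longrightarrow> A = N +>\<^bsub>V\<^esub> v \<Longrightarrow> thesis" for A thesis
    using that Q(1) by blast
  have c: "N +>\<^bsub>V\<^esub> v \<in> carrier ?Q" if "v \<in> carrier V" for v using that Q(1) by blast
  have "abelian_group ?Q"
  proof (rule abelian_groupI)
    fix A B assume "A \<in> carrier ?Q" "B \<in> carrier ?Q"
    then show "A \<oplus>\<^bsub>?Q\<^esub> B \<in> carrier ?Q" "A \<oplus>\<^bsub>?Q\<^esub> B = B \<oplus>\<^bsub>?Q\<^esub> A"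
      by (auto elim!: rep simp: Q(2) c M.a_comm)
  next
    fix A B C assume "A \<in> carrier ?Q" "B \<in> carrier ?Q" "C \<in> carrier ?Q"
    then show "A \<oplus>\<^bsub>?Q\<^esub> B \<oplus>\<^bsub>?Q\<^esub> C = A \<oplus>\<^bsub>?Q\<^esub> (B \<oplus>\<^bsub>?Q\<^esub> C)"
      by (auto elim!: rep simp: Q(2) c M.a_assoc)
  next
    fix A assume A: "A \<in> carrier ?Q"
    then show "\<zero>\<^bsub>?Q\<^esub> \<oplus>\<^bsub>?Q\<^esub> A = A" by (auto elim!: rep simp: Q(2,4))
    show "\<exists>B\<in>carrier ?Q. B \<oplus>\<^bsub>?Q\<^esub> A = \<zero>\<^bsub>?Q\<^esub>"
      using A by (intro bexI[of _ A]) (auto elim!: rep simp: Q(2,4) add_self)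
  qed (simp add: Q(4) c)
  then have "module F ?Q"
    by (rule moduleI[OF is_cring])
      (auto elim!: rep simp: Q(2,3) c smult_l_distr smult_r_distr smult_assoc1)
  then show ?thesis
    by (intro char2_space.intro char2_space_axioms.intro char_2 field_axioms)
qed

end

lemma coset_carrier_update [simp]: "N +>\<^bsub>V\<lparr>carrier := Z\<rparr>\<^esub> v = N +>\<^bsub>V\<^esub> v"
  by (simp add: a_r_coset_def')

lemma linear_maps_zero:
  assumes "module F V" "module F W" "T \<in> linear_maps F V W"
  shows "T \<zero>\<^bsub>V\<^esub> = \<zero>\<^bsub>W\<^esub>"
proof -
  interpret V: module F V by fact
  interpret W: module F W by fact
  show ?thesis using linear_mapsD(3)[OF assms(3), of "\<zero>\<^bsub>F\<^esub>" "\<zero>\<^bsub>V\<^esub>"] linear_mapsD(1)[OF assms(3), of "\<zero>\<^bsub>V\<^esub>"]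
    by simp
qed

lemma linear_mapsI:
  assumes "\<And>u. u \<in> carrier V \<Longrightarrow> f u \<in> carrier W"
    and "\<And>u v. u \<in> carrier V \<Longrightarrow> v \<in> carrier V \<Longrightarrow> f (u \<oplus>\<^bsub>V\<^esub> v) = f u \<oplus>\<^bsub>W\<^esub> f v"
    and "\<And>a u. a \<in> carrier F \<Longrightarrow> u \<in> carrier V \<Longrightarrow> f (a \<odot>\<^bsub>V\<^esub> u) = a \<odot>\<^bsub>W\<^esub> f u"
  shows "f \<in> linear_maps F V W"
  using assms unfolding linear_maps_def by blast

text \<open>The first isomorphism theorem, for a target that is itself a quotient: a surjection onto \<open>W\<close>
  under which \<open>N\<close> is the preimage of \<open>K\<close>.\<close>

lemma quot_iso_of_surjective:
  assumes "char2_space F V" "char2_space F W"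
    and N: "submodule N F V" and K: "submodule K F W"
    and \<theta>: "\<theta> \<in> linear_maps F V W" and surj: "\<And>w. w \<in> carrier W \<Longrightarrow> \<exists>v\<in>carrier V. \<theta> v = w"
    and ker: "\<And>v. v \<in> carrier V \<Longrightarrow> \<theta> v \<in> K \<longleftrightarrow> v \<in> N"
  shows "\<exists>\<Phi>\<in>linear_isos F (quot_module V N) (quot_module W K).
    \<forall>v\<in>carrier V. \<Phi> (N +>\<^bsub>V\<^esub> v) = K +>\<^bsub>W\<^esub> \<theta> v"
proof -
  interpret V: char2_space F V by fact
  interpret W: char2_space F W by fact
  note Q = quot_module_carrier[OF V.module_V N] quot_module_add[OF V.module_V N]
    quot_module_smult[OF V.module_V N]
  note R = quot_module_carrier[OF W.module_V K] quot_module_add[OF W.module_V K]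
    quot_module_smult[OF W.module_V K]
  note [simp] = linear_mapsD[OF \<theta>]
  have eq: "K +>\<^bsub>W\<^esub> \<theta> v = K +>\<^bsub>W\<^esub> \<theta> w \<longleftrightarrow> N +>\<^bsub>V\<^esub> v = N +>\<^bsub>V\<^esub> w"
    if "v \<in> carrier V" "w \<in> carrier V" for v w
    using that ker[of "v \<oplus>\<^bsub>V\<^esub> w"] by (simp add: V.coset_eq_iff[OF N] W.coset_eq_iff[OF K])
  define \<Phi> where "\<Phi> A = K +>\<^bsub>W\<^esub> \<theta> (SOME v. v \<in> carrier V \<and> A = N +>\<^bsub>V\<^esub> v)" for A
  have \<Phi>: "\<Phi> (N +>\<^bsub>V\<^esub> v) = K +>\<^bsub>W\<^esub> \<theta> v" if v: "v \<in> carrier V" for v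
  proof -
    let ?v = "SOME v'. v' \<in> carrier V \<and> N +>\<^bsub>V\<^esub> v = N +>\<^bsub>V\<^esub> v'"
    have "?v \<in> carrier V \<and> N +>\<^bsub>V\<^esub> v = N +>\<^bsub>V\<^esub> ?v" by (rule someI[of _ v]) (simp add: v)
    then show ?thesis unfolding \<Phi>_def using eq[OF _ v] by blast
  qed
  have "\<Phi> \<in> linear_maps F (quot_module V N) (quot_module W K)"
    by (rule linear_mapsI) (auto simp: Q R \<Phi>)
  moreover have "inj_on \<Phi> (carrier (quot_module V N))"
    by (rule inj_onI) (auto simp: Q \<Phi> eq)
  moreover have "\<Phi> ` carrier (quot_module V N) = carrier (quot_module W K)"
  proof
    show "carrier (quot_module W K) \<subseteq> \<Phi> ` carrier (quot_module V N)"
    proof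
      fix B assume "B \<in> carrier (quot_module W K)"
      then obtain w where w: "w \<in> carrier W" "B = K +>\<^bsub>W\<^esub> w" by (auto simp: R(1))
      then obtain v where "v \<in> carrier V" "\<theta> v = w" using surj by blast
      then show "B \<in> \<Phi> ` carrier (quot_module V N)" using w \<Phi>[of v] by (auto simp: Q(1) image_iff)
    qed
  qed (auto simp: Q R \<Phi>)
  ultimately show ?thesis using \<Phi> unfolding linear_isos_def bij_betw_def by blast
qed

text \<open>By Zorn's lemma some subspace \<open>U\<close> is maximal among those on which \<open>T\<close> is injective. If \<open>T\<close> missed
  a vector on \<open>U\<close>, a preimage of this vector could be adjoined to \<open>U\<close>; so \<open>T\<close> is an isomorphism from \<open>U\<close>
  onto \<open>W\<close>, and its inverse is the section.\<close>

lemma linear_section: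
  assumes "char2_space F V" "char2_space F W"
    and T: "T \<in> linear_maps F V W" and surj: "\<And>w. w \<in> carrier W \<Longrightarrow> \<exists>v\<in>carrier V. T v = w"
  shows "\<exists>S\<in>linear_maps F W V. \<forall>w\<in>carrier W. T (S w) = w"
proof -
  interpret V: char2_space F V by fact
  interpret W: char2_space F W by fact
  note [simp] = linear_mapsD[OF T]
  define \<A> where "\<A> = {U. submodule U F V \<and> (\<forall>u\<in>U. T u = \<zero>\<^bsub>W\<^esub> \<longrightarrow> u = \<zero>\<^bsub>V\<^esub>)}"
  have zero: "{\<zero>\<^bsub>V\<^esub>} \<in> \<A>" unfolding \<A>_def by (auto intro: V.submoduleI_char2)
  have "\<exists>U\<in>\<A>. \<forall>X\<in>\<A>. U \<subseteq> X \<longrightarrow> X = U"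
  proof (rule subset_Zorn_nonempty)
    fix \<C> assume ne: "\<C> \<noteq> {}" and ch: "subset.chain \<A> \<C>"
    have sub: "submodule U F V" if "U \<in> \<C>" for U using ch that unfolding subset_chain_def \<A>_def by blast
    note D = V.submoduleD[OF sub]
    have "submodule (\<Union>\<C>) F V"
    proof (rule V.submoduleI_char2)
      show "v \<oplus>\<^bsub>V\<^esub> w \<in> \<Union>\<C>" if "v \<in> \<Union>\<C>" "w \<in> \<Union>\<C>" for v w
      proof -
        from that obtain X Y where XY: "X \<in> \<C>" "Y \<in> \<C>" "v \<in> X" "w \<in> Y" by blast
        then have "X \<subseteq> Y \<or> Y \<subseteq> X" using ch unfolding subset_chain_def by blast
        then show ?thesis using XY D(3) by blast
      qed
      show "\<Union>\<C> \<subseteq> carrier V" using D(1) by blast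
      show "\<zero>\<^bsub>V\<^esub> \<in> \<Union>\<C>" using ne D(2) by blast
      show "a \<odot>\<^bsub>V\<^esub> v \<in> \<Union>\<C>" if "a \<in> carrier F" "v \<in> \<Union>\<C>" for a v
        using that D(4) by blast
    qed
    then show "\<Union>\<C> \<in> \<A>" using ch unfolding subset_chain_def \<A>_def by blast
  qed (use zero in blast)
  then obtain U where U: "U \<in> \<A>" and max: "\<And>X. X \<in> \<A> \<Longrightarrow> U \<subseteq> X \<Longrightarrow> X = U" by blast
  have sub: "submodule U F V" and inj: "\<And>u. u \<in> U \<Longrightarrow> T u = \<zero>\<^bsub>W\<^esub> \<Longrightarrow> u = \<zero>\<^bsub>V\<^esub>"
    using U unfolding \<A>_def by auto
  note D = V.submoduleD[OF sub]
  have UV: "u \<in> carrier V" if "u \<in> U" for u using D(1) that by blast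
  have onto: "\<exists>u\<in>U. T u = w" if w: "w \<in> carrier W" for w
  proof (rule ccontr)
    assume no: "\<not> (\<exists>u\<in>U. T u = w)"
    obtain x where x: "x \<in> carrier V" "T x = w" using surj[OF w] by blast
    let ?X = "{u \<oplus>\<^bsub>V\<^esub> a \<odot>\<^bsub>V\<^esub> x | u a. u \<in> U \<and> a \<in> carrier F}"
    have "submodule ?X F V"
    proof (rule V.submoduleI_char2)
      show "?X \<subseteq> carrier V" using UV x by auto
      have "\<zero>\<^bsub>V\<^esub> = \<zero>\<^bsub>V\<^esub> \<oplus>\<^bsub>V\<^esub> \<zero>\<^bsub>F\<^esub> \<odot>\<^bsub>V\<^esub> x" using x by simp
      then show "\<zero>\<^bsub>V\<^esub> \<in> ?X" using D(2) by blast
    next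
      fix v w assume "v \<in> ?X" "w \<in> ?X"
      then obtain u a u' a' where *: "v = u \<oplus>\<^bsub>V\<^esub> a \<odot>\<^bsub>V\<^esub> x" "w = u' \<oplus>\<^bsub>V\<^esub> a' \<odot>\<^bsub>V\<^esub> x"
        "u \<in> U" "a \<in> carrier F" "u' \<in> U" "a' \<in> carrier F" by blast
      then have "v \<oplus>\<^bsub>V\<^esub> w = (u \<oplus>\<^bsub>V\<^esub> u') \<oplus>\<^bsub>V\<^esub> (a \<oplus>\<^bsub>F\<^esub> a') \<odot>\<^bsub>V\<^esub> x"
        using UV x by (simp add: V.smult_l_distr V.M.a_ac)
      then show "v \<oplus>\<^bsub>V\<^esub> w \<in> ?X" using * D(3) by blast
    next
      fix b v assume b: "b \<in> carrier F" and "v \<in> ?X"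
      then obtain u a where *: "v = u \<oplus>\<^bsub>V\<^esub> a \<odot>\<^bsub>V\<^esub> x" "u \<in> U" "a \<in> carrier F" by blast
      then have "b \<odot>\<^bsub>V\<^esub> v = b \<odot>\<^bsub>V\<^esub> u \<oplus>\<^bsub>V\<^esub> (b \<otimes>\<^bsub>F\<^esub> a) \<odot>\<^bsub>V\<^esub> x"
        using UV x b by (simp add: V.smult_r_distr V.smult_assoc1)
      then show "b \<odot>\<^bsub>V\<^esub> v \<in> ?X" using * b D(4) by blast
    qed
    moreover have "v = \<zero>\<^bsub>V\<^esub>" if vX: "v \<in> ?X" and v0: "T v = \<zero>\<^bsub>W\<^esub>" for v
    proof -
      obtain u a where *: "v = u \<oplus>\<^bsub>V\<^esub> a \<odot>\<^bsub>V\<^esub> x" "u \<in> U" "a \<in> carrier F" using vX by blast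
      have eq: "T u = a \<odot>\<^bsub>W\<^esub> w"
        using v0 * UV x w by (simp add: W.add_eq_zero_iff)
      \<comment> \<open>Otherwise \<open>u\<close>, divided by \<open>a\<close>, would be a preimage of \<open>w\<close> in \<open>U\<close>.\<close>
      have "a = \<zero>\<^bsub>F\<^esub>"
      proof (rule ccontr)
        assume "a \<noteq> \<zero>\<^bsub>F\<^esub>"
        then have a: "a \<in> Units F" using * V.field_Units by blast
        then have "T (inv\<^bsub>F\<^esub> a \<odot>\<^bsub>V\<^esub> u) = w"
          using * UV w by (simp add: eq W.smult_assoc1[symmetric])
        then show False using no D(4)[of "inv\<^bsub>F\<^esub> a" u] * a by auto
      qed
      then have "T u = \<zero>\<^bsub>W\<^esub>" using eq w by simp
      then show ?thesis using inj[OF *(2)] * \<open>a = \<zero>\<^bsub>F\<^esub>\<close> x by simp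
    qed
    ultimately have "?X \<in> \<A>" unfolding \<A>_def by blast
    moreover have "u \<in> ?X" if "u \<in> U" for u
    proof -
      have "u = u \<oplus>\<^bsub>V\<^esub> \<zero>\<^bsub>F\<^esub> \<odot>\<^bsub>V\<^esub> x" using UV[OF that] x by simp
      then show ?thesis using that by blast
    qed
    ultimately have "?X = U" using max by blast
    moreover have "x \<in> ?X"
    proof -
      have "x = \<zero>\<^bsub>V\<^esub> \<oplus>\<^bsub>V\<^esub> \<one>\<^bsub>F\<^esub> \<odot>\<^bsub>V\<^esub> x" using x by simp
      then show ?thesis using D(2) by blast
    qed
    ultimately show False using no x by blast
  qed
  define S where "S w = (SOME u. u \<in> U \<and> T u = w)" for w
  have S: "S w \<in> U" "T (S w) = w" if "w \<in> carrier W" for w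
    using someI_ex[OF onto[OF that, unfolded Bex_def]] unfolding S_def by auto
  have uniq: "u = u'" if "u \<in> U" "u' \<in> U" "T u = T u'" for u u'
    using inj[of "u \<oplus>\<^bsub>V\<^esub> u'"] that D(3)[of u u'] UV
    by (simp add: V.add_eq_zero_iff W.add_self)
  have "S \<in> linear_maps F W V"
  proof (rule linear_mapsI)
    show "S (v \<oplus>\<^bsub>W\<^esub> w) = S v \<oplus>\<^bsub>V\<^esub> S w" if "v \<in> carrier W" "w \<in> carrier W" for v w
      by (rule uniq) (use that S UV D(3) in auto)
    show "S (a \<odot>\<^bsub>W\<^esub> v) = a \<odot>\<^bsub>V\<^esub> S v" if "a \<in> carrier F" "v \<in> carrier W" for a v
      by (rule uniq) (use that S UV D(4) in auto)
  qed (use S UV in auto)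
  then show ?thesis using S by blast
qed

section \<open>Symmetric multilinear functions on words\<close>

definition words :: "'a set \<Rightarrow> 'a list set" where
  "words S = {xs. set xs \<subseteq> S}"

abbreviation "gwords g \<equiv> words (carrier g)"

lemma words_simps [simp]: "[] \<in> words S" "x # xs \<in> words S \<longleftrightarrow> x \<in> S \<and> xs \<in> words S"
  "xs @ ys \<in> words S \<longleftrightarrow> xs \<in> words S \<and> ys \<in> words S"
  by (auto simp: words_def)

lemma in_words_iff: "xs \<in> words S \<longleftrightarrow> (\<forall>x\<in>set xs. x \<in> S)"
  by (auto simp: words_def)

lemma words_update: "xs \<in> words S \<Longrightarrow> x \<in> S \<Longrightarrow> xs[i := x] \<in> words S"
  by (auto simp: words_def dest: set_update_subset_insert[THEN subsetD])

lemma words_nth: "xs \<in> words S \<Longrightarrow> i < length xs \<Longrightarrow> xs ! i \<in> S"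
  by (auto simp: words_def)

text \<open>Functions on words of every length are considered, so that inductions on words need no bookkeeping of
  degrees. Linearity in the first letter is enough, because the symmetry moves every other letter there.\<close>

definition sym_multilin ::
    "('f, 'x) ring_scheme \<Rightarrow> ('f, 'g, 'y) module_scheme \<Rightarrow> ('f, 'm, 'z) module_scheme \<Rightarrow> ('g list \<Rightarrow> 'm) \<Rightarrow> bool" where
  "sym_multilin F g M f \<longleftrightarrow>
     (\<forall>xs\<in>gwords g. f xs \<in> carrier M) \<and>
     (\<forall>xs\<in>gwords g. \<forall>ys. mset xs = mset ys \<longrightarrow> f xs = f ys) \<and>
     (\<forall>xs\<in>gwords g. \<forall>x\<in>carrier g. \<forall>y\<in>carrier g.
        f ((x \<oplus>\<^bsub>g\<^esub> y) # xs) = f (x # xs) \<oplus>\<^bsub>M\<^esub> f (y # xs)) \<and>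
     (\<forall>xs\<in>gwords g. \<forall>a\<in>carrier F. \<forall>x\<in>carrier g. f ((a \<odot>\<^bsub>g\<^esub> x) # xs) = a \<odot>\<^bsub>M\<^esub> f (x # xs))"

lemma sym_multilinI:
  assumes "\<And>xs. xs \<in> gwords g \<Longrightarrow> f xs \<in> carrier M"
    and "\<And>xs ys. xs \<in> gwords g \<Longrightarrow> mset xs = mset ys \<Longrightarrow> f xs = f ys"
    and "\<And>xs x y. xs \<in> gwords g \<Longrightarrow> x \<in> carrier g \<Longrightarrow> y \<in> carrier g \<Longrightarrow>
      f ((x \<oplus>\<^bsub>g\<^esub> y) # xs) = f (x # xs) \<oplus>\<^bsub>M\<^esub> f (y # xs)"
    and "\<And>xs a x. xs \<in> gwords g \<Longrightarrow> a \<in> carrier F \<Longrightarrow> x \<in> carrier g \<Longrightarrow>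
      f ((a \<odot>\<^bsub>g\<^esub> x) # xs) = a \<odot>\<^bsub>M\<^esub> f (x # xs)"
  shows "sym_multilin F g M f"
  using assms unfolding sym_multilin_def by blast

lemma sym_multilinD:
  assumes "sym_multilin F g M f"
  shows "\<And>xs. xs \<in> gwords g \<Longrightarrow> f xs \<in> carrier M"
    and "\<And>xs ys. xs \<in> gwords g \<Longrightarrow> mset xs = mset ys \<Longrightarrow> f xs = f ys"
    and "\<And>xs x y. xs \<in> gwords g \<Longrightarrow> x \<in> carrier g \<Longrightarrow> y \<in> carrier g \<Longrightarrow>
      f ((x \<oplus>\<^bsub>g\<^esub> y) # xs) = f (x # xs) \<oplus>\<^bsub>M\<^esub> f (y # xs)"
    and "\<And>xs a x. xs \<in> gwords g \<Longrightarrow> a \<in> carrier F \<Longrightarrow> x \<in> carrier g \<Longrightarrow>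
      f ((a \<odot>\<^bsub>g\<^esub> x) # xs) = a \<odot>\<^bsub>M\<^esub> f (x # xs)"
  using assms unfolding sym_multilin_def by blast+

lemma words_mset_eq: "xs \<in> words S \<Longrightarrow> mset xs = mset ys \<Longrightarrow> ys \<in> words S"
  by (metis in_words_iff set_mset_mset)

lemma vecs_iff: "xs \<in> vecs g n \<longleftrightarrow> xs \<in> gwords g \<and> length xs = n"
  by (auto simp: vecs_def in_words_iff)

lemma vecs_mset_eq: "xs \<in> vecs g n \<Longrightarrow> mset xs = mset ys \<Longrightarrow> ys \<in> vecs g n"
  unfolding vecs_iff by (metis words_mset_eq mset_eq_length)

lemma mset_list_update_nths:
  "i < length xs \<Longrightarrow> mset (xs[i := x]) = add_mset x (mset (nths xs (- {i})))"
proof (induction xs arbitrary: i)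
  case (Cons y xs)
  have "{j. Suc j \<in> - {Suc k}} = - {k}" "{j. Suc j \<in> - {0}} = UNIV" for k by auto
  then show ?case using Cons by (cases i) (auto simp: nths_Cons nths_all)
qed simp

lemma mset_list_update_fst:
  "i < length xs \<Longrightarrow> mset (xs[i := x]) = mset (x # nths xs (- {i}))"
  by (simp add: mset_list_update_nths)

lemma words_nths: "xs \<in> words S \<Longrightarrow> nths xs I \<in> words S"
  using set_nths_subset[of xs I] by (auto simp: in_words_iff)

text \<open>The head of the second word is brought to the second place of the first word by permuting the tail,
  and then to the front by a swap.\<close>

lemma symmetric_by_swaps:
  assumes swap: "\<And>x y zs. x \<in> S \<Longrightarrow> y \<in> S \<Longrightarrow> zs \<in> words S \<Longrightarrow> f (x # y # zs) = f (y # x # zs)"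
    and tail: "\<And>x zs zs'. x \<in> S \<Longrightarrow> zs \<in> words S \<Longrightarrow> length zs < length xs \<Longrightarrow> mset zs = mset zs' \<Longrightarrow>
      f (x # zs) = f (x # zs')"
    and xs: "xs \<in> words S" and eq: "mset xs = mset ys"
  shows "f xs = f ys"
proof (cases xs)
  case Nil
  then show ?thesis using eq by simp
next
  case (Cons x us)
  then obtain y vs where ys: "ys = y # vs" using eq by (cases ys) auto
  have yv: "y \<in> S" "vs \<in> words S" using words_mset_eq[OF xs eq] ys by auto
  have xu: "x \<in> S" "us \<in> words S" using xs Cons by auto
  have len: "length vs = length us" using mset_eq_length[OF eq] Cons ys by simp
  show ?thesis
  proof (cases "x = y")
    case True
    then show ?thesis using tail[of x us vs] xu eq Cons ys by simp
  next
    case False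
    then have "x \<in> set vs" using eq Cons ys
      by (metis list.set_intros(1) mset_eq_setD set_ConsD)
    define ws where "ws = remove1 x vs"
    have ws: "ws \<in> words S" using yv set_remove1_subset[of x vs] by (auto simp: ws_def in_words_iff)
    have vs: "mset vs = mset (x # ws)" using \<open>x \<in> set vs\<close> by (simp add: ws_def)
    then have us: "mset us = mset (y # ws)" using eq Cons ys by (simp add: add_mset_commute)
    have "f xs = f (x # y # ws)" using tail[OF xu _ us] Cons by simp
    also have "\<dots> = f (y # x # ws)" using swap xu yv ws by blast
    also have "\<dots> = f ys" using tail[OF yv _ vs] Cons ys len by simp
    finally show ?thesis .
  qed
qed

lemma sym_multilin_Cons:
  assumes "sym_multilin F g M f" "x \<in> carrier g" "module F g"
  shows "sym_multilin F g M (\<lambda>xs. f (x # xs))"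
proof (rule sym_multilinI)
  note D = sym_multilinD[OF assms(1)]
  have c: "f (x # y # xs) = f (y # x # xs)" if "xs \<in> gwords g" "y \<in> carrier g" for xs y
    using D(2)[of "x # y # xs" "y # x # xs"] that assms(2) by simp
  interpret g: module F g by fact
  show "f (x # xs) \<in> carrier M" if "xs \<in> gwords g" for xs using D(1) that assms(2) by simp
  show "f (x # xs) = f (x # ys)" if "xs \<in> gwords g" "mset xs = mset ys" for xs ys
    using D(2)[of "x # xs" "x # ys"] that assms(2) by simp
  show "f (x # (y \<oplus>\<^bsub>g\<^esub> z) # xs) = f (x # y # xs) \<oplus>\<^bsub>M\<^esub> f (x # z # xs)"
    if "xs \<in> gwords g" "y \<in> carrier g" "z \<in> carrier g" for xs y z
    using that assms(2) c[of xs y] c[of xs z] c[of xs "y \<oplus>\<^bsub>g\<^esub> z"] D(3)[of "x # xs" y z] g.a_closed by simp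
  show "f (x # (a \<odot>\<^bsub>g\<^esub> y) # xs) = a \<odot>\<^bsub>M\<^esub> f (x # y # xs)"
    if "xs \<in> gwords g" "a \<in> carrier F" "y \<in> carrier g" for xs a y
    using that assms(2) c[of xs y] c[of xs "a \<odot>\<^bsub>g\<^esub> y"] D(4)[of "x # xs" a y] g.smult_closed by simp
qed

section \<open>The differential by recursion on words\<close>

text \<open>The Lie derivative for an endomorphism \<open>a\<close> of the coefficients and an endomorphism \<open>\<delta>\<close> of the arguments:
  \<open>i\<^sub>y L = L i\<^sub>y + i\<^bsub>\<delta> y\<^esub>\<close>, where \<open>i\<^sub>y\<close> inserts \<open>y\<close> as the first letter.\<close>

fun word_lie :: "('m, 'z) ring_scheme \<Rightarrow> ('m \<Rightarrow> 'm) \<Rightarrow> ('g \<Rightarrow> 'g) \<Rightarrow> ('g list \<Rightarrow> 'm) \<Rightarrow> 'g list \<Rightarrow> 'm" where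
  "word_lie M a \<delta> f [] = a (f [])"
| "word_lie M a \<delta> f (y # ys) = f (\<delta> y # ys) \<oplus>\<^bsub>M\<^esub> word_lie M a \<delta> (\<lambda>zs. f (y # zs)) ys"

text \<open>Cartan's formula \<open>i\<^sub>x d = L\<^sub>x + d i\<^sub>x\<close>, free of signs in characteristic two. Here a bracket takes the
  place of its second argument; for symmetric functions this agrees with putting it first, see
  \<open>word_diff_eq_sum\<close>.\<close>

fun word_diff :: "('m, 'z) ring_scheme \<Rightarrow> ('g \<Rightarrow> 'm \<Rightarrow> 'm) \<Rightarrow> ('g \<Rightarrow> 'g \<Rightarrow> 'g) \<Rightarrow> ('g list \<Rightarrow> 'm) \<Rightarrow> 'g list \<Rightarrow> 'm" where
  "word_diff M \<rho> \<beta> f [] = \<zero>\<^bsub>M\<^esub>"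
| "word_diff M \<rho> \<beta> f (x # xs) = word_lie M (\<rho> x) (\<beta> x) f xs \<oplus>\<^bsub>M\<^esub> word_diff M \<rho> \<beta> (\<lambda>zs. f (x # zs)) xs"

lemma word_lie_cong:
  assumes "\<And>xs. xs \<in> words S \<Longrightarrow> length xs = length ys \<Longrightarrow> f xs = f' xs" "\<delta> \<in> S \<rightarrow> S" "ys \<in> words S"
  shows "word_lie M a \<delta> f ys = word_lie M a \<delta> f' ys"
  using assms
proof (induction ys arbitrary: f f')
  case (Cons y ys)
  have "word_lie M a \<delta> (\<lambda>zs. f (y # zs)) ys = word_lie M a \<delta> (\<lambda>zs. f' (y # zs)) ys"
    by (rule Cons.IH) (use Cons.prems in auto)
  moreover have "f (\<delta> y # ys) = f' (\<delta> y # ys)" by (rule Cons.prems(1)) (use Cons.prems in auto)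
  ultimately show ?case by simp
qed simp

lemma word_diff_cong:
  assumes "\<And>xs. xs \<in> words S \<Longrightarrow> Suc (length xs) = length ys \<Longrightarrow> f xs = f' xs" "\<beta> \<in> S \<rightarrow> S \<rightarrow> S" "ys \<in> words S"
  shows "word_diff M \<rho> \<beta> f ys = word_diff M \<rho> \<beta> f' ys"
  using assms
proof (induction ys arbitrary: f f')
  case (Cons y ys)
  have "word_diff M \<rho> \<beta> (\<lambda>zs. f (y # zs)) ys = word_diff M \<rho> \<beta> (\<lambda>zs. f' (y # zs)) ys"
    by (rule Cons.IH) (use Cons.prems in auto)
  moreover have "word_lie M (\<rho> y) (\<beta> y) f ys = word_lie M (\<rho> y) (\<beta> y) f' ys"
    by (rule word_lie_cong[of S]) (use Cons.prems in auto)
  ultimately show ?case by simp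
qed simp

context abelian_monoid
begin

lemma word_lie_closed:
  assumes "a \<in> carrier G \<rightarrow> carrier G" "\<delta> \<in> S \<rightarrow> S" "f \<in> words S \<rightarrow> carrier G" "ys \<in> words S"
  shows "word_lie G a \<delta> f ys \<in> carrier G"
  using assms
proof (induction ys arbitrary: f)
  case (Cons y ys)
  have "word_lie G a \<delta> (\<lambda>zs. f (y # zs)) ys \<in> carrier G"
    by (rule Cons.IH) (use Cons.prems in auto)
  moreover have "f (\<delta> y # ys) \<in> carrier G" using Cons.prems by (auto simp: Pi_iff)
  ultimately show ?case by simp
qed auto

lemma word_diff_closed:
  assumes "\<rho> \<in> S \<rightarrow> carrier G \<rightarrow> carrier G" "\<beta> \<in> S \<rightarrow> S \<rightarrow> S" "f \<in> words S \<rightarrow> carrier G" "ys \<in> words S"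
  shows "word_diff G \<rho> \<beta> f ys \<in> carrier G"
  using assms
proof (induction ys arbitrary: f)
  case (Cons y ys)
  have "word_diff G \<rho> \<beta> (\<lambda>zs. f (y # zs)) ys \<in> carrier G"
    by (rule Cons.IH) (use Cons.prems in auto)
  moreover have "word_lie G (\<rho> y) (\<beta> y) f ys \<in> carrier G"
    by (rule word_lie_closed[of _ _ S]) (use Cons.prems in auto)
  ultimately show ?case by simp
qed simp

lemma word_lie_add:
  assumes "a \<in> carrier G \<rightarrow> carrier G" "\<And>u v. u \<in> carrier G \<Longrightarrow> v \<in> carrier G \<Longrightarrow> a (u \<oplus> v) = a u \<oplus> a v"
    "\<delta> \<in> S \<rightarrow> S" "f \<in> words S \<rightarrow> carrier G" "f' \<in> words S \<rightarrow> carrier G" "ys \<in> words S"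
  shows "word_lie G a \<delta> (\<lambda>xs. f xs \<oplus> f' xs) ys = word_lie G a \<delta> f ys \<oplus> word_lie G a \<delta> f' ys"
  using assms
proof (induction ys arbitrary: f f')
  case Nil
  then have "f [] \<in> carrier G" "f' [] \<in> carrier G" by auto
  then show ?case using Nil by simp
next
  case (Cons y ys)
  have "word_lie G a \<delta> (\<lambda>zs. f (y # zs) \<oplus> f' (y # zs)) ys = word_lie G a \<delta> (\<lambda>zs. f (y # zs)) ys
      \<oplus> word_lie G a \<delta> (\<lambda>zs. f' (y # zs)) ys"
    by (rule Cons.IH) (use Cons.prems in auto)
  moreover have "f (\<delta> y # ys) \<in> carrier G" "f' (\<delta> y # ys) \<in> carrier G" using Cons.prems by (auto simp: Pi_iff)
  moreover have "word_lie G a \<delta> (\<lambda>zs. f (y # zs)) ys \<in> carrier G" "word_lie G a \<delta> (\<lambda>zs. f' (y # zs)) ys \<in> carrier G"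
    by (rule word_lie_closed[of _ _ S]; use Cons.prems in auto)+
  ultimately show ?case by (simp add: a_ac)
qed

lemma word_diff_add:
  assumes "\<rho> \<in> S \<rightarrow> carrier G \<rightarrow> carrier G"
    "\<And>x u v. x \<in> S \<Longrightarrow> u \<in> carrier G \<Longrightarrow> v \<in> carrier G \<Longrightarrow> \<rho> x (u \<oplus> v) = \<rho> x u \<oplus> \<rho> x v"
    "\<beta> \<in> S \<rightarrow> S \<rightarrow> S" "f \<in> words S \<rightarrow> carrier G" "f' \<in> words S \<rightarrow> carrier G" "ys \<in> words S"
  shows "word_diff G \<rho> \<beta> (\<lambda>xs. f xs \<oplus> f' xs) ys = word_diff G \<rho> \<beta> f ys \<oplus> word_diff G \<rho> \<beta> f' ys"
  using assms
proof (induction ys arbitrary: f f')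
  case (Cons y ys)
  have "word_diff G \<rho> \<beta> (\<lambda>zs. f (y # zs) \<oplus> f' (y # zs)) ys = word_diff G \<rho> \<beta> (\<lambda>zs. f (y # zs)) ys
      \<oplus> word_diff G \<rho> \<beta> (\<lambda>zs. f' (y # zs)) ys"
    by (rule Cons.IH) (use Cons.prems in auto)
  moreover have "word_lie G (\<rho> y) (\<beta> y) (\<lambda>xs. f xs \<oplus> f' xs) ys = word_lie G (\<rho> y) (\<beta> y) f ys
      \<oplus> word_lie G (\<rho> y) (\<beta> y) f' ys"
    by (rule word_lie_add[of _ _ S]) (use Cons.prems in auto)
  moreover have "word_diff G \<rho> \<beta> (\<lambda>zs. f (y # zs)) ys \<in> carrier G" "word_diff G \<rho> \<beta> (\<lambda>zs. f' (y # zs)) ys \<in> carrier G"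
    by (rule word_diff_closed[of _ S]; use Cons.prems in auto)+
  moreover have "word_lie G (\<rho> y) (\<beta> y) f ys \<in> carrier G" "word_lie G (\<rho> y) (\<beta> y) f' ys \<in> carrier G"
    by (rule word_lie_closed[of _ _ S]; use Cons.prems in auto)+
  ultimately show ?case by (simp add: a_ac)
qed simp

lemma word_lie_zero:
  assumes "a \<zero> = \<zero>" "\<delta> \<in> S \<rightarrow> S" "ys \<in> words S" "\<And>xs. xs \<in> words S \<Longrightarrow> length xs = length ys \<Longrightarrow> f xs = \<zero>"
  shows "word_lie G a \<delta> f ys = \<zero>"
proof -
  have "word_lie G a \<delta> (\<lambda>_. \<zero>) ys = \<zero>" using assms(1) by (induction ys) simp_all
  then show ?thesis using word_lie_cong[of S ys f "\<lambda>_. \<zero>" \<delta> G a] assms by simp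
qed

lemma word_diff_zero:
  assumes "\<And>x. x \<in> S \<Longrightarrow> \<rho> x \<zero> = \<zero>" "\<beta> \<in> S \<rightarrow> S \<rightarrow> S" "ys \<in> words S"
    "\<And>xs. xs \<in> words S \<Longrightarrow> Suc (length xs) = length ys \<Longrightarrow> f xs = \<zero>"
  shows "word_diff G \<rho> \<beta> f ys = \<zero>"
  using assms
proof (induction ys arbitrary: f)
  case (Cons y ys)
  have "word_diff G \<rho> \<beta> (\<lambda>zs. f (y # zs)) ys = \<zero>"
    by (rule Cons.IH) (use Cons.prems in auto)
  moreover have "word_lie G (\<rho> y) (\<beta> y) f ys = \<zero>"
    by (rule word_lie_zero[of _ _ S]) (use Cons.prems in auto)
  ultimately show ?case by simp
qed simp

lemma word_lie_eq_sum:
  assumes "a \<in> carrier G \<rightarrow> carrier G" "\<delta> \<in> S \<rightarrow> S" "f \<in> words S \<rightarrow> carrier G" "ys \<in> words S"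
  shows "word_lie G a \<delta> f ys = a (f ys) \<oplus> finsum G (\<lambda>i. f (ys[i := \<delta> (ys ! i)])) {..<length ys}"
  using assms
proof (induction ys arbitrary: f)
  case Nil
  then have "a (f []) \<in> carrier G" by auto
  then show ?case by simp
next
  case (Cons y ys)
  define h where "h i = f ((y # ys)[i := \<delta> ((y # ys) ! i)])" for i
  have h0: "h 0 = f (\<delta> y # ys)" and hS: "\<And>i. h (Suc i) = f (y # ys[i := \<delta> (ys ! i)])"
    by (simp_all add: h_def)
  have h: "h i \<in> carrier G" if "i < Suc (length ys)" for i
    using that words_nth[OF Cons.prems(4), of i] words_update[OF Cons.prems(4)] Cons.prems(2,3)
    by (auto simp: h_def simp del: list_update.simps)
  have s: "(\<lambda>i. f (y # ys[i := \<delta> (ys ! i)])) \<in> {..<length ys} \<rightarrow> carrier G"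
    unfolding hS[symmetric] by (auto intro: h)
  have "finsum G h {..<Suc (length ys)} = h 0 \<oplus> finsum G h (Suc ` {..<length ys})"
    unfolding lessThan_Suc_eq_insert_0 by (rule finsum_insert) (auto intro: h)
  also have "finsum G h (Suc ` {..<length ys}) = finsum G (\<lambda>i. h (Suc i)) {..<length ys}"
    by (rule finsum_reindex) (auto intro: h)
  finally have 1: "finsum G (\<lambda>i. f ((y # ys)[i := \<delta> ((y # ys) ! i)])) {..<length (y # ys)} =
    f (\<delta> y # ys) \<oplus> finsum G (\<lambda>i. f (y # ys[i := \<delta> (ys ! i)])) {..<length ys}"
    by (simp only: h0 hS h_def[symmetric] length_Cons)
  have 2: "word_lie G a \<delta> (\<lambda>zs. f (y # zs)) ys = a (f (y # ys))
      \<oplus> finsum G (\<lambda>i. f (y # ys[i := \<delta> (ys ! i)])) {..<length ys}"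
    by (rule Cons.IH) (use Cons.prems in auto)
  have 3: "f (\<delta> y # ys) \<in> carrier G" "a (f (y # ys)) \<in> carrier G"
    "finsum G (\<lambda>i. f (y # ys[i := \<delta> (ys ! i)])) {..<length ys} \<in> carrier G"
    using Cons.prems s by (auto simp: Pi_iff intro!: finsum_closed)
  show ?case unfolding 1 word_lie.simps 2 using 3 by (simp add: a_ac)
qed

text \<open>In the explicit differential of \<open>f\<close> the summands in which the first letter \<open>x\<close> acts or is bracketed form
  the Lie derivative along \<open>x\<close>; the summands in which \<open>x\<close> is an argument of \<open>f\<close> form the differential of
  \<open>i\<^sub>x f\<close>. The symmetry of \<open>f\<close> moves the brackets to the front.\<close>

lemma word_diff_eq_sum:
  assumes \<rho>: "\<rho> \<in> S \<rightarrow> carrier G \<rightarrow> carrier G" and \<beta>: "\<beta> \<in> S \<rightarrow> S \<rightarrow> S"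
    and f: "f \<in> words S \<rightarrow> carrier G"
    and sym: "\<And>us vs. us \<in> words S \<Longrightarrow> mset us = mset vs \<Longrightarrow> f us = f vs" and xs: "xs \<in> words S"
  shows "word_diff G \<rho> \<beta> f xs = finsum G (\<lambda>i. \<rho> (xs ! i) (f (nths xs (- {i})))) {..<length xs} \<oplus>
     finsum G (\<lambda>(i, j). f (\<beta> (xs ! i) (xs ! j) # nths xs (- {i, j}))) {(i, j). i < j \<and> j < length xs}"
  using f sym xs
proof (induction xs arbitrary: f)
  case Nil
  show ?case by simp
next
  case (Cons x xs)
  note f = Cons.prems(1) and sym = Cons.prems(2)
  have x: "x \<in> S" and xs: "xs \<in> words S" and nth: "\<And>i. i < length xs \<Longrightarrow> xs ! i \<in> S"
    using Cons.prems(3) by (auto simp: in_words_iff)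
  let ?n = "length xs"
  let ?P = "{(i, j). i < j \<and> j < ?n}" and ?P' = "{(i, j). i < j \<and> j < Suc ?n}"
  have finP: "finite ?P"
    by (rule finite_subset[of _ "{..<?n} \<times> {..<?n}"]) auto
  have ns: "{j. Suc j \<in> - {Suc k}} = - {k}" "{j. Suc j \<in> - {0}} = UNIV" "{j. Suc j \<in> - {Suc k, Suc l}} = - {k, l}"
    "{j. Suc j \<in> - {0, Suc k}} = - {k}" for k l by auto
  have nths: "nths (x # xs) (- {0}) = xs" "nths (x # xs) (- {Suc i}) = x # nths xs (- {i})"
    "nths (x # xs) (- {0, Suc i}) = nths xs (- {i})"
    "nths (x # xs) (- {Suc i, Suc j}) = x # nths xs (- {i, j})" for i j
    by (simp_all only: nths_Cons ns) (simp_all add: nths_all)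
  define A where "A i = \<rho> ((x # xs) ! i) (f (nths (x # xs) (- {i})))" for i
  define B where "B = (\<lambda>(i, j). f (\<beta> ((x # xs) ! i) ((x # xs) ! j) # nths (x # xs) (- {i, j})))"
  have A0: "A 0 = \<rho> x (f xs)" and AS: "\<And>i. A (Suc i) = \<rho> (xs ! i) (f (x # nths xs (- {i})))"
    by (simp_all only: A_def nths nth_Cons_0 nth_Cons_Suc)
  have B0: "\<And>j. B (0, Suc j) = f (\<beta> x (xs ! j) # nths xs (- {j}))"
    and BS: "\<And>i j. B (Suc i, Suc j) = f (\<beta> (xs ! i) (xs ! j) # x # nths xs (- {i, j}))"
    by (simp_all only: B_def prod.case nths nth_Cons_0 nth_Cons_Suc)
  have Ac: "A i \<in> carrier G" if "i < Suc ?n" for i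
  proof -
    have "(x # xs) ! i \<in> S" using that by (intro words_nth[OF Cons.prems(3)]) simp
    then show ?thesis using \<rho> f words_nths[OF Cons.prems(3)] by (auto simp: A_def Pi_iff)
  qed
  have Bc: "B (i, j) \<in> carrier G" if "i < j" "j < Suc ?n" for i j
  proof -
    have "(x # xs) ! i \<in> S" "(x # xs) ! j \<in> S" using that
      by (auto intro!: words_nth[OF Cons.prems(3)] simp del: nth_Cons_pos)
    then show ?thesis using \<beta> f words_nths[OF Cons.prems(3)] by (auto simp: B_def Pi_iff simp del: nth_Cons_pos)
  qed
  have "finsum G A {..<Suc ?n} = A 0 \<oplus> finsum G A (Suc ` {..<?n})"
    unfolding lessThan_Suc_eq_insert_0 by (rule finsum_insert) (auto intro: Ac)
  also have "finsum G A (Suc ` {..<?n}) = finsum G (\<lambda>i. A (Suc i)) {..<?n}"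
    by (rule finsum_reindex) (auto intro: Ac)
  finally have A: "finsum G (\<lambda>i. \<rho> ((x # xs) ! i) (f (nths (x # xs) (- {i})))) {..<Suc ?n} =
    \<rho> x (f xs) \<oplus> finsum G (\<lambda>i. \<rho> (xs ! i) (f (x # nths xs (- {i})))) {..<?n}"
    unfolding A0 AS A_def[symmetric] .
  have Ac': "(\<lambda>i. \<rho> (xs ! i) (f (x # nths xs (- {i})))) \<in> {..<?n} \<rightarrow> carrier G" "\<rho> x (f xs) \<in> carrier G"
    using x xs nth \<rho> f words_nths[OF xs] by (auto simp: Pi_iff)
  have P': "?P' = (\<lambda>j. (0, Suc j)) ` {..<?n} \<union> map_prod Suc Suc ` ?P"
  proof (intro equalityI subsetI)
    fix ij assume "ij \<in> ?P'"
    then obtain i j where ij: "ij = (i, Suc j)" "i < Suc j" "j < ?n" by (auto elim: less_natE)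
    then show "ij \<in> (\<lambda>j. (0, Suc j)) ` {..<?n} \<union> map_prod Suc Suc ` ?P"
      by (cases i) auto
  qed auto
  have "finsum G B ?P' = finsum G B ((\<lambda>j. (0, Suc j)) ` {..<?n}) \<oplus> finsum G B (map_prod Suc Suc ` ?P)"
    unfolding P' by (rule finsum_Un_disjoint) (use finP in \<open>auto intro: Bc\<close>)
  also have "finsum G B ((\<lambda>j. (0, Suc j)) ` {..<?n}) = finsum G (\<lambda>j. B (0, Suc j)) {..<?n}"
    by (rule finsum_reindex) (auto intro: Bc simp: inj_on_def)
  also have "finsum G B (map_prod Suc Suc ` ?P) = finsum G (\<lambda>ij. B (map_prod Suc Suc ij)) ?P"
    by (rule finsum_reindex) (auto intro: Bc simp: inj_on_def)
  also have "finsum G (\<lambda>j. B (0, Suc j)) {..<?n} = finsum G (\<lambda>j. f (xs[j := \<beta> x (xs ! j)])) {..<?n}"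
  proof (rule finsum_cong')
    have u: "xs[j := \<beta> x (xs ! j)] \<in> words S" if "j < ?n" for j
      using x nth[OF that] \<beta> xs by (auto intro: words_update)
    then show "(\<lambda>j. f (xs[j := \<beta> x (xs ! j)])) \<in> {..<?n} \<rightarrow> carrier G" using f by auto
    fix j assume "j \<in> {..<?n}"
    then show "B (0, Suc j) = f (xs[j := \<beta> x (xs ! j)])"
      unfolding B0 by (intro sym[OF u, symmetric] mset_list_update_fst) simp_all
  qed simp
  also have "finsum G (\<lambda>ij. B (map_prod Suc Suc ij)) ?P
      = finsum G (\<lambda>(i, j). f (x # \<beta> (xs ! i) (xs ! j) # nths xs (- {i, j}))) ?P"
  proof (rule finsum_cong')
    have l: "x # \<beta> (xs ! i) (xs ! j) # nths xs (- {i, j}) \<in> words S" if "i < j" "j < ?n" for i j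
      using that x nth[of i] nth[of j] \<beta> words_nths[OF xs] by auto
    then show "(\<lambda>(i, j). f (x # \<beta> (xs ! i) (xs ! j) # nths xs (- {i, j}))) \<in> ?P \<rightarrow> carrier G"
      using f by (auto simp: Pi_iff)
    fix ij assume "ij \<in> ?P"
    then obtain i j where ij: "ij = (i, j)" "i < j" "j < ?n" by blast
    show "B (map_prod Suc Suc ij) = (\<lambda>(i, j). f (x # \<beta> (xs ! i) (xs ! j) # nths xs (- {i, j}))) ij"
      unfolding ij map_prod_simp BS prod.case by (rule sym[OF l[OF ij(2,3)], symmetric]) simp
  qed simp
  finally have B: "finsum G (\<lambda>(i, j). f (\<beta> ((x # xs) ! i) ((x # xs) ! j) # nths (x # xs) (- {i, j}))) ?P' =
    finsum G (\<lambda>j. f (xs[j := \<beta> x (xs ! j)])) {..<?n} \<oplus>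
    finsum G (\<lambda>(i, j). f (x # \<beta> (xs ! i) (xs ! j) # nths xs (- {i, j}))) ?P"
    unfolding B_def .
  have L: "word_lie G (\<rho> x) (\<beta> x) f xs = \<rho> x (f xs) \<oplus> finsum G (\<lambda>j. f (xs[j := \<beta> x (xs ! j)])) {..<?n}"
    by (rule word_lie_eq_sum[of _ _ S]) (use x xs \<rho> \<beta> f in auto)
  have D: "word_diff G \<rho> \<beta> (\<lambda>zs. f (x # zs)) xs = finsum G (\<lambda>i. \<rho> (xs ! i) (f (x # nths xs (- {i})))) {..<?n} \<oplus>
     finsum G (\<lambda>(i, j). f (x # \<beta> (xs ! i) (xs ! j) # nths xs (- {i, j}))) ?P"
  proof (rule Cons.IH)
    show "f (x # us) = f (x # vs)" if "us \<in> words S" "mset us = mset vs" for us vs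
      using sym[of "x # us" "x # vs"] that x by simp
  qed (use x xs f in auto)
  have Bc': "finsum G (\<lambda>j. f (xs[j := \<beta> x (xs ! j)])) {..<?n} \<in> carrier G"
  proof (rule finsum_closed)
    have "xs[j := \<beta> x (xs ! j)] \<in> words S" if "j < ?n" for j
      using x nth[OF that] \<beta> xs by (auto intro: words_update)
    then show "(\<lambda>j. f (xs[j := \<beta> x (xs ! j)])) \<in> {..<?n} \<rightarrow> carrier G" using f by auto
  qed
  have Bc'': "finsum G (\<lambda>(i, j). f (x # \<beta> (xs ! i) (xs ! j) # nths xs (- {i, j}))) ?P \<in> carrier G"
  proof (rule finsum_closed)
    show "(\<lambda>(i, j). f (x # \<beta> (xs ! i) (xs ! j) # nths xs (- {i, j}))) \<in> ?P \<rightarrow> carrier G"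
      using x nth \<beta> words_nths[OF xs] f by (force simp: Pi_iff)
  qed
  show ?case
    unfolding word_diff.simps length_Cons A B L D
    using Ac' Bc' Bc'' finsum_closed[OF Ac'(1)] by (simp add: a_ac)
qed

end

context module
begin

lemma word_lie_smult:
  assumes "a \<in> carrier M \<rightarrow> carrier M" "\<And>u. u \<in> carrier M \<Longrightarrow> a (b \<odot>\<^bsub>M\<^esub> u) = b \<odot>\<^bsub>M\<^esub> a u"
    "\<delta> \<in> S \<rightarrow> S" "f \<in> words S \<rightarrow> carrier M" "ys \<in> words S" "b \<in> carrier R"
  shows "word_lie M a \<delta> (\<lambda>xs. b \<odot>\<^bsub>M\<^esub> f xs) ys = b \<odot>\<^bsub>M\<^esub> word_lie M a \<delta> f ys"
  using assms
proof (induction ys arbitrary: f)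
  case Nil
  then have "f [] \<in> carrier M" by auto
  then show ?case using Nil by simp
next
  case (Cons y ys)
  have "word_lie M a \<delta> (\<lambda>zs. b \<odot>\<^bsub>M\<^esub> f (y # zs)) ys = b \<odot>\<^bsub>M\<^esub> word_lie M a \<delta> (\<lambda>zs. f (y # zs)) ys"
    by (rule Cons.IH) (use Cons.prems in auto)
  moreover have "f (\<delta> y # ys) \<in> carrier M" using Cons.prems by (auto simp: Pi_iff)
  moreover have "word_lie M a \<delta> (\<lambda>zs. f (y # zs)) ys \<in> carrier M"
    by (rule M.word_lie_closed[of _ _ S]; use Cons.prems in auto)+
  ultimately show ?case using Cons.prems by (simp add: smult_r_distr)
qed

lemma word_diff_smult:
  assumes "\<rho> \<in> S \<rightarrow> carrier M \<rightarrow> carrier M"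
    "\<And>x u. x \<in> S \<Longrightarrow> u \<in> carrier M \<Longrightarrow> \<rho> x (b \<odot>\<^bsub>M\<^esub> u) = b \<odot>\<^bsub>M\<^esub> \<rho> x u"
    "\<beta> \<in> S \<rightarrow> S \<rightarrow> S" "f \<in> words S \<rightarrow> carrier M" "ys \<in> words S" "b \<in> carrier R"
  shows "word_diff M \<rho> \<beta> (\<lambda>xs. b \<odot>\<^bsub>M\<^esub> f xs) ys = b \<odot>\<^bsub>M\<^esub> word_diff M \<rho> \<beta> f ys"
  using assms
proof (induction ys arbitrary: f)
  case (Cons y ys)
  have "word_diff M \<rho> \<beta> (\<lambda>zs. b \<odot>\<^bsub>M\<^esub> f (y # zs)) ys = b \<odot>\<^bsub>M\<^esub> word_diff M \<rho> \<beta> (\<lambda>zs. f (y # zs)) ys"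
    by (rule Cons.IH) (use Cons.prems in auto)
  moreover have "word_lie M (\<rho> y) (\<beta> y) (\<lambda>xs. b \<odot>\<^bsub>M\<^esub> f xs) ys = b \<odot>\<^bsub>M\<^esub> word_lie M (\<rho> y) (\<beta> y) f ys"
    by (rule word_lie_smult[of _ _ _ S]) (use Cons.prems in auto)
  moreover have "word_diff M \<rho> \<beta> (\<lambda>zs. f (y # zs)) ys \<in> carrier M"
    by (rule M.word_diff_closed[of _ S]; use Cons.prems in auto)+
  moreover have "word_lie M (\<rho> y) (\<beta> y) f ys \<in> carrier M"
    by (rule M.word_lie_closed[of _ _ S]; use Cons.prems in auto)+
  ultimately show ?case using Cons.prems by (simp add: smult_r_distr)
qed simp

end

lemma sym_multilin_Lie:
  assumes g: "module F g" and M: "module F M"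
    and a: "a \<in> linear_maps F M M" and \<delta>: "\<delta> \<in> linear_maps F g g" and f: "sym_multilin F g M f"
  shows "sym_multilin F g M (word_lie M a \<delta> f)"
proof (rule sym_multilinI)
  interpret g: module F g by fact
  interpret M: module F M by fact
  note f' = sym_multilinD[OF f] and sm = sym_multilin_Cons[OF _ _ g]
  have ac: "a \<in> carrier M \<rightarrow> carrier M" and \<delta>c: "\<delta> \<in> carrier g \<rightarrow> carrier g"
    using linear_mapsD(1)[OF a] linear_mapsD(1)[OF \<delta>] by auto
  have fc: "f \<in> gwords g \<rightarrow> carrier M" if "sym_multilin F g M f" for f
    using sym_multilinD(1)[OF that] by auto
  have closed: "word_lie M a \<delta> f xs \<in> carrier M" if "sym_multilin F g M f" "xs \<in> gwords g" for f xs
    by (rule M.M.word_lie_closed[OF ac \<delta>c fc[OF that(1)] that(2)])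
  show "word_lie M a \<delta> f xs \<in> carrier M" if "xs \<in> gwords g" for xs by (rule closed[OF f that])
  have sym: "word_lie M a \<delta> f xs = word_lie M a \<delta> f ys"
    if "xs \<in> gwords g" "mset xs = mset ys" "sym_multilin F g M f" for xs ys f
    using that
  proof (induction xs arbitrary: f ys rule: measure_induct_rule[of length])
    case (less xs)
    show ?case
    proof (rule symmetric_by_swaps[of "carrier g" "word_lie M a \<delta> f"])
      note f = sym_multilinD[OF less.prems(3)]
      show "word_lie M a \<delta> f (x # y # zs) = word_lie M a \<delta> f (y # x # zs)"
        if xyz: "x \<in> carrier g" "y \<in> carrier g" "zs \<in> gwords g" for x y zs
      proof -
        have d: "\<delta> x \<in> carrier g" "\<delta> y \<in> carrier g" using xyz \<delta>c by auto
        have "word_lie M a \<delta> (\<lambda>zs. f (x # y # zs)) zs = word_lie M a \<delta> (\<lambda>zs. f (y # x # zs)) zs"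
          by (rule word_lie_cong[OF _ \<delta>c xyz(3)]) (rule f(2), use xyz in auto)
        moreover have "f (\<delta> x # y # zs) = f (y # \<delta> x # zs)" "f (x # \<delta> y # zs) = f (\<delta> y # x # zs)"
          by (rule f(2); use xyz d in simp)+
        moreover have "f (y # \<delta> x # zs) \<in> carrier M" "f (\<delta> y # x # zs) \<in> carrier M"
          by (rule f(1); use xyz d in simp)+
        moreover have "word_lie M a \<delta> (\<lambda>zs. f (y # x # zs)) zs \<in> carrier M"
          by (rule closed[OF sm[OF sm[OF less.prems(3) xyz(2)] xyz(1)] xyz(3)])
        ultimately show ?thesis by (simp add: M.M.a_lcomm)
      qed
      show "word_lie M a \<delta> f (x # zs) = word_lie M a \<delta> f (x # zs')"
        if xz: "x \<in> carrier g" "zs \<in> gwords g" "length zs < length xs" "mset zs = mset zs'" for x zs zs'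
      proof -
        have "word_lie M a \<delta> (\<lambda>zs. f (x # zs)) zs = word_lie M a \<delta> (\<lambda>zs. f (x # zs)) zs'"
          by (rule less.IH[OF xz(3,2,4) sm[OF less.prems(3) xz(1)]])
        moreover have "f (\<delta> x # zs) = f (\<delta> x # zs')"
          by (rule f(2)) (use xz \<delta>c in auto)
        ultimately show ?thesis by simp
      qed
    qed (use less.prems in auto)
  qed
  show "word_lie M a \<delta> f xs = word_lie M a \<delta> f ys" if "xs \<in> gwords g" "mset xs = mset ys" for xs ys
    by (rule sym[OF that f])
  show "word_lie M a \<delta> f ((x \<oplus>\<^bsub>g\<^esub> y) # xs) = word_lie M a \<delta> f (x # xs) \<oplus>\<^bsub>M\<^esub> word_lie M a \<delta> f (y # xs)"
    if xs: "xs \<in> gwords g" and x: "x \<in> carrier g" and y: "y \<in> carrier g" for xs x y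
  proof -
    note smx = sm[OF f x] and smy = sm[OF f y]
    have "word_lie M a \<delta> (\<lambda>zs. f ((x \<oplus>\<^bsub>g\<^esub> y) # zs)) xs = word_lie M a \<delta> (\<lambda>zs. f (x # zs) \<oplus>\<^bsub>M\<^esub> f (y # zs)) xs"
      by (rule word_lie_cong[OF _ \<delta>c xs]) (rule f'(3)[OF _ x y])
    also have "\<dots> = word_lie M a \<delta> (\<lambda>zs. f (x # zs)) xs \<oplus>\<^bsub>M\<^esub> word_lie M a \<delta> (\<lambda>zs. f (y # zs)) xs"
      by (rule M.M.word_lie_add[OF ac linear_mapsD(2)[OF a] \<delta>c fc[OF smx] fc[OF smy] xs])
    finally show ?thesis
      using f'(1)[of "\<delta> x # xs"] f'(1)[of "\<delta> y # xs"] closed[OF smx xs] closed[OF smy xs] x y xs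
        linear_mapsD(1,2)[OF \<delta>] by (simp add: f'(3) M.M.a_ac)
  qed
  show "word_lie M a \<delta> f ((b \<odot>\<^bsub>g\<^esub> x) # xs) = b \<odot>\<^bsub>M\<^esub> word_lie M a \<delta> f (x # xs)"
    if xs: "xs \<in> gwords g" and b: "b \<in> carrier F" and x: "x \<in> carrier g" for xs b x
  proof -
    note smx = sm[OF f x]
    have "word_lie M a \<delta> (\<lambda>zs. f ((b \<odot>\<^bsub>g\<^esub> x) # zs)) xs = word_lie M a \<delta> (\<lambda>zs. b \<odot>\<^bsub>M\<^esub> f (x # zs)) xs"
      by (rule word_lie_cong[OF _ \<delta>c xs]) (rule f'(4)[OF _ b x])
    also have "\<dots> = b \<odot>\<^bsub>M\<^esub> word_lie M a \<delta> (\<lambda>zs. f (x # zs)) xs"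
      by (rule M.word_lie_smult[OF ac linear_mapsD(3)[OF a b] \<delta>c fc[OF smx] xs b])
    finally show ?thesis
      using f'(1)[of "\<delta> x # xs"] closed[OF smx xs] x xs b linear_mapsD(1,3)[OF \<delta>]
      by (simp add: f'(4) M.smult_r_distr)
  qed
qed

sublocale comm_lie_module \<subseteq> V: char2_space F M
  by (intro char2_space.intro char2_space_axioms.intro char_2 field_axioms M.module_axioms)

sublocale comm_lie_algebra \<subseteq> A: char2_space F g
  by (intro char2_space.intro char2_space_axioms.intro char_2 field_axioms module_axioms)

context comm_lie_algebra
begin

lemma bracket_linear: "x \<in> carrier g \<Longrightarrow> bracket g x \<in> linear_maps F g g"
proof (rule linear_mapsI)
  assume x: "x \<in> carrier g"
  show "bracket g x u \<in> carrier g" if "u \<in> carrier g" for u by (rule bracket_closed[OF x that])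
  show "bracket g x (u \<oplus>\<^bsub>g\<^esub> v) = bracket g x u \<oplus>\<^bsub>g\<^esub> bracket g x v" if "u \<in> carrier g" "v \<in> carrier g" for u v
    using that x by (simp add: bracket_commute[of x] bracket_add)
  show "bracket g x (a \<odot>\<^bsub>g\<^esub> u) = a \<odot>\<^bsub>g\<^esub> bracket g x u" if "a \<in> carrier F" "u \<in> carrier g" for a u
    using that x by (simp add: bracket_commute[of x] bracket_smult)
qed

lemma bracket_Pi: "bracket g \<in> carrier g \<rightarrow> carrier g \<rightarrow> carrier g"
  by (auto simp: bracket_closed)

text \<open>The Jacobi identity in the form \<open>ad\<^bsub>[x,y]\<^esub> = ad\<^sub>x ad\<^sub>y + ad\<^sub>y ad\<^sub>x\<close>.\<close>

lemma jacobi': "x \<in> carrier g \<Longrightarrow> y \<in> carrier g \<Longrightarrow> z \<in> carrier g \<Longrightarrow>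
    bracket g (bracket g x y) z = bracket g x (bracket g y z) \<oplus>\<^bsub>g\<^esub> bracket g y (bracket g x z)"
  using jacobi[of x y z] bracket_commute[of "bracket g x y" z] bracket_commute[of z x]
  by (subst A.add_eq_zero_iff[symmetric]) (simp_all add: bracket_closed M.a_ac)

end

context comm_lie_module
begin

abbreviation "L x \<equiv> word_lie M (\<rho> x) (bracket g x)"
abbreviation "D \<equiv> word_diff M \<rho> (bracket g)"
abbreviation "sm \<equiv> sym_multilin F g M"

lemma act_linear: "x \<in> carrier g \<Longrightarrow> \<rho> x \<in> linear_maps F M M"
  by (rule linear_mapsI) (simp_all add: act_closed act_add_right act_smult_right)

lemma act_Pi: "\<rho> \<in> carrier g \<rightarrow> carrier M \<rightarrow> carrier M"
  by (auto simp: act_closed)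

lemma act_zero: "x \<in> carrier g \<Longrightarrow> \<rho> x \<zero>\<^bsub>M\<^esub> = \<zero>\<^bsub>M\<^esub>"
  using linear_maps_zero[OF V.module_V V.module_V act_linear] .

lemma sm_Pi: "sm f \<Longrightarrow> f \<in> gwords g \<rightarrow> carrier M"
  using sym_multilinD(1) by blast

lemma sm_Cons: "sm f \<Longrightarrow> x \<in> carrier g \<Longrightarrow> sm (\<lambda>xs. f (x # xs))"
  by (rule sym_multilin_Cons[OF _ _ A.module_V])

lemma sm_L: "sm f \<Longrightarrow> x \<in> carrier g \<Longrightarrow> sm (L x f)"
  by (rule sym_multilin_Lie[OF A.module_V V.module_V act_linear bracket_linear])

lemma L_closed: "sm f \<Longrightarrow> x \<in> carrier g \<Longrightarrow> xs \<in> gwords g \<Longrightarrow> L x f xs \<in> carrier M"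
  by (rule sym_multilinD(1)[OF sm_L])

lemma D_closed_Pi: "f \<in> gwords g \<rightarrow> carrier M \<Longrightarrow> xs \<in> gwords g \<Longrightarrow> D f xs \<in> carrier M"
  by (rule M.M.word_diff_closed[OF act_Pi bracket_Pi])

lemma D_closed: "sm f \<Longrightarrow> xs \<in> gwords g \<Longrightarrow> D f xs \<in> carrier M"
  by (rule D_closed_Pi[OF sm_Pi])

lemma D_cong: "(\<And>zs. zs \<in> gwords g \<Longrightarrow> Suc (length zs) = length xs \<Longrightarrow> f zs = f' zs) \<Longrightarrow>
    xs \<in> gwords g \<Longrightarrow> D f xs = D f' xs"
  by (rule word_diff_cong[OF _ bracket_Pi])

lemma D_add: "f \<in> gwords g \<rightarrow> carrier M \<Longrightarrow> f' \<in> gwords g \<rightarrow> carrier M \<Longrightarrow>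
    xs \<in> gwords g \<Longrightarrow> D (\<lambda>zs. f zs \<oplus>\<^bsub>M\<^esub> f' zs) xs = D f xs \<oplus>\<^bsub>M\<^esub> D f' xs"
  by (rule M.M.word_diff_add[OF act_Pi act_add_right bracket_Pi])

lemma D_smult: "f \<in> gwords g \<rightarrow> carrier M \<Longrightarrow> a \<in> carrier F \<Longrightarrow>
    xs \<in> gwords g \<Longrightarrow> D (\<lambda>zs. a \<odot>\<^bsub>M\<^esub> f zs) xs = a \<odot>\<^bsub>M\<^esub> D f xs"
  by (rule M.word_diff_smult[OF act_Pi act_smult_right bracket_Pi])

lemma L_add: "f \<in> gwords g \<rightarrow> carrier M \<Longrightarrow> f' \<in> gwords g \<rightarrow> carrier M \<Longrightarrow>
    x \<in> carrier g \<Longrightarrow> xs \<in> gwords g \<Longrightarrow> L x (\<lambda>zs. f zs \<oplus>\<^bsub>M\<^esub> f' zs) xs = L x f xs \<oplus>\<^bsub>M\<^esub> L x f' xs"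
  by (rule M.M.word_lie_add[of _ _ "carrier g"]) (auto simp: act_closed act_add_right bracket_closed)

lemma L_add_left:
  "sm f \<Longrightarrow> x \<in> carrier g \<Longrightarrow> y \<in> carrier g \<Longrightarrow> zs \<in> gwords g \<Longrightarrow>
    L (x \<oplus>\<^bsub>g\<^esub> y) f zs = L x f zs \<oplus>\<^bsub>M\<^esub> L y f zs"
proof (induction zs arbitrary: f)
  case Nil
  then show ?case using sym_multilinD(1)[OF Nil(1), of "[]"] by (simp add: act_add_left)
next
  case (Cons z zs)
  note f = sym_multilinD[OF Cons.prems(1)]
  have z: "z \<in> carrier g" and zs: "zs \<in> gwords g" using Cons.prems by auto
  note sz = sm_Cons[OF Cons.prems(1) z]
  have "f (bracket g x z # zs) \<in> carrier M" "f (bracket g y z # zs) \<in> carrier M"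
    by (rule f(1); use Cons.prems in \<open>simp add: bracket_closed\<close>)+
  then show ?case
    using Cons.IH[OF sz] Cons.prems L_closed[OF sz _ zs]
    by (simp add: bracket_add f(3) bracket_closed M.M.a_ac)
qed

lemma L_smult_left:
  "sm f \<Longrightarrow> a \<in> carrier F \<Longrightarrow> x \<in> carrier g \<Longrightarrow> zs \<in> gwords g \<Longrightarrow>
    L (a \<odot>\<^bsub>g\<^esub> x) f zs = a \<odot>\<^bsub>M\<^esub> L x f zs"
proof (induction zs arbitrary: f)
  case Nil
  then show ?case using sym_multilinD(1)[OF Nil(1), of "[]"] by (simp add: act_smult_left)
next
  case (Cons z zs)
  note f = sym_multilinD[OF Cons.prems(1)]
  have z: "z \<in> carrier g" and zs: "zs \<in> gwords g" using Cons.prems by auto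
  note sz = sm_Cons[OF Cons.prems(1) z]
  have "f (bracket g x z # zs) \<in> carrier M"
    by (rule f(1)) (use Cons.prems in \<open>simp add: bracket_closed\<close>)
  then show ?case
    using Cons.IH[OF sz] Cons.prems L_closed[OF sz _ zs]
    by (simp add: bracket_smult f(4) bracket_closed M.smult_r_distr)
qed

text \<open>Contracting with \<open>z\<close> reduces the claim to the Jacobi identity for \<open>x\<close>, \<open>y\<close>, \<open>z\<close> and to the induction
  hypothesis; the mixed terms \<open>L\<^sub>x i\<^bsub>[y,z]\<^esub>\<close> and \<open>L\<^sub>y i\<^bsub>[x,z]\<^esub>\<close> occur twice and cancel.\<close>

lemma L_L:
  assumes "sm f" "x \<in> carrier g" "y \<in> carrier g" "zs \<in> gwords g"
  shows "L (bracket g x y) f zs = L x (L y f) zs \<oplus>\<^bsub>M\<^esub> L y (L x f) zs"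
  using assms
proof (induction zs arbitrary: f)
  case Nil
  then show ?case using sym_multilinD(1)[OF Nil(1), of "[]"] by (simp add: act_bracket)
next
  case (Cons z zs)
  note f = sym_multilinD[OF Cons.prems(1)]
  have z: "z \<in> carrier g" and zs: "zs \<in> gwords g" using Cons.prems by auto
  note x = Cons.prems(2) and y = Cons.prems(3)
  note sz = sm_Cons[OF Cons.prems(1)]
  have b: "bracket g x z \<in> carrier g" "bracket g y z \<in> carrier g" using x y z by (simp_all add: bracket_closed)
  have *: "L x (L y f) (z # zs) = f (bracket g y (bracket g x z) # zs) \<oplus>\<^bsub>M\<^esub> L y (\<lambda>w. f (bracket g x z # w)) zs
      \<oplus>\<^bsub>M\<^esub> (L x (\<lambda>w. f (bracket g y z # w)) zs \<oplus>\<^bsub>M\<^esub> L x (L y (\<lambda>w. f (z # w))) zs)"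
    if x: "x \<in> carrier g" and y: "y \<in> carrier g" for x y
  proof -
    have "bracket g y z \<in> carrier g" using y z by (simp add: bracket_closed)
    then have "L x (\<lambda>w. f (bracket g y z # w) \<oplus>\<^bsub>M\<^esub> L y (\<lambda>v. f (z # v)) w) zs
        = L x (\<lambda>w. f (bracket g y z # w)) zs \<oplus>\<^bsub>M\<^esub> L x (L y (\<lambda>w. f (z # w))) zs"
      by (intro L_add sm_Pi sz sm_L x y z zs)
    then show ?thesis by simp
  qed
  have c: "f (bracket g y (bracket g x z) # zs) \<in> carrier M" "f (bracket g x (bracket g y z) # zs) \<in> carrier M"
    by (rule f(1); use x y zs b in \<open>simp add: bracket_closed\<close>)+
  note c' = L_closed[OF sz[OF b(1)] y zs] L_closed[OF sz[OF b(2)] x zs]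
    L_closed[OF sm_L[OF sz[OF z] y] x zs] L_closed[OF sm_L[OF sz[OF z] x] y zs]
  have "L (bracket g x y) f (z # zs) = f (bracket g x (bracket g y z) # zs) \<oplus>\<^bsub>M\<^esub> f (bracket g y (bracket g x z) # zs)
      \<oplus>\<^bsub>M\<^esub> (L x (L y (\<lambda>w. f (z # w))) zs \<oplus>\<^bsub>M\<^esub> L y (L x (\<lambda>w. f (z # w))) zs)"
    using Cons.IH[OF sz[OF z] x y zs] by (simp add: jacobi' x y z zs b f(3) bracket_closed)
  then show ?case
    unfolding *[OF x y] *[OF y x] using c c' by (simp add: V.char2_simps)
qed

text \<open>Contracting \<open>d f\<close> with \<open>x\<close> and then with \<open>y\<close> gives \<open>L\<^sub>x i\<^sub>y f + i\<^bsub>[x,y]\<^esub> f + L\<^sub>y i\<^sub>x f + d i\<^sub>y i\<^sub>x f\<close>,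
  which is symmetric in \<open>x\<close> and \<open>y\<close> because the bracket is commutative.\<close>

lemma sm_D:
  assumes f: "sm f"
  shows "sm (D f)"
proof (rule sym_multilinI)
  note f' = sym_multilinD[OF f]
  show "D f xs \<in> carrier M" if "xs \<in> gwords g" for xs by (rule D_closed[OF f that])
  have sym: "D f xs = D f ys" if "xs \<in> gwords g" "mset xs = mset ys" "sm f" for xs ys f
    using that
  proof (induction xs arbitrary: f ys rule: measure_induct_rule[of length])
    case (less xs)
    show ?case
    proof (rule symmetric_by_swaps[of "carrier g" "D f"])
      note f = sym_multilinD[OF less.prems(3)] and sf = sm_Cons[OF less.prems(3)]
      show "D f (x # y # zs) = D f (y # x # zs)"
        if x: "x \<in> carrier g" and y: "y \<in> carrier g" and zs: "zs \<in> gwords g" for x y zs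
      proof -
        have b: "bracket g x y \<in> carrier g" by (rule bracket_closed[OF x y])
        have "D (\<lambda>zs. f (x # y # zs)) zs = D (\<lambda>zs. f (y # x # zs)) zs"
          by (rule D_cong[OF _ zs]) (rule f(2), use x y in auto)
        then show ?thesis
          using L_closed[OF sf[OF x] y zs] L_closed[OF sf[OF y] x zs] f(1)[of "bracket g x y # zs"] b zs
            D_closed[OF sm_Cons[OF sf[OF y] x] zs] bracket_commute[OF x y]
          by (simp add: M.M.a_ac)
      qed
      show "D f (x # zs) = D f (x # zs')"
        if xz: "x \<in> carrier g" "zs \<in> gwords g" "length zs < length xs" "mset zs = mset zs'" for x zs zs'
        using less.IH[OF xz(3,2,4) sf[OF xz(1)]] sym_multilinD(2)[OF sm_L[OF less.prems(3) xz(1)] xz(2,4)] by simp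
    qed (use less.prems in auto)
  qed
  show "D f xs = D f ys" if "xs \<in> gwords g" "mset xs = mset ys" for xs ys
    by (rule sym[OF that f])
  show "D f ((x \<oplus>\<^bsub>g\<^esub> y) # xs) = D f (x # xs) \<oplus>\<^bsub>M\<^esub> D f (y # xs)"
    if xs: "xs \<in> gwords g" and x: "x \<in> carrier g" and y: "y \<in> carrier g" for xs x y
  proof -
    note sx = sm_Cons[OF f x] and sy = sm_Cons[OF f y]
    have "D (\<lambda>zs. f ((x \<oplus>\<^bsub>g\<^esub> y) # zs)) xs = D (\<lambda>zs. f (x # zs) \<oplus>\<^bsub>M\<^esub> f (y # zs)) xs"
      by (rule D_cong[OF _ xs]) (rule f'(3)[OF _ x y])
    also have "\<dots> = D (\<lambda>zs. f (x # zs)) xs \<oplus>\<^bsub>M\<^esub> D (\<lambda>zs. f (y # zs)) xs"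
      by (rule D_add[OF sm_Pi[OF sx] sm_Pi[OF sy] xs])
    finally show ?thesis
      using L_add_left[OF f x y xs] L_closed[OF f x xs] L_closed[OF f y xs] D_closed[OF sx xs] D_closed[OF sy xs]
      by (simp add: M.M.a_ac)
  qed
  show "D f ((a \<odot>\<^bsub>g\<^esub> x) # xs) = a \<odot>\<^bsub>M\<^esub> D f (x # xs)"
    if xs: "xs \<in> gwords g" and a: "a \<in> carrier F" and x: "x \<in> carrier g" for xs a x
  proof -
    note sx = sm_Cons[OF f x]
    have "D (\<lambda>zs. f ((a \<odot>\<^bsub>g\<^esub> x) # zs)) xs = D (\<lambda>zs. a \<odot>\<^bsub>M\<^esub> f (x # zs)) xs"
      by (rule D_cong[OF _ xs]) (rule f'(4)[OF _ a x])
    also have "\<dots> = a \<odot>\<^bsub>M\<^esub> D (\<lambda>zs. f (x # zs)) xs"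
      by (rule D_smult[OF sm_Pi[OF sx] a xs])
    finally show ?thesis
      using L_smult_left[OF f a x xs] L_closed[OF f x xs] D_closed[OF sx xs] a by (simp add: M.smult_r_distr)
  qed
qed

text \<open>Both sides are contracted with \<open>y\<close>. They then differ by \<open>L\<^sub>x L\<^sub>y f + L\<^sub>y L\<^sub>x f + L\<^bsub>[x,y]\<^esub> f\<close>, which
  vanishes by \<open>L_L\<close>, and by the instance of the claim for \<open>i\<^sub>y f\<close>.\<close>

lemma L_D:
  assumes "sm f" "x \<in> carrier g" "ys \<in> gwords g"
  shows "L x (D f) ys = D (L x f) ys"
  using assms
proof (induction ys arbitrary: f)
  case Nil
  then show ?case by (simp add: act_zero)
next
  case (Cons y ys)
  note x = Cons.prems(2) and f = Cons.prems(1)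
  have y: "y \<in> carrier g" and ys: "ys \<in> gwords g" using Cons.prems by auto
  note b = bracket_closed[OF x y] and sf = sm_Cons[OF f]
  have "L x (\<lambda>w. L y f w \<oplus>\<^bsub>M\<^esub> D (\<lambda>v. f (y # v)) w) ys = L x (L y f) ys \<oplus>\<^bsub>M\<^esub> L x (D (\<lambda>v. f (y # v))) ys"
    by (intro L_add sm_Pi sm_L sm_D sf f x y ys)
  moreover have "D (\<lambda>w. f (bracket g x y # w) \<oplus>\<^bsub>M\<^esub> L x (\<lambda>v. f (y # v)) w) ys
      = D (\<lambda>w. f (bracket g x y # w)) ys \<oplus>\<^bsub>M\<^esub> D (L x (\<lambda>v. f (y # v))) ys"
    by (intro D_add sm_Pi sm_L sf b x y ys)
  ultimately show ?case
    using Cons.IH[OF sf[OF y] x ys] L_L[OF f x y ys]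
      L_closed[OF sm_L[OF f y] x ys] L_closed[OF sm_L[OF f x] y ys] D_closed[OF sm_L[OF sf[OF y] x] ys]
      D_closed[OF sf[OF b] ys]
    by (simp add: V.char2_simps)
qed

text \<open>From \<open>i\<^sub>x d d = L\<^sub>x d + d L\<^sub>x + d d i\<^sub>x\<close> and \<open>L_D\<close>, by induction.\<close>

lemma D_D:
  assumes "sm f" "xs \<in> gwords g"
  shows "D (D f) xs = \<zero>\<^bsub>M\<^esub>"
  using assms
proof (induction xs arbitrary: f)
  case (Cons x xs)
  have x: "x \<in> carrier g" and xs: "xs \<in> gwords g" using Cons.prems by auto
  note f = Cons.prems(1) and sf = sm_Cons[OF Cons.prems(1) x]
  have "D (\<lambda>w. L x f w \<oplus>\<^bsub>M\<^esub> D (\<lambda>v. f (x # v)) w) xs = D (L x f) xs \<oplus>\<^bsub>M\<^esub> D (D (\<lambda>v. f (x # v))) xs"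
    by (intro D_add sm_Pi sm_L sm_D sf f x xs)
  then show ?case
    using Cons.IH[OF sf xs] L_D[OF f x xs] D_closed[OF sm_L[OF f x] xs] by (simp add: V.char2_simps)
qed simp

end

section \<open>Cochain spaces and their differential\<close>

lemma CS_simps:
  "\<zero>\<^bsub>CS F g M n\<^esub> = (\<lambda>xs\<in>vecs g n. \<zero>\<^bsub>M\<^esub>)"
  "c \<oplus>\<^bsub>CS F g M n\<^esub> c' = (\<lambda>xs\<in>vecs g n. c xs \<oplus>\<^bsub>M\<^esub> c' xs)"
  "a \<odot>\<^bsub>CS F g M n\<^esub> c = (\<lambda>xs\<in>vecs g n. a \<odot>\<^bsub>M\<^esub> c xs)"
  by (simp_all add: CS_def)

lemma CS_extensional: "c \<in> carrier (CS F g M n) \<Longrightarrow> c \<in> extensional (vecs g n)"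
  unfolding CS_def partial_object.simps by (simp add: PiE_def)

lemma CS_closed: "c \<in> carrier (CS F g M n) \<Longrightarrow> xs \<in> vecs g n \<Longrightarrow> c xs \<in> carrier M"
  unfolding CS_def partial_object.simps by blast

lemma CS_sym: "c \<in> carrier (CS F g M n) \<Longrightarrow> xs \<in> vecs g n \<Longrightarrow> mset xs = mset ys \<Longrightarrow> c xs = c ys"
  using vecs_mset_eq[of xs g n ys] unfolding CS_def partial_object.simps by blast

lemma CS_eqI:
  assumes "c \<in> carrier (CS F g M n)" "c' \<in> carrier (CS F g M n)" "\<And>xs. xs \<in> vecs g n \<Longrightarrow> c xs = c' xs"
  shows "c = c'"
  by (rule extensionalityI[OF CS_extensional[OF assms(1)] CS_extensional[OF assms(2)] assms(3)])

text \<open>A cochain of degree \<open>n\<close> as a function on words of every length.\<close>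

definition extend_zero :: "('g, 'y) partial_object_scheme \<Rightarrow> ('m, 'z) ring_scheme \<Rightarrow> nat \<Rightarrow> ('g list \<Rightarrow> 'm) \<Rightarrow> 'g list \<Rightarrow> 'm" where
  "extend_zero g M n c xs = (if xs \<in> vecs g n then c xs else \<zero>\<^bsub>M\<^esub>)"

lemma extend_zero_vecs [simp]: "xs \<in> vecs g n \<Longrightarrow> extend_zero g M n c xs = c xs"
  by (simp add: extend_zero_def)

lemma vecs_words: "xs \<in> vecs g n \<Longrightarrow> xs \<in> gwords g"
  by (simp add: vecs_iff)

lemma sym_multilin_extend_zero:
  assumes "module F g" "module F M" and c: "c \<in> carrier (CS F g M n)"
  shows "sym_multilin F g M (extend_zero g M n c)"
proof (rule sym_multilinI)
  interpret g: module F g by fact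
  interpret M: module F M by fact
  have lin: "\<And>xs i x y. xs \<in> vecs g n \<Longrightarrow> i < n \<Longrightarrow> x \<in> carrier g \<Longrightarrow> y \<in> carrier g \<Longrightarrow>
        c (xs[i := x \<oplus>\<^bsub>g\<^esub> y]) = c (xs[i := x]) \<oplus>\<^bsub>M\<^esub> c (xs[i := y])"
    "\<And>xs i a x. xs \<in> vecs g n \<Longrightarrow> i < n \<Longrightarrow> a \<in> carrier F \<Longrightarrow> x \<in> carrier g \<Longrightarrow>
        c (xs[i := a \<odot>\<^bsub>g\<^esub> x]) = a \<odot>\<^bsub>M\<^esub> c (xs[i := x])"
    using c unfolding CS_def partial_object.simps by blast+
  show "extend_zero g M n c xs \<in> carrier M" for xs using CS_closed[OF c] by (simp add: extend_zero_def)
  show "extend_zero g M n c xs = extend_zero g M n c ys" if "mset xs = mset ys" for xs ys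
    using CS_sym[OF c _ that] vecs_mset_eq[OF _ that] vecs_mset_eq[OF _ that[symmetric]]
    by (auto simp: extend_zero_def)
  show "extend_zero g M n c ((x \<oplus>\<^bsub>g\<^esub> y) # xs) = extend_zero g M n c (x # xs) \<oplus>\<^bsub>M\<^esub> extend_zero g M n c (y # xs)"
    if "xs \<in> gwords g" "x \<in> carrier g" "y \<in> carrier g" for xs x y
    using lin(1)[of "x # xs" 0 x y] that by (auto simp: extend_zero_def vecs_iff)
  show "extend_zero g M n c ((a \<odot>\<^bsub>g\<^esub> x) # xs) = a \<odot>\<^bsub>M\<^esub> extend_zero g M n c (x # xs)"
    if "xs \<in> gwords g" "a \<in> carrier F" "x \<in> carrier g" for xs a x
    using lin(2)[of "x # xs" 0 a x] that by (auto simp: extend_zero_def vecs_iff)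
qed

lemma restrict_CS:
  assumes "module F g" and f: "sym_multilin F g M f"
  shows "(\<lambda>xs\<in>vecs g n. f xs) \<in> carrier (CS F g M n)"
proof -
  interpret g: module F g by fact
  note f' = sym_multilinD[OF f]
  have first: "xs[i := x] \<in> vecs g n" "f (xs[i := x]) = f (x # nths xs (- {i}))" "nths xs (- {i}) \<in> gwords g"
    if "xs \<in> vecs g n" "i < n" "x \<in> carrier g" for xs i x
  proof -
    show v: "xs[i := x] \<in> vecs g n" by (rule vecs_upd[OF that(1,3)])
    show "f (xs[i := x]) = f (x # nths xs (- {i}))"
      by (rule f'(2)[OF vecs_words[OF v] mset_list_update_fst]) (use that in \<open>simp add: vecs_iff\<close>)
    show "nths xs (- {i}) \<in> gwords g" by (rule words_nths[OF vecs_words[OF that(1)]])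
  qed
  show ?thesis
    unfolding CS_def partial_object.simps
  proof (intro CollectI conjI ballI allI impI)
    show "(\<lambda>xs\<in>vecs g n. f xs) \<in> vecs g n \<rightarrow>\<^sub>E carrier M" using f'(1) by (auto simp: vecs_iff)
    show "(\<lambda>xs\<in>vecs g n. f xs) xs = (\<lambda>xs\<in>vecs g n. f xs) ys"
      if "xs \<in> vecs g n" "ys \<in> vecs g n" "mset xs = mset ys" for xs ys
      using f'(2)[OF vecs_words[OF that(1)] that(3)] that(1,2) by simp
  qed (simp_all add: first f'(3,4) vecs_words)
qed

lemma extend_zero_restrict:
  assumes "\<And>xs. xs \<in> gwords g \<Longrightarrow> length xs \<noteq> n \<Longrightarrow> f xs = \<zero>\<^bsub>M\<^esub>" "xs \<in> gwords g"
  shows "extend_zero g M n (\<lambda>xs\<in>vecs g n. f xs) xs = f xs"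
  using assms by (auto simp: extend_zero_def vecs_iff)

lemma CS_composition:
  assumes "module F g" "module F V" "module F W" and T: "T \<in> linear_maps F V W" and c: "c \<in> carrier (CS F g V n)"
  shows "(\<lambda>xs\<in>vecs g n. T (c xs)) \<in> carrier (CS F g W n)"
proof -
  note e = sym_multilinD[OF sym_multilin_extend_zero[OF assms(1,2) c]]
  interpret g: module F g by fact
  have "sym_multilin F g W (\<lambda>xs. T (extend_zero g V n c xs))"
    by (rule sym_multilinI) (use e(1) in \<open>simp_all add: linear_mapsD[OF T] e(3,4), metis e(2)\<close>)
  from restrict_CS[OF assms(1) this, of n] show ?thesis
    by (simp cong: restrict_cong)
qed

text \<open>Used to view cochains with values in the cocycles or in the coboundaries as cochains with
  coefficients in these spaces, to which linear sections can then be applied.\<close>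

lemma CS_subspace:
  assumes g: "module F g" and V: "module F V" and "\<zero>\<^bsub>V\<^esub> \<in> Z"
    and c: "c \<in> carrier (CS F g V n)" and Z: "\<And>xs. xs \<in> vecs g n \<Longrightarrow> c xs \<in> Z"
  shows "c \<in> carrier (CS F g (V\<lparr>carrier := Z\<rparr>) n)"
proof -
  note e = sym_multilinD[OF sym_multilin_extend_zero[OF g V c]]
  have "sym_multilin F g (V\<lparr>carrier := Z\<rparr>) (extend_zero g V n c)"
  proof (rule sym_multilinI)
    show "extend_zero g V n c xs = extend_zero g V n c ys" if "xs \<in> gwords g" "mset xs = mset ys" for xs ys
      by (rule e(2)[OF that])
    show "extend_zero g V n c xs \<in> carrier (V\<lparr>carrier := Z\<rparr>)" for xs
      using assms(3) Z by (simp add: extend_zero_def)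
  qed (simp_all add: e(3,4))
  from restrict_CS[OF g this, of n] have "(\<lambda>xs\<in>vecs g n. c xs) \<in> carrier (CS F g (V\<lparr>carrier := Z\<rparr>) n)"
    by (simp cong: restrict_cong)
  then show ?thesis by (simp add: extensional_restrict[OF CS_extensional[OF c]])
qed

lemma char2_space_CS:
  assumes "module F g" "char2_space F M"
  shows "char2_space F (CS F g M n)"
proof -
  interpret g: module F g by fact
  interpret M: char2_space F M by fact
  let ?C = "CS F g M n"
  note e = sym_multilin_extend_zero[OF assms(1) M.module_V]
  note cl = CS_closed[of _ F g M n]
  have add: "c \<oplus>\<^bsub>?C\<^esub> c' \<in> carrier ?C" if c: "c \<in> carrier ?C" and c': "c' \<in> carrier ?C" for c c'
  proof -
    note s = sym_multilinD[OF e[OF c]] and s' = sym_multilinD[OF e[OF c']]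
    have "sym_multilin F g M (\<lambda>xs. extend_zero g M n c xs \<oplus>\<^bsub>M\<^esub> extend_zero g M n c' xs)"
    proof (rule sym_multilinI)
      show "extend_zero g M n c xs \<oplus>\<^bsub>M\<^esub> extend_zero g M n c' xs = extend_zero g M n c ys \<oplus>\<^bsub>M\<^esub> extend_zero g M n c' ys"
        if "xs \<in> gwords g" "mset xs = mset ys" for xs ys using s(2)[OF that] s'(2)[OF that] by simp
    qed (use s(1) s'(1) in \<open>simp_all add: s(3,4) s'(3,4) M.smult_r_distr M.M.a_ac\<close>)
    from restrict_CS[OF assms(1) this, of n] show ?thesis by (simp add: CS_simps cong: restrict_cong)
  qed
  have smult: "a \<odot>\<^bsub>?C\<^esub> c \<in> carrier ?C" if c: "c \<in> carrier ?C" and a: "a \<in> carrier F" for c a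
    unfolding CS_simps
    by (rule CS_composition[OF assms(1) M.module_V M.module_V _ c, of "\<lambda>u. a \<odot>\<^bsub>M\<^esub> u"])
      (rule linear_mapsI, use a in \<open>simp_all add: M.smult_r_distr M.smult_assoc1[symmetric] g.R.m_comm\<close>)
  have zero: "\<zero>\<^bsub>?C\<^esub> \<in> carrier ?C"
    using restrict_CS[OF assms(1), of M "\<lambda>_. \<zero>\<^bsub>M\<^esub>" n] by (simp add: CS_simps sym_multilin_def)
  note simps = CS_simps restrict_def fun_eq_iff
  have ext: "c xs = undefined" if "c \<in> carrier ?C" "xs \<notin> vecs g n" for c xs
    using CS_extensional[OF that(1)] that(2) by (simp add: extensional_def)
  have "abelian_group ?C"
  proof (rule abelian_groupI)
    fix c assume c: "c \<in> carrier ?C"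
    show "\<zero>\<^bsub>?C\<^esub> \<oplus>\<^bsub>?C\<^esub> c = c" using c cl ext[OF c] by (auto simp: simps)
    show "\<exists>c'\<in>carrier ?C. c' \<oplus>\<^bsub>?C\<^esub> c = \<zero>\<^bsub>?C\<^esub>"
      by (rule bexI[OF _ c]) (use cl[OF c] in \<open>auto simp: simps M.add_self\<close>)
  qed (use add zero cl in \<open>auto simp: simps M.M.a_ac\<close>)
  then have "module F ?C"
  proof (rule moduleI[OF g.R.is_cring])
    fix c assume c: "c \<in> carrier ?C"
    show "\<one>\<^bsub>F\<^esub> \<odot>\<^bsub>?C\<^esub> c = c" using cl[OF c] ext[OF c] by (auto simp: simps)
  qed (use smult cl in \<open>auto simp: simps M.smult_l_distr M.smult_r_distr M.smult_assoc1\<close>)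
  then show ?thesis by (intro char2_space.intro char2_space_axioms.intro M.char_2 M.field_axioms)
qed

lemma length_nths_minus1: "length xs = Suc n \<Longrightarrow> i \<le> n \<Longrightarrow> length (nths xs (- {i})) = n"
proof -
  assume a: "length xs = Suc n" "i \<le> n"
  have "{j. j < Suc n \<and> j \<in> - {i}} = {..<Suc n} - {i}" by auto
  then show ?thesis using a by (simp add: length_nths)
qed

lemma length_nths_minus2:
  "length xs = Suc n \<Longrightarrow> i < j \<Longrightarrow> j \<le> n \<Longrightarrow> Suc (length (nths xs (- {i, j}))) = n"
proof -
  assume a: "length xs = Suc n" "i < j" "j \<le> n"
  have "{k. k < Suc n \<and> k \<in> - {i, j}} = {..<Suc n} - {i, j}" by auto
  moreover have "card ({..<Suc n} - {i, j}) = n - 1" using a by (subst card_Diff_subset) auto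
  ultimately show ?thesis using a by (simp add: length_nths)
qed

lemma CS_diff_eq:
  assumes "module F g" "module F M" and c: "c \<in> carrier (CS F g M n)"
    and \<rho>: "\<rho> \<in> carrier g \<rightarrow> carrier M \<rightarrow> carrier M" and \<beta>: "bracket g \<in> carrier g \<rightarrow> carrier g \<rightarrow> carrier g"
  shows "CS_diff g M \<rho> n c = (\<lambda>xs\<in>vecs g (Suc n). word_diff M \<rho> (bracket g) (extend_zero g M n c) xs)"
  unfolding CS_diff_def
proof (rule restrict_ext)
  interpret g: module F g by fact
  interpret M: module F M by fact
  fix xs assume xs: "xs \<in> vecs g (Suc n)"
  note e = sym_multilinD[OF sym_multilin_extend_zero[OF assms(1-3)]]
  have w: "xs \<in> gwords g" and len: "length xs = Suc n" using xs by (auto simp: vecs_iff)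
  have D: "word_diff M \<rho> (bracket g) (extend_zero g M n c) xs =
     finsum M (\<lambda>i. \<rho> (xs ! i) (extend_zero g M n c (nths xs (- {i})))) {..<length xs} \<oplus>\<^bsub>M\<^esub>
     finsum M (\<lambda>(i, j). extend_zero g M n c (bracket g (xs ! i) (xs ! j) # nths xs (- {i, j}))) {(i, j). i < j \<and> j < length xs}"
    by (rule M.M.word_diff_eq_sum[OF \<rho> \<beta> _ e(2) w]) (use e(1) in auto)
  have s: "{..<length xs} = {..n}" "{(i, j). i < j \<and> j < length xs} = {(i, j). i < j \<and> j \<le> n}" using len by auto
  have nth: "xs ! i \<in> carrier g" if "i \<le> n" for i using words_nth[OF w] len that by simp
  have v1: "nths xs (- {i}) \<in> vecs g n" if "i \<le> n" for i
    using words_nths[OF w] length_nths_minus1[OF len that] by (simp add: vecs_iff)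
  have v2: "bracket g (xs ! i) (xs ! j) # nths xs (- {i, j}) \<in> vecs g n" if "i < j" "j \<le> n" for i j
    using words_nths[OF w] length_nths_minus2[OF len that] nth[of i] nth[of j] \<beta> that by (auto simp: vecs_iff)
  have 1: "finsum M (\<lambda>i. \<rho> (xs ! i) (extend_zero g M n c (nths xs (- {i})))) {..n} =
    finsum M (\<lambda>i. \<rho> (xs ! i) (c (nths xs (- {i})))) {..n}"
    by (rule M.M.finsum_cong') (use \<rho> v1 nth CS_closed[OF c v1] in \<open>auto simp: Pi_iff\<close>)
  have 2: "finsum M (\<lambda>(i, j). extend_zero g M n c (bracket g (xs ! i) (xs ! j) # nths xs (- {i, j}))) {(i, j). i < j \<and> j \<le> n} =
    finsum M (\<lambda>(i, j). c (bracket g (xs ! i) (xs ! j) # nths xs (- {i, j}))) {(i, j). i < j \<and> j \<le> n}"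
    by (rule M.M.finsum_cong') (use v2 CS_closed[OF c v2] in auto)
  show "finsum M (\<lambda>i. \<rho> (xs ! i) (c (nths xs (- {i})))) {..n} \<oplus>\<^bsub>M\<^esub>
     finsum M (\<lambda>(i, j). c (bracket g (xs ! i) (xs ! j) # nths xs (- {i, j}))) {(i, j). i < j \<and> j \<le> n} =
     word_diff M \<rho> (bracket g) (extend_zero g M n c) xs"
    unfolding D s 1 2 ..
qed

lemma submodule_kernel:
  assumes "char2_space F V" "module F W" "T \<in> linear_maps F V W"
  shows "submodule {v \<in> carrier V. T v = \<zero>\<^bsub>W\<^esub>} F V"
proof -
  interpret V: char2_space F V by fact
  interpret W: module F W by fact
  show ?thesis
    by (rule V.submoduleI_char2)
      (auto simp: linear_mapsD[OF assms(3)] linear_maps_zero[OF V.module_V assms(2,3)])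
qed

lemma submodule_image:
  assumes "char2_space F V" "char2_space F W" "T \<in> linear_maps F V W" and N: "submodule N F V"
  shows "submodule (T ` N) F W"
proof -
  interpret V: char2_space F V by fact
  interpret W: char2_space F W by fact
  note T = linear_mapsD[OF assms(3)] and N = V.submoduleD[OF N]
  show ?thesis
  proof (rule W.submoduleI_char2)
    show "T ` N \<subseteq> carrier W" using T(1) N(1) by blast
    show "\<zero>\<^bsub>W\<^esub> \<in> T ` N" using linear_maps_zero[OF V.module_V W.module_V assms(3)] N(2) by force
    show "v \<oplus>\<^bsub>W\<^esub> w \<in> T ` N" if vw: "v \<in> T ` N" "w \<in> T ` N" for v w
    proof -
      obtain v' w' where "v' \<in> N" "w' \<in> N" "v = T v'" "w = T w'" using vw by blast
      then show ?thesis using T(2)[of v' w'] N(1,3) by (metis image_eqI subsetD)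
    qed
    show "a \<odot>\<^bsub>W\<^esub> v \<in> T ` N" if av: "a \<in> carrier F" "v \<in> T ` N" for a v
    proof -
      obtain v' where "v' \<in> N" "v = T v'" using av by blast
      then show ?thesis using T(3)[of a v'] N(1,4) av by (metis image_eqI subsetD)
    qed
  qed
qed

context comm_lie_module
begin

abbreviation "C n \<equiv> CS F g M n"
abbreviation "d n \<equiv> CS_diff g M \<rho> n"

lemma C_space: "char2_space F (C n)"
  by (rule char2_space_CS[OF A.module_V V.char2_space_axioms])

lemma sm_extend_zero: "c \<in> carrier (C n) \<Longrightarrow> sm (extend_zero g M n c)"
  by (rule sym_multilin_extend_zero[OF A.module_V V.module_V])

lemma d_eq: "c \<in> carrier (C n) \<Longrightarrow> d n c = (\<lambda>xs\<in>vecs g (Suc n). D (extend_zero g M n c) xs)"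
  by (rule CS_diff_eq[OF A.module_V V.module_V _ act_Pi bracket_Pi])

lemma d_closed: "c \<in> carrier (C n) \<Longrightarrow> d n c \<in> carrier (C (Suc n))"
  unfolding d_eq by (rule restrict_CS[OF A.module_V sm_D[OF sm_extend_zero]])

lemma extend_zero_d: "c \<in> carrier (C n) \<Longrightarrow> xs \<in> gwords g \<Longrightarrow> extend_zero g M (Suc n) (d n c) xs
    = D (extend_zero g M n c) xs"
  unfolding d_eq
proof (rule extend_zero_restrict)
  show "D (extend_zero g M n c) xs = \<zero>\<^bsub>M\<^esub>" if "xs \<in> gwords g" "length xs \<noteq> Suc n" for xs
    by (rule M.M.word_diff_zero[where S = "carrier g" and \<rho> = \<rho>, OF act_zero bracket_Pi that(1)])
        (use that in \<open>auto simp: extend_zero_def vecs_iff\<close>)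
qed

lemma d_d:
  assumes c: "c \<in> carrier (C n)"
  shows "d (Suc n) (d n c) = \<zero>\<^bsub>C (Suc (Suc n))\<^esub>"
  unfolding d_eq[OF d_closed[OF c]] CS_simps
proof (rule restrict_ext)
  fix xs assume "xs \<in> vecs g (Suc (Suc n))"
  then have xs: "xs \<in> gwords g" by (rule vecs_words)
  have "D (extend_zero g M (Suc n) (d n c)) xs = D (D (extend_zero g M n c)) xs"
    by (rule D_cong[OF extend_zero_d[OF c] xs])
  then show "D (extend_zero g M (Suc n) (d n c)) xs = \<zero>\<^bsub>M\<^esub>" using D_D[OF sm_extend_zero[OF c] xs] by simp
qed

lemma d_linear: "d n \<in> linear_maps F (C n) (C (Suc n))"
proof (rule linear_mapsI)
  interpret C: char2_space F "C n" by (rule C_space)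
  show "d n c \<in> carrier (C (Suc n))" if "c \<in> carrier (C n)" for c by (rule d_closed[OF that])
  show "d n (c \<oplus>\<^bsub>C n\<^esub> c') = d n c \<oplus>\<^bsub>C (Suc n)\<^esub> d n c'" if c: "c \<in> carrier (C n)" "c' \<in> carrier (C n)" for c c'
  proof -
    have "d n (c \<oplus>\<^bsub>C n\<^esub> c') = (\<lambda>xs\<in>vecs g (Suc n). D (\<lambda>zs. extend_zero g M n c zs \<oplus>\<^bsub>M\<^esub> extend_zero g M n c' zs) xs)"
      unfolding d_eq[OF C.M.a_closed[OF c]]
      by (intro restrict_ext D_cong) (auto simp: vecs_iff extend_zero_def CS_simps)
    also have "\<dots> = (\<lambda>xs\<in>vecs g (Suc n). D (extend_zero g M n c) xs \<oplus>\<^bsub>M\<^esub> D (extend_zero g M n c') xs)"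
      by (intro restrict_ext D_add sm_Pi sm_extend_zero c vecs_words)
    also have "\<dots> = d n c \<oplus>\<^bsub>C (Suc n)\<^esub> d n c'"
      unfolding CS_simps by (rule restrict_ext) (simp add: d_eq c)
    finally show ?thesis .
  qed
  show "d n (a \<odot>\<^bsub>C n\<^esub> c) = a \<odot>\<^bsub>C (Suc n)\<^esub> d n c" if a: "a \<in> carrier F" and c: "c \<in> carrier (C n)" for a c
  proof -
    have "d n (a \<odot>\<^bsub>C n\<^esub> c) = (\<lambda>xs\<in>vecs g (Suc n). D (\<lambda>zs. a \<odot>\<^bsub>M\<^esub> extend_zero g M n c zs) xs)"
      unfolding d_eq[OF C.smult_closed[OF a c]]
      by (intro restrict_ext D_cong) (auto simp: vecs_iff extend_zero_def CS_simps a)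
    also have "\<dots> = (\<lambda>xs\<in>vecs g (Suc n). a \<odot>\<^bsub>M\<^esub> D (extend_zero g M n c) xs)"
      by (intro restrict_ext D_smult sm_Pi sm_extend_zero a c vecs_words)
    also have "\<dots> = a \<odot>\<^bsub>C (Suc n)\<^esub> d n c"
      unfolding CS_simps by (rule restrict_ext) (simp add: d_eq c)
    finally show ?thesis .
  qed
qed

lemma cocycles_submodule: "submodule (HS_cocycles F g M \<rho> n) F (C n)"
  unfolding cocycles_def by (rule submodule_kernel[OF C_space char2_space.module_V[OF C_space] d_linear])

lemma coboundaries_submodule: "submodule (HS_coboundaries F g M \<rho> n) F (C n)"
proof (cases n)
  case 0
  interpret C: char2_space F "C 0" by (rule C_space)
  show ?thesis unfolding 0 coboundaries_def by (auto intro: C.submoduleI_char2)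
next
  case (Suc m)
  interpret C: char2_space F "C m" by (rule C_space)
  show ?thesis unfolding Suc coboundaries_def nat.case
    by (rule submodule_image[OF C_space C_space d_linear C.carrier_is_submodule])
qed

lemma coboundaries_subset: "HS_coboundaries F g M \<rho> n \<subseteq> HS_cocycles F g M \<rho> n"
proof (cases n)
  case 0
  then show ?thesis
    using char2_space.submoduleD(2)[OF C_space cocycles_submodule, of n] by (simp add: coboundaries_def)
next
  case (Suc m)
  then show ?thesis using d_closed d_d by (auto simp: coboundaries_def cocycles_def)
qed

end

section \<open>Extensions of cochains from the ideal and the quotient\<close>

lemma sym_multilin_zero:
  assumes "module F g" "module F M" "sym_multilin F g M f" "xs \<in> gwords g"
  shows "f (\<zero>\<^bsub>g\<^esub> # xs) = \<zero>\<^bsub>M\<^esub>"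
proof -
  interpret g: module F g by fact
  interpret M: module F M by fact
  show ?thesis
    using sym_multilinD(4)[OF assms(3,4), of "\<zero>\<^bsub>F\<^esub>" "\<zero>\<^bsub>g\<^esub>"] sym_multilinD(1)[OF assms(3), of "\<zero>\<^bsub>g\<^esub> # xs"] assms(4)
    by simp
qed

lemma words_map: "(\<And>x. x \<in> S \<Longrightarrow> \<phi> x \<in> T) \<Longrightarrow> xs \<in> words S \<Longrightarrow> map \<phi> xs \<in> words T"
  by (auto simp: in_words_iff)

lemma sym_multilin_map:
  assumes \<phi>: "\<phi> \<in> linear_maps F k g" and f: "sym_multilin F g M f"
  shows "sym_multilin F k M (\<lambda>ys. f (map \<phi> ys))"
proof -
  note f' = sym_multilinD[OF f]
  have w: "map \<phi> xs \<in> gwords g" if "xs \<in> gwords k" for xs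
    by (rule words_map[OF _ that]) (rule linear_mapsD(1)[OF \<phi>])
  show ?thesis
  proof (rule sym_multilinI)
    show "f (map \<phi> xs) = f (map \<phi> ys)" if "xs \<in> gwords k" "mset xs = mset ys" for xs ys
      by (rule f'(2)[OF w[OF that(1)]]) (simp add: that(2))
  qed (use f'(1,3,4) w in \<open>simp_all add: linear_mapsD[OF \<phi>]\<close>)
qed

lemma sym_multilin_append:
  assumes g: "module F g" and f: "sym_multilin F g M f" and xs: "xs \<in> gwords g"
  shows "sym_multilin F g M (\<lambda>ys. f (xs @ ys))"
  using f xs
proof (induction xs arbitrary: f)
  case (Cons x xs)
  show ?case using Cons.IH[OF sym_multilin_Cons[OF Cons.prems(1) _ g, of x]] Cons.prems(2) by simp
qed simp

text \<open>The sum over all ways of distributing the letters of a word, each letter going through \<open>\<pi>\<close> to the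
  first argument of \<open>f\<close> or through \<open>\<tau>\<close> to the second one.\<close>

fun shuffle :: "('m, 'z) ring_scheme \<Rightarrow> ('g \<Rightarrow> 'q) \<Rightarrow> ('g \<Rightarrow> 'h) \<Rightarrow> ('q list \<Rightarrow> 'h list \<Rightarrow> 'm) \<Rightarrow> 'g list \<Rightarrow> 'm" where
  "shuffle M \<pi> \<tau> f [] = f [] []"
| "shuffle M \<pi> \<tau> f (z # zs) =
     shuffle M \<pi> \<tau> (\<lambda>us. f (\<pi> z # us)) zs \<oplus>\<^bsub>M\<^esub> shuffle M \<pi> \<tau> (\<lambda>us ys. f us (\<tau> z # ys)) zs"

locale split_projections = M: char2_space F M + g: char2_space F g + q: char2_space F \<qq> + h: char2_space F h
  for F :: "('f, 'x) ring_scheme" and M :: "('f, 'm, 'z) module_scheme"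
    and g :: "('f, 'g, 'y2) module_scheme" and \<qq> :: "('f, 'q, 'y3) module_scheme"
    and h :: "('f, 'h, 'y1) module_scheme" and \<pi> :: "'g \<Rightarrow> 'q" and \<tau> :: "'g \<Rightarrow> 'h" +
  assumes \<pi>: "\<pi> \<in> linear_maps F g \<qq>" and \<tau>: "\<tau> \<in> linear_maps F g h"
begin

abbreviation "sh \<equiv> shuffle M \<pi> \<tau>"

definition bisym :: "('q list \<Rightarrow> 'h list \<Rightarrow> 'm) \<Rightarrow> bool" where
  "bisym f \<longleftrightarrow> (\<forall>ys\<in>gwords h. sym_multilin F \<qq> M (\<lambda>us. f us ys)) \<and>
     (\<forall>us\<in>gwords \<qq>. sym_multilin F h M (f us))"

lemma bisymD:
  assumes "bisym f"
  shows "ys \<in> gwords h \<Longrightarrow> sym_multilin F \<qq> M (\<lambda>us. f us ys)"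
    and "us \<in> gwords \<qq> \<Longrightarrow> sym_multilin F h M (f us)"
    and "us \<in> gwords \<qq> \<Longrightarrow> ys \<in> gwords h \<Longrightarrow> f us ys \<in> carrier M"
  using assms sym_multilinD(1) unfolding bisym_def by blast+

lemma bisym_Cons:
  assumes "bisym f"
  shows "z \<in> carrier \<qq> \<Longrightarrow> bisym (\<lambda>us. f (z # us))" "y \<in> carrier h \<Longrightarrow> bisym (\<lambda>us ys. f us (y # ys))"
proof -
  show "bisym (\<lambda>us. f (z # us))" if z: "z \<in> carrier \<qq>"
    unfolding bisym_def
    using sym_multilin_Cons[OF bisymD(1)[OF assms] z q.module_V] bisymD(2)[OF assms] z by simp
  show "bisym (\<lambda>us ys. f us (y # ys))" if y: "y \<in> carrier h"
    unfolding bisym_def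
    using sym_multilin_Cons[OF bisymD(2)[OF assms] y h.module_V] bisymD(1)[OF assms] y by simp
qed

lemma proj_closed [simp]: "x \<in> carrier g \<Longrightarrow> \<pi> x \<in> carrier \<qq>" "x \<in> carrier g \<Longrightarrow> \<tau> x \<in> carrier h"
  by (rule linear_mapsD(1)[OF \<pi>], assumption) (rule linear_mapsD(1)[OF \<tau>])

lemma shuffle_cong:
  assumes "\<And>us ys. us \<in> gwords \<qq> \<Longrightarrow> ys \<in> gwords h \<Longrightarrow> f us ys = f' us ys" "zs \<in> gwords g"
  shows "sh f zs = sh f' zs"
  using assms
proof (induction zs arbitrary: f f')
  case (Cons z zs)
  have "sh (\<lambda>us. f (\<pi> z # us)) zs = sh (\<lambda>us. f' (\<pi> z # us)) zs"
    "sh (\<lambda>us ys. f us (\<tau> z # ys)) zs = sh (\<lambda>us ys. f' us (\<tau> z # ys)) zs"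
    using Cons.prems(2) by (intro Cons.IH Cons.prems(1); simp)+
  then show ?case by simp
qed simp

lemma shuffle_closed:
  assumes "\<And>us ys. us \<in> gwords \<qq> \<Longrightarrow> ys \<in> gwords h \<Longrightarrow> f us ys \<in> carrier M" "zs \<in> gwords g"
  shows "sh f zs \<in> carrier M"
  using assms
proof (induction zs arbitrary: f)
  case (Cons z zs)
  have "sh (\<lambda>us. f (\<pi> z # us)) zs \<in> carrier M" "sh (\<lambda>us ys. f us (\<tau> z # ys)) zs \<in> carrier M"
    using Cons.prems(2) by (intro Cons.IH Cons.prems(1); simp)+
  then show ?case by simp
qed simp

lemma shuffle_add:
  assumes "\<And>us ys. us \<in> gwords \<qq> \<Longrightarrow> ys \<in> gwords h \<Longrightarrow> f us ys \<in> carrier M"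
    "\<And>us ys. us \<in> gwords \<qq> \<Longrightarrow> ys \<in> gwords h \<Longrightarrow> f' us ys \<in> carrier M" "zs \<in> gwords g"
  shows "sh (\<lambda>us ys. f us ys \<oplus>\<^bsub>M\<^esub> f' us ys) zs = sh f zs \<oplus>\<^bsub>M\<^esub> sh f' zs"
  using assms
proof (induction zs arbitrary: f f')
  case (Cons z zs)
  have z: "z \<in> carrier g" "zs \<in> gwords g" using Cons.prems by auto
  have "sh (\<lambda>us. f (\<pi> z # us)) zs \<in> carrier M" "sh (\<lambda>us ys. f us (\<tau> z # ys)) zs \<in> carrier M"
    "sh (\<lambda>us. f' (\<pi> z # us)) zs \<in> carrier M" "sh (\<lambda>us ys. f' us (\<tau> z # ys)) zs \<in> carrier M"
    using z by (intro shuffle_closed Cons.prems(1,2); simp)+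
  moreover have "sh (\<lambda>us ys. f (\<pi> z # us) ys \<oplus>\<^bsub>M\<^esub> f' (\<pi> z # us) ys) zs =
      sh (\<lambda>us. f (\<pi> z # us)) zs \<oplus>\<^bsub>M\<^esub> sh (\<lambda>us. f' (\<pi> z # us)) zs"
    "sh (\<lambda>us ys. f us (\<tau> z # ys) \<oplus>\<^bsub>M\<^esub> f' us (\<tau> z # ys)) zs =
      sh (\<lambda>us ys. f us (\<tau> z # ys)) zs \<oplus>\<^bsub>M\<^esub> sh (\<lambda>us ys. f' us (\<tau> z # ys)) zs"
    using z by (intro Cons.IH Cons.prems(1,2); simp)+
  ultimately show ?case by (simp add: M.M.a_ac)
qed simp

lemma shuffle_smult:
  assumes "\<And>us ys. us \<in> gwords \<qq> \<Longrightarrow> ys \<in> gwords h \<Longrightarrow> f us ys \<in> carrier M"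
    "a \<in> carrier F" "zs \<in> gwords g"
  shows "sh (\<lambda>us ys. a \<odot>\<^bsub>M\<^esub> f us ys) zs = a \<odot>\<^bsub>M\<^esub> sh f zs"
  using assms
proof (induction zs arbitrary: f)
  case (Cons z zs)
  have z: "z \<in> carrier g" "zs \<in> gwords g" using Cons.prems by auto
  have "sh (\<lambda>us. f (\<pi> z # us)) zs \<in> carrier M" "sh (\<lambda>us ys. f us (\<tau> z # ys)) zs \<in> carrier M"
    using z by (intro shuffle_closed Cons.prems(1); simp)+
  moreover have "sh (\<lambda>us ys. a \<odot>\<^bsub>M\<^esub> f (\<pi> z # us) ys) zs = a \<odot>\<^bsub>M\<^esub> sh (\<lambda>us. f (\<pi> z # us)) zs"
    "sh (\<lambda>us ys. a \<odot>\<^bsub>M\<^esub> f us (\<tau> z # ys)) zs = a \<odot>\<^bsub>M\<^esub> sh (\<lambda>us ys. f us (\<tau> z # ys)) zs"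
    using z by (intro Cons.IH Cons.prems(1,2); simp)+
  ultimately show ?case using Cons.prems(2) by (simp add: M.smult_r_distr)
qed simp

text \<open>Exchanging the first two letters exchanges the two summands in which these letters go to different
  arguments of \<open>f\<close>, and fixes the other two by the symmetry of \<open>f\<close> in each argument.\<close>

lemma sym_multilin_shuffle:
  assumes f: "bisym f"
  shows "sym_multilin F g M (sh f)"
proof (rule sym_multilinI)
  have closed: "sh f xs \<in> carrier M" if "bisym f" "xs \<in> gwords g" for f xs
    by (rule shuffle_closed[OF bisymD(3)[OF that(1)] that(2)])
  show "sh f xs \<in> carrier M" if "xs \<in> gwords g" for xs by (rule closed[OF f that])
  have sym: "sh f xs = sh f ys" if "xs \<in> gwords g" "mset xs = mset ys" "bisym f" for xs ys f
    using that
  proof (induction xs arbitrary: f ys rule: measure_induct_rule[of length])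
    case (less xs)
    note f = less.prems(3)
    show ?case
    proof (rule symmetric_by_swaps[of "carrier g" "sh f"])
      show "sh f (x # y # zs) = sh f (y # x # zs)"
        if x: "x \<in> carrier g" and y: "y \<in> carrier g" and zs: "zs \<in> gwords g" for x y zs
      proof -
        have "f (\<pi> x # \<pi> y # us) ys = f (\<pi> y # \<pi> x # us) ys"
          if "us \<in> gwords \<qq>" "ys \<in> gwords h" for us ys
          by (rule sym_multilinD(2)[OF bisymD(1)[OF f that(2)]]) (use that x y in auto)
        then have 1: "sh (\<lambda>us. f (\<pi> x # \<pi> y # us)) zs = sh (\<lambda>us. f (\<pi> y # \<pi> x # us)) zs"
          by (rule shuffle_cong[OF _ zs])
        have "f us (\<tau> x # \<tau> y # ys) = f us (\<tau> y # \<tau> x # ys)"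
          if "us \<in> gwords \<qq>" "ys \<in> gwords h" for us ys
          by (rule sym_multilinD(2)[OF bisymD(2)[OF f that(1)]]) (use that x y in auto)
        then have 2: "sh (\<lambda>us ys. f us (\<tau> x # \<tau> y # ys)) zs = sh (\<lambda>us ys. f us (\<tau> y # \<tau> x # ys)) zs"
          by (rule shuffle_cong[OF _ zs])
        have "bisym (\<lambda>us. f (\<pi> x # \<pi> y # us))" "bisym (\<lambda>us. f (\<pi> y # \<pi> x # us))"
          "bisym (\<lambda>us ys. f us (\<tau> x # \<tau> y # ys))" "bisym (\<lambda>us ys. f us (\<tau> y # \<tau> x # ys))"
          "bisym (\<lambda>us ys. f (\<pi> x # us) (\<tau> y # ys))" "bisym (\<lambda>us ys. f (\<pi> y # us) (\<tau> x # ys))"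
          using bisym_Cons(1)[OF bisym_Cons(1)[OF f]] bisym_Cons(2)[OF bisym_Cons(2)[OF f]]
            bisym_Cons(2)[OF bisym_Cons(1)[OF f]] x y by auto
        note c = this[THEN closed, OF zs]
        show ?thesis using c by (simp add: 1 2 M.M.a_ac)
      qed
      show "sh f (x # zs) = sh f (x # zs')"
        if xz: "x \<in> carrier g" "zs \<in> gwords g" "length zs < length xs" "mset zs = mset zs'" for x zs zs'
        using less.IH[OF xz(3,2,4) bisym_Cons(1)[OF f]] less.IH[OF xz(3,2,4) bisym_Cons(2)[OF f]] xz(1) by simp
    qed (use less.prems in auto)
  qed
  show "sh f xs = sh f ys" if "xs \<in> gwords g" "mset xs = mset ys" for xs ys by (rule sym[OF that f])
  show "sh f ((x \<oplus>\<^bsub>g\<^esub> y) # xs) = sh f (x # xs) \<oplus>\<^bsub>M\<^esub> sh f (y # xs)"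
    if xs: "xs \<in> gwords g" and x: "x \<in> carrier g" and y: "y \<in> carrier g" for xs x y
  proof -
    note b = bisym_Cons(1)[OF f proj_closed(1)[OF x]] bisym_Cons(1)[OF f proj_closed(1)[OF y]]
      bisym_Cons(2)[OF f proj_closed(2)[OF x]] bisym_Cons(2)[OF f proj_closed(2)[OF y]]
    have "sh (\<lambda>us. f (\<pi> (x \<oplus>\<^bsub>g\<^esub> y) # us)) xs = sh (\<lambda>us ys. f (\<pi> x # us) ys \<oplus>\<^bsub>M\<^esub> f (\<pi> y # us) ys) xs"
      by (rule shuffle_cong[OF _ xs])
        (use x y sym_multilinD(3)[OF bisymD(1)[OF f]] in \<open>simp add: linear_mapsD(2)[OF \<pi>]\<close>)
    also have "\<dots> = sh (\<lambda>us. f (\<pi> x # us)) xs \<oplus>\<^bsub>M\<^esub> sh (\<lambda>us. f (\<pi> y # us)) xs"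
      by (rule shuffle_add[OF bisymD(3)[OF b(1)] bisymD(3)[OF b(2)] xs])
    finally have 1: "sh (\<lambda>us. f (\<pi> (x \<oplus>\<^bsub>g\<^esub> y) # us)) xs = \<dots>" .
    have "sh (\<lambda>us ys. f us (\<tau> (x \<oplus>\<^bsub>g\<^esub> y) # ys)) xs = sh (\<lambda>us ys. f us (\<tau> x # ys) \<oplus>\<^bsub>M\<^esub> f us (\<tau> y # ys)) xs"
      by (rule shuffle_cong[OF _ xs])
        (use x y sym_multilinD(3)[OF bisymD(2)[OF f]] in \<open>simp add: linear_mapsD(2)[OF \<tau>]\<close>)
    also have "\<dots> = sh (\<lambda>us ys. f us (\<tau> x # ys)) xs \<oplus>\<^bsub>M\<^esub> sh (\<lambda>us ys. f us (\<tau> y # ys)) xs"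
      by (rule shuffle_add[OF bisymD(3)[OF b(3)] bisymD(3)[OF b(4)] xs])
    finally show ?thesis using 1 b[THEN closed, OF xs] by (simp add: M.M.a_ac)
  qed
  show "sh f ((a \<odot>\<^bsub>g\<^esub> x) # xs) = a \<odot>\<^bsub>M\<^esub> sh f (x # xs)"
    if xs: "xs \<in> gwords g" and a: "a \<in> carrier F" and x: "x \<in> carrier g" for xs a x
  proof -
    note b = bisym_Cons(1)[OF f proj_closed(1)[OF x]] bisym_Cons(2)[OF f proj_closed(2)[OF x]]
    have "sh (\<lambda>us. f (\<pi> (a \<odot>\<^bsub>g\<^esub> x) # us)) xs = sh (\<lambda>us ys. a \<odot>\<^bsub>M\<^esub> f (\<pi> x # us) ys) xs"
      by (rule shuffle_cong[OF _ xs])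
        (use x a sym_multilinD(4)[OF bisymD(1)[OF f]] in \<open>simp add: linear_mapsD(3)[OF \<pi>]\<close>)
    also have "\<dots> = a \<odot>\<^bsub>M\<^esub> sh (\<lambda>us. f (\<pi> x # us)) xs"
      by (rule shuffle_smult[OF bisymD(3)[OF b(1)] a xs])
    finally have 1: "sh (\<lambda>us. f (\<pi> (a \<odot>\<^bsub>g\<^esub> x) # us)) xs = \<dots>" .
    have "sh (\<lambda>us ys. f us (\<tau> (a \<odot>\<^bsub>g\<^esub> x) # ys)) xs = sh (\<lambda>us ys. a \<odot>\<^bsub>M\<^esub> f us (\<tau> x # ys)) xs"
      by (rule shuffle_cong[OF _ xs])
        (use x a sym_multilinD(4)[OF bisymD(2)[OF f]] in \<open>simp add: linear_mapsD(3)[OF \<tau>]\<close>)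
    also have "\<dots> = a \<odot>\<^bsub>M\<^esub> sh (\<lambda>us ys. f us (\<tau> x # ys)) xs"
      by (rule shuffle_smult[OF bisymD(3)[OF b(2)] a xs])
    finally show ?thesis using 1 b[THEN closed, OF xs] a by (simp add: M.smult_r_distr)
  qed
qed

lemma shuffle_zero:
  assumes "\<And>us ys. us \<in> gwords \<qq> \<Longrightarrow> ys \<in> gwords h \<Longrightarrow> f us ys = \<zero>\<^bsub>M\<^esub>" "zs \<in> gwords g"
  shows "sh f zs = \<zero>\<^bsub>M\<^esub>"
  using assms
proof (induction zs arbitrary: f)
  case (Cons z zs)
  have "sh (\<lambda>us. f (\<pi> z # us)) zs = \<zero>\<^bsub>M\<^esub>" "sh (\<lambda>us ys. f us (\<tau> z # ys)) zs = \<zero>\<^bsub>M\<^esub>"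
    using Cons.prems(2) by (intro Cons.IH Cons.prems(1); simp)+
  then show ?case by simp
qed simp

lemma shuffle_ideal:
  assumes \<iota>: "\<And>y. y \<in> carrier h \<Longrightarrow> \<iota> y \<in> carrier g \<and> \<pi> (\<iota> y) = \<zero>\<^bsub>\<qq>\<^esub> \<and> \<tau> (\<iota> y) = y"
    and "bisym f" "ys \<in> gwords h"
  shows "sh f (map \<iota> ys) = f [] ys"
  using assms(2,3)
proof (induction ys arbitrary: f)
  case (Cons y ys)
  have y: "y \<in> carrier h" and ys: "ys \<in> gwords h" using Cons.prems by auto
  have w: "map \<iota> ys \<in> gwords g" by (rule words_map[OF _ ys]) (simp add: \<iota>)
  have "sh (\<lambda>us. f (\<zero>\<^bsub>\<qq>\<^esub> # us)) (map \<iota> ys) = \<zero>\<^bsub>M\<^esub>"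
    by (rule shuffle_zero[OF _ w], rule sym_multilin_zero[OF q.module_V M.module_V bisymD(1)[OF Cons.prems(1)]])
  moreover have "sh (\<lambda>us ys. f us (y # ys)) (map \<iota> ys) = f [] (y # ys)"
    by (rule Cons.IH[OF bisym_Cons(2)[OF Cons.prems(1) y] ys])
  ultimately show ?case using \<iota>[OF y] bisymD(3)[OF Cons.prems(1), of "[]" "y # ys"] y ys by simp
qed simp

text \<open>All distributions but one contribute nothing: either some letter \<open>\<iota> y\<close> goes to the first argument, where
  \<open>\<pi>\<close> makes it zero, or the second argument receives more than \<open>length ys\<close> letters.\<close>

lemma shuffle_eval:
  assumes \<iota>: "\<And>y. y \<in> carrier h \<Longrightarrow> \<iota> y \<in> carrier g \<and> \<pi> (\<iota> y) = \<zero>\<^bsub>\<qq>\<^esub> \<and> \<tau> (\<iota> y) = y"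
    and "bisym f" "xs \<in> gwords g" and ys: "ys \<in> gwords h"
    and "\<And>us ys'. us \<in> gwords \<qq> \<Longrightarrow> ys' \<in> gwords h \<Longrightarrow> length ys < length ys' \<Longrightarrow> f us ys' = \<zero>\<^bsub>M\<^esub>"
  shows "sh f (xs @ map \<iota> ys) = f (map \<pi> xs) ys"
  using assms(2,3,5)
proof (induction xs arbitrary: f)
  case Nil
  then show ?case using shuffle_ideal[OF \<iota> _ ys] by simp
next
  case (Cons x xs)
  have x: "x \<in> carrier g" and xs: "xs \<in> gwords g" using Cons.prems by auto
  note b = bisym_Cons(1)[OF Cons.prems(1) proj_closed(1)[OF x]] bisym_Cons(2)[OF Cons.prems(1) proj_closed(2)[OF x]]
  have pxs: "map \<pi> xs \<in> gwords \<qq>" by (rule words_map[OF _ xs]) simp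
  have "sh (\<lambda>us. f (\<pi> x # us)) (xs @ map \<iota> ys) = f (\<pi> x # map \<pi> xs) ys"
    by (rule Cons.IH[OF b(1) xs Cons.prems(3)]) (use x in simp_all)
  moreover have "sh (\<lambda>us ys. f us (\<tau> x # ys)) (xs @ map \<iota> ys) = f (map \<pi> xs) (\<tau> x # ys)"
    by (rule Cons.IH[OF b(2) xs Cons.prems(3)]) (use x in simp_all)
  moreover have "f (map \<pi> xs) (\<tau> x # ys) = \<zero>\<^bsub>M\<^esub>"
    by (rule Cons.prems(3)[OF pxs]) (use x ys in simp_all)
  moreover have "f (\<pi> x # map \<pi> xs) ys \<in> carrier M" by (rule bisymD(3)[OF Cons.prems(1)]) (use x pxs ys in simp_all)
  ultimately show ?case by simp
qed

end

section \<open>Restricting cochains along the ideal\<close>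

lemma word_lie_map:
  assumes "\<And>y. y \<in> S \<Longrightarrow> \<delta> (\<phi> y) = \<phi> (\<delta>' y)" "ys \<in> words S"
  shows "word_lie M a \<delta> f (map \<phi> ys) = word_lie M a \<delta>' (\<lambda>ys. f (map \<phi> ys)) ys"
  using assms(2)
proof (induction ys arbitrary: f)
  case (Cons y ys)
  then show ?case using assms(1)[of y] Cons.IH[of "\<lambda>zs. f (\<phi> y # zs)"] by simp
qed simp

lemma word_diff_map:
  assumes "\<And>x y. x \<in> S \<Longrightarrow> y \<in> S \<Longrightarrow> \<beta> (\<phi> x) (\<phi> y) = \<phi> (\<beta>' x y)" "ys \<in> words S"
  shows "word_diff M \<rho> \<beta> f (map \<phi> ys) = word_diff M (\<lambda>y. \<rho> (\<phi> y)) \<beta>' (\<lambda>ys. f (map \<phi> ys)) ys"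
  using assms(2)
proof (induction ys arbitrary: f)
  case (Cons y ys)
  then show ?case
    using word_lie_map[of S "\<beta> (\<phi> y)" \<phi> "\<beta>' y" ys M "\<rho> (\<phi> y)" f] assms(1) Cons.IH[of "\<lambda>zs. f (\<phi> y # zs)"] by simp
qed simp

locale comm_lie_extension_module =
  comm_lie_short_exact F h g \<qq> \<iota> \<pi> + gM: comm_lie_module F g M \<rho>
  for F :: "('f, 'x) ring_scheme"
    and h :: "('f, 'h, 'y1) lie_algebra_scheme"
    and g :: "('f, 'g, 'y2) lie_algebra_scheme"
    and \<qq> :: "('f, 'q, 'y3) lie_algebra_scheme"
    and \<iota> :: "'h \<Rightarrow> 'g" and \<pi> :: "'g \<Rightarrow> 'q"
    and M :: "('f, 'm, 'z) module_scheme" and \<rho> :: "'g \<Rightarrow> 'm \<Rightarrow> 'm"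
begin

abbreviation "Cg \<equiv> CS F g M"
abbreviation "Ch \<equiv> CS F h M"
abbreviation "H \<equiv> \<iota> ` carrier h"
abbreviation "Fil \<equiv> CS_filt F g M H"
abbreviation "ad x y \<equiv> inv_into (carrier h) \<iota> (bracket g x (\<iota> y))"
abbreviation "\<l> q \<equiv> lie_derivative h g \<iota> M \<rho> q"

lemma incl_linear: "\<iota> \<in> linear_maps F h g"
  and incl_bracket: "\<And>x y. x \<in> carrier h \<Longrightarrow> y \<in> carrier h \<Longrightarrow> \<iota> (bracket h x y) = bracket g (\<iota> x) (\<iota> y)"
  using incl_hom unfolding lie_homs_def by blast+

lemma proj_linear: "\<pi> \<in> linear_maps F g \<qq>"
  and proj_bracket: "\<And>x y. x \<in> carrier g \<Longrightarrow> y \<in> carrier g \<Longrightarrow> \<pi> (bracket g x y) = bracket \<qq> (\<pi> x) (\<pi> y)"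
  using proj_hom unfolding lie_homs_def by blast+

lemma incl_closed [simp]: "y \<in> carrier h \<Longrightarrow> \<iota> y \<in> carrier g"
  by (rule linear_mapsD(1)[OF incl_linear])

lemma proj_closed [simp]: "x \<in> carrier g \<Longrightarrow> \<pi> x \<in> carrier \<qq>"
  by (rule linear_mapsD(1)[OF proj_linear])

lemma words_incl [simp]: "ys \<in> gwords h \<Longrightarrow> map \<iota> ys \<in> gwords g"
  by (rule words_map[OF incl_closed])

lemma words_proj [simp]: "xs \<in> gwords g \<Longrightarrow> map \<pi> xs \<in> gwords \<qq>"
  by (rule words_map[OF proj_closed])

lemma mem_ideal_iff: "x \<in> carrier g \<Longrightarrow> x \<in> H \<longleftrightarrow> \<pi> x = \<zero>\<^bsub>\<qq>\<^esub>"
  using exact by blast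

lemma proj_incl: "y \<in> carrier h \<Longrightarrow> \<pi> (\<iota> y) = \<zero>\<^bsub>\<qq>\<^esub>"
  using exact by blast

lemma inv_incl: "y \<in> carrier h \<Longrightarrow> inv_into (carrier h) \<iota> (\<iota> y) = y"
  by (rule inv_into_f_f[OF incl_inj])

lemma incl_inv: "x \<in> H \<Longrightarrow> \<iota> (inv_into (carrier h) \<iota> x) = x" "x \<in> H \<Longrightarrow> inv_into (carrier h) \<iota> x \<in> carrier h"
  by (rule f_inv_into_f, assumption) (rule inv_into_into)

lemma inv_incl_linear:
  assumes T: "T \<in> linear_maps F k g" and "\<And>x. x \<in> carrier k \<Longrightarrow> T x \<in> H" "module F k"
  shows "(\<lambda>x. inv_into (carrier h) \<iota> (T x)) \<in> linear_maps F k h"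
proof -
  interpret k: module F k by fact
  let ?S = "\<lambda>x. inv_into (carrier h) \<iota> (T x)"
  have S: "?S x \<in> carrier h" "\<iota> (?S x) = T x" if "x \<in> carrier k" for x
    using assms(2)[OF that] by (simp_all add: incl_inv)
  have eq: "?S x = y" if "x \<in> carrier k" "y \<in> carrier h" "T x = \<iota> y" for x y
    using that inv_incl by simp
  show ?thesis
    by (rule linear_mapsI; (intro eq)?)
      (simp_all add: S linear_mapsD[OF T] linear_mapsD[OF incl_linear])
qed

lemma bracket_ideal: "x \<in> carrier g \<Longrightarrow> y \<in> carrier h \<Longrightarrow> bracket g x (\<iota> y) \<in> H"
proof -
  assume x: "x \<in> carrier g" and y: "y \<in> carrier h"
  have "\<pi> (bracket g x (\<iota> y)) = bracket \<qq> (\<pi> x) \<zero>\<^bsub>\<qq>\<^esub>"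
    using x y by (simp add: proj_bracket proj_incl)
  also have "\<dots> = \<zero>\<^bsub>\<qq>\<^esub>"
    by (rule linear_maps_zero[OF q.A.module_V q.A.module_V q.bracket_linear]) (use x in simp)
  finally show ?thesis using x y by (simp add: mem_ideal_iff g.bracket_closed)
qed

lemma ad_linear: "x \<in> carrier g \<Longrightarrow> ad x \<in> linear_maps F h h"
proof (rule inv_incl_linear[OF _ bracket_ideal h.A.module_V])
  assume x: "x \<in> carrier g"
  note b = g.bracket_linear[OF x]
  show "(\<lambda>y. bracket g x (\<iota> y)) \<in> linear_maps F h g"
    by (rule linear_mapsI) (simp_all add: linear_mapsD[OF b] linear_mapsD[OF incl_linear])
qed

lemma incl_ad: "x \<in> carrier g \<Longrightarrow> y \<in> carrier h \<Longrightarrow> \<iota> (ad x y) = bracket g x (\<iota> y)"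
  by (rule incl_inv(1)[OF bracket_ideal])

sublocale hM: comm_lie_module F h M "\<lambda>y. \<rho> (\<iota> y)"
  by (intro comm_lie_module.intro comm_lie_module_axioms.intro h.comm_lie_algebra_axioms gM.M.module_axioms)
    (simp_all add: gM.act_closed gM.act_add_left gM.act_add_right gM.act_smult_left gM.act_smult_right
      gM.act_bracket incl_bracket linear_mapsD[OF incl_linear])

lemma ex_linear_section: "\<exists>s\<in>linear_maps F \<qq> g. \<forall>z\<in>carrier \<qq>. \<pi> (s z) = z"
  by (rule linear_section[OF g.A.char2_space_axioms q.A.char2_space_axioms proj_linear])
    (metis proj_surj imageE)

definition "sec = (SOME s. s \<in> linear_maps F \<qq> g \<and> (\<forall>z\<in>carrier \<qq>. \<pi> (s z) = z))"

lemma sec_linear: "sec \<in> linear_maps F \<qq> g" and proj_sec: "z \<in> carrier \<qq> \<Longrightarrow> \<pi> (sec z) = z"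
  using someI_ex[OF ex_linear_section[unfolded Bex_def]] unfolding sec_def by auto

lemma sec_closed [simp]: "z \<in> carrier \<qq> \<Longrightarrow> sec z \<in> carrier g"
  by (rule linear_mapsD(1)[OF sec_linear])

text \<open>The element \<open>x - sec (\<pi> x)\<close> of the ideal, read in \<open>h\<close>; the difference is a sum in characteristic two.\<close>

definition "retr x = inv_into (carrier h) \<iota> (x \<oplus>\<^bsub>g\<^esub> sec (\<pi> x))"

lemma retr_linear: "retr \<in> linear_maps F g h"
  unfolding retr_def[abs_def]
proof (rule inv_incl_linear[OF _ _ g.A.module_V])
  show "(\<lambda>x. x \<oplus>\<^bsub>g\<^esub> sec (\<pi> x)) \<in> linear_maps F g g"
    by (rule linear_mapsI)
      (simp_all add: linear_mapsD[OF proj_linear] linear_mapsD[OF sec_linear] g.M.a_ac g.smult_r_distr)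
  show "x \<oplus>\<^bsub>g\<^esub> sec (\<pi> x) \<in> H" if "x \<in> carrier g" for x
    using that by (simp add: mem_ideal_iff linear_mapsD(2)[OF proj_linear] proj_sec q.A.add_self)
qed

lemma retr_incl: "y \<in> carrier h \<Longrightarrow> retr (\<iota> y) = y"
  using linear_maps_zero[OF q.A.module_V g.A.module_V sec_linear]
  by (simp add: retr_def proj_incl inv_incl)

sublocale split_projections F M g \<qq> h \<pi> retr
  by (intro split_projections.intro split_projections_axioms.intro gM.V.char2_space_axioms
      g.A.char2_space_axioms q.A.char2_space_axioms h.A.char2_space_axioms proj_linear retr_linear)

definition slice :: "nat \<Rightarrow> ('g list \<Rightarrow> 'm) \<Rightarrow> 'g list \<Rightarrow> 'h list \<Rightarrow> 'm" where
  "slice q c xs = (\<lambda>ys\<in>vecs h q. c (xs @ map \<iota> ys))"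

lemma sm_slice: "gM.sm c \<Longrightarrow> xs \<in> gwords g \<Longrightarrow> hM.sm (\<lambda>ys. c (xs @ map \<iota> ys))"
  by (rule sym_multilin_map[OF incl_linear sym_multilin_append[OF g.A.module_V]])

lemma slice_closed: "gM.sm c \<Longrightarrow> xs \<in> gwords g \<Longrightarrow> slice q c xs \<in> carrier (Ch q)"
  unfolding slice_def by (rule restrict_CS[OF h.A.module_V sm_slice])

lemma slice_extend_zero:
  "xs \<in> vecs g p \<Longrightarrow> slice q (extend_zero g M (p + q) c) xs = slice q c xs"
  unfolding slice_def by (rule restrict_ext) (auto simp: extend_zero_def vecs_iff)

lemma slice_closed': "c \<in> carrier (Cg (p + q)) \<Longrightarrow> xs \<in> vecs g p \<Longrightarrow> slice q c xs \<in> carrier (Ch q)"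
  using slice_closed[OF gM.sm_extend_zero vecs_words] slice_extend_zero by metis

lemma lie_derivative_eq:
  assumes "f \<in> carrier (Ch q)" "x \<in> carrier g"
  shows "\<l> q x f = (\<lambda>ys\<in>vecs h q. word_lie M (\<rho> x) (ad x) (extend_zero h M q f) ys)"
  unfolding lie_derivative_def
proof (rule restrict_ext)
  fix ys assume ys: "ys \<in> vecs h q"
  have w: "ys \<in> gwords h" and len: "length ys = q" using ys by (auto simp: vecs_iff)
  have v: "ys[i := ad x (ys ! i)] \<in> vecs h q" if "i < q" for i
    by (rule vecs_upd[OF ys linear_mapsD(1)[OF ad_linear[OF assms(2)]]]) (use words_nth[OF w] len that in simp)
  have "word_lie M (\<rho> x) (ad x) (extend_zero h M q f) ys = \<rho> x (extend_zero h M q f ys) \<oplus>\<^bsub>M\<^esub>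
    finsum M (\<lambda>i. extend_zero h M q f (ys[i := ad x (ys ! i)])) {..<length ys}"
    by (rule gM.M.M.word_lie_eq_sum[OF _ _ hM.sm_Pi[OF hM.sm_extend_zero[OF assms(1)]] w])
      (use linear_mapsD(1)[OF ad_linear[OF assms(2)]] assms(2) in \<open>auto simp: gM.act_closed\<close>)
  also have "finsum M (\<lambda>i. extend_zero h M q f (ys[i := ad x (ys ! i)])) {..<length ys} =
      finsum M (\<lambda>i. f (ys[i := ad x (ys ! i)])) {..<q}"
    unfolding len by (rule gM.M.M.finsum_cong') (use CS_closed[OF assms(1) v] v in auto)
  finally show "\<rho> x (f ys) \<oplus>\<^bsub>M\<^esub> finsum M (\<lambda>i. f (ys[i := ad x (ys ! i)])) {..<q} =
      word_lie M (\<rho> x) (ad x) (extend_zero h M q f) ys" using ys by simp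
qed

lemma lie_derivative_closed: "f \<in> carrier (Ch q) \<Longrightarrow> x \<in> carrier g \<Longrightarrow> \<l> q x f \<in> carrier (Ch q)"
  unfolding lie_derivative_eq
  by (rule restrict_CS[OF h.A.module_V sym_multilin_Lie[OF h.A.module_V gM.V.module_V gM.act_linear ad_linear hM.sm_extend_zero]])

lemma lie_derivative_linear: "x \<in> carrier g \<Longrightarrow> \<l> q x \<in> linear_maps F (Ch q) (Ch q)"
proof (rule linear_mapsI)
  assume x: "x \<in> carrier g"
  interpret C: char2_space F "Ch q" by (rule hM.C_space)
  have \<rho>: "\<rho> x \<in> carrier M \<rightarrow> carrier M" and ad: "ad x \<in> carrier h \<rightarrow> carrier h"
    using gM.act_closed[OF x] linear_mapsD(1)[OF ad_linear[OF x]] by auto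
  show "\<l> q x f \<in> carrier (Ch q)" if "f \<in> carrier (Ch q)" for f
    by (rule lie_derivative_closed[OF that x])
  show "\<l> q x (f \<oplus>\<^bsub>Ch q\<^esub> f') = \<l> q x f \<oplus>\<^bsub>Ch q\<^esub> \<l> q x f'"
    if f: "f \<in> carrier (Ch q)" "f' \<in> carrier (Ch q)" for f f'
  proof -
    have "\<l> q x (f \<oplus>\<^bsub>Ch q\<^esub> f') = (\<lambda>ys\<in>vecs h q. word_lie M (\<rho> x) (ad x) (\<lambda>zs. extend_zero h M q f zs
        \<oplus>\<^bsub>M\<^esub> extend_zero h M q f' zs) ys)"
      unfolding lie_derivative_eq[OF C.M.a_closed[OF f] x]
      by (intro restrict_ext word_lie_cong[OF _ ad]) (auto simp: vecs_iff extend_zero_def CS_simps)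
    also have "\<dots> = (\<lambda>ys\<in>vecs h q. word_lie M (\<rho> x) (ad x) (extend_zero h M q f) ys
        \<oplus>\<^bsub>M\<^esub> word_lie M (\<rho> x) (ad x) (extend_zero h M q f') ys)"
      by (intro restrict_ext gM.M.M.word_lie_add[OF \<rho> gM.act_add_right ad] hM.sm_Pi hM.sm_extend_zero f vecs_words x)
    finally show ?thesis
      unfolding CS_simps by (simp add: lie_derivative_eq f x cong: restrict_cong)
  qed
  show "\<l> q x (a \<odot>\<^bsub>Ch q\<^esub> f) = a \<odot>\<^bsub>Ch q\<^esub> \<l> q x f"
    if a: "a \<in> carrier F" and f: "f \<in> carrier (Ch q)" for a f
  proof -
    have "\<l> q x (a \<odot>\<^bsub>Ch q\<^esub> f) = (\<lambda>ys\<in>vecs h q. word_lie M (\<rho> x) (ad x) (\<lambda>zs. a \<odot>\<^bsub>M\<^esub> extend_zero h M q f zs) ys)"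
      unfolding lie_derivative_eq[OF C.smult_closed[OF a f] x]
      by (intro restrict_ext word_lie_cong[OF _ ad]) (auto simp: vecs_iff extend_zero_def CS_simps a)
    also have "\<dots> = (\<lambda>ys\<in>vecs h q. a \<odot>\<^bsub>M\<^esub> word_lie M (\<rho> x) (ad x) (extend_zero h M q f) ys)"
      by (intro restrict_ext gM.M.word_lie_smult[OF \<rho> gM.act_smult_right ad] hM.sm_Pi hM.sm_extend_zero a f vecs_words x)
    finally show ?thesis
      unfolding CS_simps by (simp add: lie_derivative_eq f x cong: restrict_cong)
  qed
qed

lemma lie_derivative_Pi: "\<l> q \<in> carrier g \<rightarrow> carrier (Ch q) \<rightarrow> carrier (Ch q)"
  by (auto simp: lie_derivative_closed)

text \<open>The algebra \<open>g\<close> acts on \<open>CS\<^sup>q(h, M)\<close> by Lie derivatives, and this action descends to \<open>\<qq>\<close> on cohomology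
  only. So the differential of the slices is formed with letters from \<open>g\<close>.\<close>

abbreviation "outer_diff q c \<equiv> word_diff (Ch q) (\<l> q) (bracket g) (slice q c)"

lemma outer_diff_closed: "gM.sm c \<Longrightarrow> xs \<in> gwords g \<Longrightarrow> outer_diff q c xs \<in> carrier (Ch q)"
  by (rule abelian_monoid.word_diff_closed[OF _ lie_derivative_Pi g.bracket_Pi])
    (use char2_space.axioms(2)[OF hM.C_space] slice_closed in \<open>auto simp: module_def abelian_group_def\<close>)

lemma slice_Cons: "slice q c (x # xs) = slice q (\<lambda>zs. c (x # zs)) xs"
  by (simp add: slice_def)

text \<open>The Lie derivative along \<open>x\<close> brackets \<open>x\<close> with every letter; the brackets with the letters of \<open>ys\<close>
  stay in the ideal and, together with the action on the value, form the Lie derivative of the slice.\<close>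

lemma word_lie_slice:
  assumes "gM.sm c" "xs \<in> gwords g" and x: "x \<in> carrier g" and ys: "ys \<in> vecs h q"
  shows "gM.L x c (xs @ map \<iota> ys) = word_lie (Ch q) (\<l> q x) (bracket g x) (slice q c) xs ys"
  using assms(1,2)
proof (induction xs arbitrary: c)
  case Nil
  have w: "ys \<in> gwords h" by (rule vecs_words[OF ys])
  have "gM.L x c (map \<iota> ys) = word_lie M (\<rho> x) (ad x) (\<lambda>ys. c (map \<iota> ys)) ys"
    by (rule word_lie_map[of "carrier h"]) (simp_all add: incl_ad x w)
  also have "\<dots> = word_lie M (\<rho> x) (ad x) (extend_zero h M q (slice q c [])) ys"
  proof (rule word_lie_cong[OF _ _ w])
    show "ad x \<in> carrier h \<rightarrow> carrier h" using linear_mapsD(1)[OF ad_linear[OF x]] by auto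
    show "c (map \<iota> zs) = extend_zero h M q (slice q c []) zs" if "zs \<in> gwords h" "length zs = length ys" for zs
      using that ys by (simp add: vecs_iff slice_def)
  qed
  also have "\<dots> = \<l> q x (slice q c []) ys"
    by (simp add: lie_derivative_eq[OF slice_closed[OF Nil(1)] x] ys)
  finally show ?case by simp
next
  case (Cons z xs)
  have z: "z \<in> carrier g" "xs \<in> gwords g" using Cons.prems by auto
  have eval: "slice q c (bracket g x z # xs) ys = c (bracket g x z # xs @ map \<iota> ys)"
    using ys by (simp add: slice_def)
  show ?case
    using Cons.IH[OF gM.sm_Cons[OF Cons.prems(1) z(1)] z(2)] ys eval
    by (simp add: CS_simps slice_Cons[abs_def])
qed

text \<open>Each letter \<open>x\<close> of \<open>xs\<close> contributes, by Cartan's formula, a Lie derivative, which \<open>word_lie_slice\<close> rewrites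
  in terms of slices. When \<open>xs\<close> is used up, the differential of \<open>h\<close> remains.\<close>

lemma D_slice:
  assumes "gM.sm c" "xs \<in> gwords g" and ys: "ys \<in> vecs h q"
  shows "gM.D c (xs @ map \<iota> ys) = outer_diff q c xs ys \<oplus>\<^bsub>M\<^esub> hM.D (\<lambda>ys. c (xs @ map \<iota> ys)) ys"
  using assms(1,2)
proof (induction xs arbitrary: c)
  case Nil
  have w: "ys \<in> gwords h" by (rule vecs_words[OF ys])
  have "gM.D c (map \<iota> ys) = hM.D (\<lambda>ys. c (map \<iota> ys)) ys"
    by (rule word_diff_map[of "carrier h"]) (simp_all add: incl_bracket w)
  moreover have "hM.D (\<lambda>ys. c (map \<iota> ys)) ys \<in> carrier M"
    using hM.D_closed[OF sm_slice[OF Nil] w] by simp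
  ultimately show ?case by (simp add: CS_simps ys)
next
  case (Cons x xs)
  have x: "x \<in> carrier g" and xs: "xs \<in> gwords g" using Cons.prems by auto
  note sx = gM.sm_Cons[OF Cons.prems(1) x]
  have w: "ys \<in> gwords h" by (rule vecs_words[OF ys])
  have "word_lie (Ch q) (\<l> q x) (bracket g x) (slice q c) xs ys \<in> carrier M"
    unfolding word_lie_slice[OF Cons.prems(1) xs x ys, symmetric]
    by (rule gM.L_closed[OF Cons.prems(1) x]) (use xs w in simp)
  moreover have "outer_diff q (\<lambda>zs. c (x # zs)) xs ys \<in> carrier M"
    by (rule CS_closed[OF outer_diff_closed[OF sx xs] ys])
  moreover have "hM.D (\<lambda>ys. c (x # xs @ map \<iota> ys)) ys \<in> carrier M"
    by (rule hM.D_closed[OF sm_slice[OF sx xs] w])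
  ultimately show ?case
    using Cons.IH[OF sx xs] word_lie_slice[OF Cons.prems(1) xs x ys] ys
    by (simp add: CS_simps slice_Cons[abs_def] gM.M.M.a_assoc)
qed

end

section \<open>The filtration and the first two pages\<close>

context comm_lie_extension_module
begin

lemma split_word:
  assumes xs: "xs \<in> gwords g" and k: "k \<le> card {i. i < length xs \<and> xs ! i \<in> H}"
  shows "\<exists>us\<in>gwords g. \<exists>ys\<in>gwords h. length ys = k \<and> mset xs = mset (us @ map \<iota> ys)"
proof (intro bexI conjI)
  let ?A = "filter (\<lambda>x. x \<in> H) xs" and ?B = "filter (\<lambda>x. x \<notin> H) xs"
  let ?ys = "map (inv_into (carrier h) \<iota>) (take k ?A)"
  have A: "x \<in> H" if "x \<in> set (take k ?A)" for x using set_take_subset[of k ?A] that by auto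
  then have "(\<iota> \<circ> inv_into (carrier h) \<iota>) x = x" if "x \<in> set (take k ?A)" for x
    using incl_inv(1)[OF A[OF that]] by simp
  then have ys: "map \<iota> ?ys = take k ?A" unfolding map_map by (rule map_idI)
  show "length ?ys = k" using k by (simp add: length_filter_conv_card)
  show "?ys \<in> gwords h"
    by (rule words_map[OF incl_inv(2)[OF A]]) (simp_all only: in_words_iff, blast)
  show "drop k ?A @ ?B \<in> gwords g"
    using xs set_drop_subset[of k ?A] unfolding words_simps by (force simp: in_words_iff)
  have "mset xs = mset ?A + mset ?B" using multiset_partition[of "mset xs" "\<lambda>x. x \<in> H"] by simp
  also have "mset ?A = mset (take k ?A) + mset (drop k ?A)" by (metis append_take_drop_id mset_append)
  finally show "mset xs = mset ((drop k ?A @ ?B) @ map \<iota> ?ys)" unfolding ys by (simp add: ac_simps)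
qed

text \<open>By symmetry it suffices to test words whose last letters are those from the ideal.\<close>

lemma mem_Fil_iff:
  "c \<in> Fil k n \<longleftrightarrow> c \<in> carrier (Cg n) \<and> (\<forall>us\<in>gwords g. \<forall>ys\<in>gwords h.
     length us + length ys = n \<longrightarrow> int n - k + 1 \<le> int (length ys) \<longrightarrow> c (us @ map \<iota> ys) = \<zero>\<^bsub>M\<^esub>)"
  (is "_ \<longleftrightarrow> _ \<and> ?P")
proof (intro iffI conjI)
  assume c: "c \<in> Fil k n"
  then show "c \<in> carrier (Cg n)" unfolding CS_filt_def by blast
  show ?P
  proof (intro ballI impI)
    fix us ys assume *: "us \<in> gwords g" "ys \<in> gwords h" "length us + length ys = n"
      "int n - k + 1 \<le> int (length ys)"
    let ?xs = "us @ map \<iota> ys"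
    have "filter (\<lambda>x. x \<in> H) (map \<iota> ys) = map \<iota> ys" using *(2) by (auto simp: in_words_iff intro: filter_True)
    then have "length ys \<le> length (filter (\<lambda>x. x \<in> H) ?xs)" by simp
    moreover have "length (filter (\<lambda>x. x \<in> H) ?xs) = card {i. i < n \<and> ?xs ! i \<in> H}"
      using *(3) unfolding length_filter_conv_card by simp
    ultimately have "length ys \<le> card {i. i < n \<and> ?xs ! i \<in> H}" by simp
    then have card: "int n - k + 1 \<le> int (card {i. i < n \<and> ?xs ! i \<in> H})" using *(4) by linarith
    have "?xs \<in> vecs g n" using * by (simp add: vecs_iff)
    with card show "c ?xs = \<zero>\<^bsub>M\<^esub>" using c unfolding CS_filt_def by blast
  qed
next
  assume "c \<in> carrier (Cg n) \<and> ?P"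
  then have c: "c \<in> carrier (Cg n)" and P: ?P by auto
  have "c xs = \<zero>\<^bsub>M\<^esub>" if xs: "xs \<in> vecs g n" and k: "int (card {i. i < n \<and> xs ! i \<in> H}) \<ge> int n - k + 1" for xs
  proof -
    obtain us ys where *: "us \<in> gwords g" "ys \<in> gwords h"
      "length ys = card {i. i < n \<and> xs ! i \<in> H}" "mset xs = mset (us @ map \<iota> ys)"
      using split_word[of xs "card {i. i < n \<and> xs ! i \<in> H}"] xs by (auto simp: vecs_iff)
    have len: "length us + length ys = n" using mset_eq_length[OF *(4)] xs by (simp add: vecs_iff)
    have "c (us @ map \<iota> ys) = \<zero>\<^bsub>M\<^esub>" by (rule P[rule_format, OF *(1,2) len]) (use k *(3) in simp)
    then show ?thesis using CS_sym[OF c xs *(4)] by simp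
  qed
  then show "c \<in> Fil k n" using c unfolding CS_filt_def by blast
qed

lemma Fil_closed: "c \<in> Fil k n \<Longrightarrow> c \<in> carrier (Cg n)"
  unfolding CS_filt_def by blast

lemma Fil_antimono:
  assumes "k \<le> k'" "c \<in> Fil k' n"
  shows "c \<in> Fil k n"
proof -
  have "int n - k + 1 \<le> int m \<Longrightarrow> int n - k' + 1 \<le> int m" for m using assms(1) by simp
  then show ?thesis using assms(2) unfolding mem_Fil_iff by blast
qed

lemma Fil_nonpos:
  assumes "k \<le> 0"
  shows "Fil k n = carrier (Cg n)"
proof -
  have "\<not> int n - k + 1 \<le> int m" if "l + m = n" for l m using assms that by linarith
  then show ?thesis unfolding set_eq_iff mem_Fil_iff by blast
qed

lemma Fil_submodule: "submodule (Fil k n) F (Cg n)"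
proof -
  interpret C: char2_space F "Cg n" by (rule gM.C_space)
  have v: "us @ map \<iota> ys \<in> vecs g n"
    if "us \<in> gwords g" "ys \<in> gwords h" "length us + length ys = n" for us ys
    using that by (simp add: vecs_iff)
  show ?thesis
    by (rule C.submoduleI_char2) (simp_all add: subset_iff mem_Fil_iff v CS_simps C.M.zero_closed[unfolded CS_simps]
        C.M.a_closed[unfolded CS_simps] C.smult_closed[unfolded CS_simps])
qed

lemma slice_zero_iff:
  "slice q c us = \<zero>\<^bsub>Ch q\<^esub> \<longleftrightarrow> (\<forall>ys\<in>vecs h q. c (us @ map \<iota> ys) = \<zero>\<^bsub>M\<^esub>)"
  by (auto simp: slice_def CS_simps restrict_def fun_eq_iff)

text \<open>A word with more than \<open>q\<close> letters from the ideal is covered as well, since the surplus can be counted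
  among the \<open>p\<close> letters from \<open>g\<close>.\<close>

lemma Fil_Suc_iff:
  "c \<in> Fil (int (Suc p)) (p + q) \<longleftrightarrow> c \<in> carrier (Cg (p + q)) \<and> (\<forall>us\<in>vecs g p. slice q c us = \<zero>\<^bsub>Ch q\<^esub>)"
proof (intro iffI conjI ballI)
  assume c: "c \<in> Fil (int (Suc p)) (p + q)"
  then show "c \<in> carrier (Cg (p + q))" by (rule Fil_closed)
  show "slice q c us = \<zero>\<^bsub>Ch q\<^esub>" if "us \<in> vecs g p" for us
    unfolding slice_zero_iff using c that by (auto simp: mem_Fil_iff vecs_iff)
next
  assume "c \<in> carrier (Cg (p + q)) \<and> (\<forall>us\<in>vecs g p. slice q c us = \<zero>\<^bsub>Ch q\<^esub>)"
  then have c: "c \<in> carrier (Cg (p + q))"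
    and z: "\<And>us ys. us \<in> vecs g p \<Longrightarrow> ys \<in> vecs h q \<Longrightarrow> c (us @ map \<iota> ys) = \<zero>\<^bsub>M\<^esub>"
    unfolding slice_zero_iff by auto
  have "c (us @ map \<iota> ys) = \<zero>\<^bsub>M\<^esub>"
    if *: "us \<in> gwords g" "ys \<in> gwords h" "length us + length ys = p + q" "q \<le> length ys" for us ys
  proof -
    let ?k = "length ys - q"
    have "take ?k ys @ drop ?k ys \<in> gwords h" using *(2) by simp
    then have w: "take ?k ys \<in> gwords h" "drop ?k ys \<in> gwords h" unfolding words_simps by auto
    have "c ((us @ map \<iota> (take ?k ys)) @ map \<iota> (drop ?k ys)) = \<zero>\<^bsub>M\<^esub>"
      by (rule z) (use * w in \<open>simp_all add: vecs_iff\<close>)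
    then show ?thesis by (simp flip: map_append)
  qed
  then show "c \<in> Fil (int (Suc p)) (p + q)" using c unfolding mem_Fil_iff by auto
qed

lemma Fil_words:
  assumes "c \<in> Fil (int p) (p + q)" "us \<in> gwords g" "ys \<in> gwords h" "q < length ys"
  shows "extend_zero g M (p + q) c (us @ map \<iota> ys) = \<zero>\<^bsub>M\<^esub>"
proof (cases "length us + length ys = p + q")
  case True
  have "c (us @ map \<iota> ys) = \<zero>\<^bsub>M\<^esub>"
    by (rule assms(1)[unfolded mem_Fil_iff, THEN conjunct2, rule_format, OF assms(2,3) True]) (use assms(4) in simp)
  then show ?thesis by (simp add: extend_zero_def)
qed (simp add: extend_zero_def vecs_iff)

text \<open>The shuffle sum of \<open>f\<close> along \<open>\<pi>\<close> and the retraction. It has filtration degree \<open>p\<close> because the second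
  argument of \<open>f\<close> accepts only \<open>q\<close> letters.\<close>

lemma ex_slice_eq:
  assumes f: "f \<in> carrier (CS F \<qq> (Ch q) p)"
  shows "\<exists>c\<in>Fil (int p) (p + q). \<forall>us\<in>vecs g p. slice q c us = f (map \<pi> us)"
proof -
  interpret Ch: char2_space F "Ch q" by (rule hM.C_space)
  let ?e = "extend_zero \<qq> (Ch q) p f"
  let ?f = "\<lambda>us. extend_zero h M q (?e us)"
  note e = sym_multilinD[OF sym_multilin_extend_zero[OF q.A.module_V Ch.module_V f]]
  have bi: "bisym ?f"
    unfolding bisym_def
  proof (intro conjI ballI)
    fix us assume "us \<in> gwords \<qq>"
    then show "hM.sm (?f us)" by (rule hM.sm_extend_zero[OF e(1)])
  next
    fix ys assume ys: "ys \<in> gwords h"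
    show "sym_multilin F \<qq> M (\<lambda>us. ?f us ys)"
    proof (rule sym_multilinI)
      show "?f us ys \<in> carrier M" if "us \<in> gwords \<qq>" for us
        by (rule sym_multilinD(1)[OF hM.sm_extend_zero[OF e(1)[OF that]] ys])
      show "?f us ys = ?f vs ys" if "us \<in> gwords \<qq>" "mset us = mset vs" for us vs
        using e(2)[OF that] by simp
    qed (use e(3,4) in \<open>simp_all add: extend_zero_def[of h] CS_simps\<close>)
  qed
  let ?c = "\<lambda>xs\<in>vecs g (p + q). sh ?f xs"
  have eval: "sh ?f (us @ map \<iota> ys) = ?f (map \<pi> us) ys"
    if "us \<in> gwords g" "ys \<in> gwords h" "q \<le> length ys" for us ys
    by (rule shuffle_eval[OF _ bi that(1,2)])
      (use that(3) in \<open>auto simp: proj_incl retr_incl extend_zero_def[of h] vecs_iff\<close>)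
  have "?c \<in> Fil (int p) (p + q)"
    unfolding mem_Fil_iff
  proof (intro conjI ballI impI)
    show "?c \<in> carrier (Cg (p + q))"
      by (rule restrict_CS[OF g.A.module_V sym_multilin_shuffle[OF bi]])
    show "?c (us @ map \<iota> ys) = \<zero>\<^bsub>M\<^esub>"
      if "us \<in> gwords g" "ys \<in> gwords h" "length us + length ys = p + q"
        "int (p + q) - int p + 1 \<le> int (length ys)" for us ys
      using that eval[OF that(1,2)] by (simp add: vecs_iff extend_zero_def[of h])
  qed
  moreover have "slice q ?c us = f (map \<pi> us)" if us: "us \<in> vecs g p" for us
  proof -
    have v: "map \<pi> us \<in> vecs \<qq> p" using us by (auto simp: vecs_iff)
    have "slice q ?c us = (\<lambda>ys\<in>vecs h q. f (map \<pi> us) ys)"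
      unfolding slice_def using us eval[of us] v by (intro restrict_ext) (auto simp: vecs_iff)
    also have "\<dots> = f (map \<pi> us)"
      by (rule extensional_restrict[OF CS_extensional[OF CS_closed[OF f v]]])
    finally show ?thesis .
  qed
  ultimately show ?thesis by blast
qed

text \<open>Changing a letter of the first block by an element of the ideal changes the value of \<open>c\<close> by a value
  at a word with \<open>q + 1\<close> letters from the ideal.\<close>

lemma slice_map_proj:
  assumes c: "c \<in> Fil (int p) (p + q)" and us: "us \<in> vecs g p" and vs: "vs \<in> vecs g p" and eq: "map \<pi> us = map \<pi> vs"
  shows "slice q c us = slice q c vs"
proof -
  have *: "f us = f vs" if "gM.sm f" "\<And>x zs. x \<in> H \<Longrightarrow> zs \<in> gwords g \<Longrightarrow> f (x # zs) = \<zero>\<^bsub>M\<^esub>"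
    "us \<in> gwords g" "vs \<in> gwords g" "map \<pi> us = map \<pi> vs" for f us vs
    using that
  proof (induction us arbitrary: f vs)
    case (Cons x us)
    then obtain y ws where vs: "vs = y # ws" by (cases vs) auto
    have x: "x \<in> carrier g" "us \<in> gwords g" and y: "y \<in> carrier g" "ws \<in> gwords g"
      using Cons.prems vs by auto
    note f = sym_multilinD[OF Cons.prems(1)]
    have "x \<oplus>\<^bsub>g\<^esub> y \<in> H"
      using Cons.prems(5) vs x y by (simp add: mem_ideal_iff linear_mapsD(2)[OF proj_linear] q.A.add_self)
    then have "f (x # us) \<oplus>\<^bsub>M\<^esub> f (y # us) = \<zero>\<^bsub>M\<^esub>"
      using Cons.prems(2)[of "x \<oplus>\<^bsub>g\<^esub> y" us] f(3)[of us x y] x y by simp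
    then have "f (x # us) = f (y # us)"
      using f(1)[of "x # us"] f(1)[of "y # us"] x y by (simp add: gM.V.add_eq_zero_iff)
    also have "\<dots> = f (y # ws)"
    proof (rule Cons.IH[OF gM.sm_Cons[OF Cons.prems(1) y(1)] _ x(2) y(2)])
      show "f (y # z # zs) = \<zero>\<^bsub>M\<^esub>" if "z \<in> H" "zs \<in> gwords g" for z zs
      proof -
        have "f (y # z # zs) = f (z # y # zs)" by (rule f(2)) (use that y in auto)
        then show ?thesis using Cons.prems(2)[OF that(1), of "y # zs"] that y by simp
      qed
      show "map \<pi> us = map \<pi> ws" using Cons.prems(5) vs by simp
    qed
    finally show ?case using vs by simp
  qed simp
  let ?e = "extend_zero g M (p + q) c"
  have "?e (us @ map \<iota> ys) = ?e (vs @ map \<iota> ys)" if ys: "ys \<in> vecs h q" for ys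
  proof (rule *[of "\<lambda>us. ?e (us @ map \<iota> ys)", OF _ _ vecs_words[OF us] vecs_words[OF vs] eq])
    have w: "ys \<in> gwords h" by (rule vecs_words[OF ys])
    note e = sym_multilinD[OF gM.sm_extend_zero[OF Fil_closed[OF c]]]
    show "gM.sm (\<lambda>us. ?e (us @ map \<iota> ys))"
    proof (rule sym_multilinI)
      show "?e (us @ map \<iota> ys) = ?e (vs @ map \<iota> ys)" if "us \<in> gwords g" "mset us = mset vs" for us vs
        by (rule e(2)) (use that w in simp_all)
    qed (use e(1,3,4) w in simp_all)
    show "?e ((x # zs) @ map \<iota> ys) = \<zero>\<^bsub>M\<^esub>" if x: "x \<in> H" and zs: "zs \<in> gwords g" for x zs
    proof -
      obtain y where y: "y \<in> carrier h" "x = \<iota> y" using x by blast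
      have "?e ((x # zs) @ map \<iota> ys) = ?e (zs @ map \<iota> (y # ys))"
        by (rule e(2)) (use y zs w in simp_all)
      then show ?thesis using Fil_words[OF c zs, of "y # ys"] y ys by (simp add: vecs_iff)
    qed
  qed
  then have "slice q ?e us = slice q ?e vs" unfolding slice_def by (intro restrict_ext)
  then show ?thesis by (simp add: slice_extend_zero us vs)
qed

lemma slice_d_eq:
  assumes c: "c \<in> carrier (Cg (p + q))" and us: "us \<in> gwords g" and ys: "ys \<in> vecs h r"
    and len: "length us + r = Suc (p + q)"
  shows "gM.d (p + q) c (us @ map \<iota> ys) = outer_diff r (extend_zero g M (p + q) c) us ys \<oplus>\<^bsub>M\<^esub>
    hM.D (\<lambda>ys. extend_zero g M (p + q) c (us @ map \<iota> ys)) ys"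
proof -
  have v: "us @ map \<iota> ys \<in> vecs g (Suc (p + q))" using us ys len by (auto simp: vecs_iff)
  then show ?thesis
    unfolding gM.d_eq[OF c] restrict_apply'[OF v] by (intro D_slice gM.sm_extend_zero c us ys)
qed

text \<open>The outer differential evaluates \<open>c\<close> only at words with at least \<open>r\<close> letters from the ideal.\<close>

lemma outer_diff_zero:
  assumes c: "c \<in> Fil (int p) (p + q)" and us: "us \<in> gwords g" and "q < r"
  shows "outer_diff r (extend_zero g M (p + q) c) us = \<zero>\<^bsub>Ch r\<^esub>"
proof -
  interpret C: char2_space F "Ch r" by (rule hM.C_space)
  show ?thesis
  proof (rule C.M.word_diff_zero[OF _ g.bracket_Pi us])
    show "\<l> r x \<zero>\<^bsub>Ch r\<^esub> = \<zero>\<^bsub>Ch r\<^esub>" if "x \<in> carrier g" for x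
      by (rule linear_maps_zero[OF C.module_V C.module_V lie_derivative_linear[OF that]])
    show "slice r (extend_zero g M (p + q) c) zs = \<zero>\<^bsub>Ch r\<^esub>" if "zs \<in> gwords g" for zs
      unfolding slice_zero_iff using Fil_words[OF c that] assms(3) by (auto simp: vecs_iff)
  qed
qed

text \<open>The differential on \<open>E\<^sub>0\<close> is that of \<open>h\<close>: the outer summand in \<open>D_slice\<close> vanishes by \<open>outer_diff_zero\<close>.\<close>

lemma slice_d:
  assumes c: "c \<in> Fil (int p) (p + q)" and us: "us \<in> vecs g p"
  shows "slice (Suc q) (gM.d (p + q) c) us = hM.d q (slice q c us)"
  unfolding hM.d_eq[OF slice_closed'[OF Fil_closed[OF c] us]] slice_def[of "Suc q"]
proof (rule restrict_ext)
  fix ys assume ys: "ys \<in> vecs h (Suc q)"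
  have w: "us \<in> gwords g" "length us = p" "ys \<in> gwords h" "length ys = Suc q"
    using us ys by (auto simp: vecs_iff)
  have "gM.d (p + q) c (us @ map \<iota> ys) = hM.D (\<lambda>ys. extend_zero g M (p + q) c (us @ map \<iota> ys)) ys"
    using slice_d_eq[OF Fil_closed[OF c] w(1) ys] outer_diff_zero[OF c w(1), of "Suc q"] w ys
      hM.D_closed[OF sm_slice[OF gM.sm_extend_zero[OF Fil_closed[OF c]] w(1)] w(3)] by (simp add: CS_simps)
  also have "\<dots> = hM.D (extend_zero h M q (slice q c us)) ys"
    by (rule hM.D_cong[OF _ w(3)]) (use w us in \<open>auto simp: extend_zero_def vecs_iff slice_def\<close>)
  finally show "gM.d (p + q) c (us @ map \<iota> ys) = hM.D (extend_zero h M q (slice q c us)) ys" .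
qed

lemma d_Fil:
  assumes c: "c \<in> Fil (int p) (p + q)"
  shows "gM.d (p + q) c \<in> Fil (int p) (Suc (p + q))"
  unfolding mem_Fil_iff
proof (intro conjI ballI impI)
  show "gM.d (p + q) c \<in> carrier (Cg (Suc (p + q)))" by (rule gM.d_closed[OF Fil_closed[OF c]])
  fix us ys assume us: "us \<in> gwords g" and ys: "ys \<in> gwords h"
    and len: "length us + length ys = Suc (p + q)" "int (Suc (p + q)) - int p + 1 \<le> int (length ys)"
  have v: "ys \<in> vecs h (length ys)" using ys by (simp add: vecs_iff)
  have "hM.D (\<lambda>ys. extend_zero g M (p + q) c (us @ map \<iota> ys)) ys = \<zero>\<^bsub>M\<^esub>"
    by (rule gM.M.M.word_diff_zero[where S = "carrier h" and \<rho> = "\<lambda>y. \<rho> (\<iota> y)", OF hM.act_zero h.bracket_Pi ys])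
      (use len(2) in \<open>auto intro!: Fil_words[OF c us]\<close>)
  then show "gM.d (p + q) c (us @ map \<iota> ys) = \<zero>\<^bsub>M\<^esub>"
    using slice_d_eq[OF Fil_closed[OF c] us v len(1)] outer_diff_zero[OF c us, of "length ys"] len(2) v
    by (simp add: CS_simps)
qed

lemma d_Fil_Suc_iff:
  assumes c: "c \<in> Fil (int p) (p + q)"
  shows "gM.d (p + q) c \<in> Fil (int (Suc p)) (Suc (p + q))
      \<longleftrightarrow> (\<forall>us\<in>vecs g p. slice q c us \<in> HS_cocycles F h M (\<lambda>y. \<rho> (\<iota> y)) q)"
  using Fil_Suc_iff[of "gM.d (p + q) c" p "Suc q"] gM.d_closed[OF Fil_closed[OF c]] slice_d[OF c]
    slice_closed'[OF Fil_closed[OF c]]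
  by (simp add: cocycles_def)

abbreviation "Zh q \<equiv> HS_cocycles F h M (\<lambda>y. \<rho> (\<iota> y)) q"
abbreviation "Bh q \<equiv> HS_coboundaries F h M (\<lambda>y. \<rho> (\<iota> y)) q"

text \<open>The differential on \<open>E\<^sub>1\<close>, before passing to classes: in \<open>D_slice\<close> the second summand is the
  coboundary of the function \<open>\<lambda>ys. c (xs @ map \<iota> ys)\<close> of \<open>q - 1\<close> letters, or zero if \<open>q = 0\<close>.\<close>

lemma slice_d_outer_diff:
  assumes c: "c \<in> carrier (Cg (p + q))" and xs: "xs \<in> vecs g (Suc p)"
  shows "slice q (gM.d (p + q) c) xs \<oplus>\<^bsub>Ch q\<^esub> outer_diff q (extend_zero g M (p + q) c) xs \<in> Bh q"
proof -
  interpret C: char2_space F "Ch q" by (rule hM.C_space)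
  let ?e = "extend_zero g M (p + q) c"
  have w: "xs \<in> gwords g" "length xs = Suc p" using xs by (auto simp: vecs_iff)
  note sme = sm_slice[OF gM.sm_extend_zero[OF c] w(1)]
  have "slice q (gM.d (p + q) c) xs \<oplus>\<^bsub>Ch q\<^esub> outer_diff q ?e xs = (\<lambda>ys\<in>vecs h q. hM.D (\<lambda>ys. ?e (xs @ map \<iota> ys)) ys)"
    unfolding CS_simps
  proof (rule restrict_ext)
    fix ys assume ys: "ys \<in> vecs h q"
    show "slice q (gM.d (p + q) c) xs ys \<oplus>\<^bsub>M\<^esub> outer_diff q ?e xs ys = hM.D (\<lambda>ys. ?e (xs @ map \<iota> ys)) ys"
      using slice_d_eq[OF c w(1) ys] w(2) ys CS_closed[OF outer_diff_closed[OF gM.sm_extend_zero[OF c] w(1)] ys]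
        hM.D_closed[OF sme vecs_words[OF ys]]
      by (simp add: slice_def gM.V.char2_simps)
  qed
  also have "\<dots> \<in> Bh q"
  proof (cases q)
    case 0
    have "(\<lambda>ys\<in>vecs h q. hM.D (\<lambda>ys. ?e (xs @ map \<iota> ys)) ys) = \<zero>\<^bsub>Ch q\<^esub>"
      unfolding CS_simps 0 by (rule restrict_ext) (simp add: vecs_iff)
    then show ?thesis by (simp add: coboundaries_def 0)
  next
    case (Suc r)
    let ?b = "\<lambda>ys\<in>vecs h r. ?e (xs @ map \<iota> ys)"
    have b: "?b \<in> carrier (Ch r)" by (rule restrict_CS[OF h.A.module_V sme])
    have "(\<lambda>ys\<in>vecs h q. hM.D (\<lambda>ys. ?e (xs @ map \<iota> ys)) ys) = hM.d r ?b"
      unfolding hM.d_eq[OF b] Suc[symmetric]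
      by (intro restrict_ext hM.D_cong) (auto simp: vecs_iff extend_zero_def Suc)
    then show ?thesis using b by (auto simp: coboundaries_def Suc)
  qed
  finally show ?thesis .
qed

section \<open>The action of the quotient on the cohomology of the ideal\<close>

text \<open>This turns \<open>slice_d_outer_diff\<close>, for words with a single letter from \<open>g\<close>, into a statement about Lie
  derivatives of cochains of \<open>h\<close>.\<close>

lemma outer_diff_single:
  assumes "c \<in> carrier (Cg q)" "x \<in> carrier g"
  shows "outer_diff q (extend_zero g M q c) [x] = \<l> q x (slice q c [])"
proof -
  interpret C: char2_space F "Ch q" by (rule hM.C_space)
  have "slice q (extend_zero g M q c) [] = slice q c []" using slice_extend_zero[of "[]" 0 q c]
    by (simp add: vecs_iff)
  moreover have "slice q c [] \<in> carrier (Ch q)" using slice_closed'[of c 0 q "[]"] assms by (simp add: vecs_iff)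
  ultimately show ?thesis using lie_derivative_closed assms(2) by simp
qed

lemma ex_extension_cochain:
  assumes "f \<in> carrier (Ch q)"
  shows "\<exists>c\<in>carrier (Cg q). slice q c [] = f"
proof -
  have "sym_multilin F \<qq> (Ch q) (\<lambda>us. if us = [] then f else \<zero>\<^bsub>Ch q\<^esub>)"
  proof -
    interpret C: char2_space F "Ch q" by (rule hM.C_space)
    show ?thesis by (rule sym_multilinI) (use assms in auto)
  qed
  from ex_slice_eq[OF restrict_CS[OF q.A.module_V this, of 0]] show ?thesis
    using Fil_closed by (fastforce simp: vecs_iff)
qed

lemma lie_derivative_slice:
  assumes "c \<in> carrier (Cg q)" "x \<in> carrier g"
  shows "slice q (gM.d q c) [x] \<oplus>\<^bsub>Ch q\<^esub> \<l> q x (slice q c []) \<in> Bh q"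
  using slice_d_outer_diff[of c 0 q "[x]"] assms outer_diff_single[OF assms] by (simp add: vecs_iff)

text \<open>Let \<open>f = d e\<close> and extend \<open>e\<close> to a cochain \<open>c\<close> of \<open>g\<close>. Then \<open>d c\<close> extends \<open>f\<close>, and by \<open>d d c = 0\<close> the
  formula \<open>lie_derivative_slice\<close> for \<open>d c\<close> says that the Lie derivative of \<open>f\<close> is a coboundary.\<close>

lemma lie_derivative_coboundary:
  assumes f: "f \<in> Bh q" and x: "x \<in> carrier g"
  shows "\<l> q x f \<in> Bh q"
proof (cases q)
  case 0
  then have "f = \<zero>\<^bsub>Ch q\<^esub>" using f by (simp add: coboundaries_def)
  then show ?thesis
    using linear_maps_zero[OF _ _ lie_derivative_linear[OF x]] char2_space.module_V[OF hM.C_space]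
      char2_space.submoduleD(2)[OF hM.C_space hM.coboundaries_submodule] by metis
next
  case (Suc r)
  interpret C: char2_space F "Ch (Suc r)" by (rule hM.C_space)
  obtain e where e: "e \<in> carrier (Ch r)" "f = hM.d r e" using f by (auto simp: coboundaries_def Suc)
  obtain c where c: "c \<in> carrier (Cg r)" "slice r c [] = e" using ex_extension_cochain[OF e(1)] by blast
  have s: "slice q (gM.d r c) [] = f"
    using slice_d[of c 0 r "[]"] c e Suc by (simp add: Fil_nonpos vecs_iff)
  have "slice q (gM.d q (gM.d r c)) [x] = \<zero>\<^bsub>Ch q\<^esub>"
    unfolding Suc gM.d_d[OF c(1)] slice_zero_iff using x by (auto simp: CS_simps vecs_iff)
  moreover have "\<l> q x f \<in> carrier (Ch q)"
    by (rule lie_derivative_closed[OF _ x]) (use hM.d_closed[OF e(1)] e(2) Suc in simp)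
  ultimately show ?thesis
    using lie_derivative_slice[of "gM.d r c" q x] gM.d_closed[OF c(1)] x s Suc by simp
qed

lemma cocycle_extension:
  assumes f: "f \<in> Zh q"
  shows "\<exists>c\<in>carrier (Cg q). slice q c [] = f \<and> gM.d q c \<in> Fil 1 (Suc q)"
proof -
  obtain c where c: "c \<in> carrier (Cg q)" "slice q c [] = f"
    using ex_extension_cochain[of f q] f by (auto simp: cocycles_def)
  have "gM.d q c \<in> Fil 1 (Suc q)"
    using d_Fil_Suc_iff[of c 0 q] c f by (simp add: Fil_nonpos vecs_iff)
  then show ?thesis using c by blast
qed

lemma Bh_Zh: "f \<in> Bh q \<Longrightarrow> f \<in> Zh q"
  using hM.coboundaries_subset by blast

text \<open>If \<open>c\<close> extends the cocycle \<open>f\<close>, then \<open>d c\<close> has filtration degree one, and its slices are cocycles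
  because \<open>d d c = 0\<close>. Up to a coboundary they are the Lie derivatives of \<open>f\<close>.\<close>

lemma lie_derivative_cocycle:
  assumes f: "f \<in> Zh q" and x: "x \<in> carrier g"
  shows "\<l> q x f \<in> Zh q"
proof -
  interpret C: char2_space F "Ch q" by (rule hM.C_space)
  obtain c where c: "c \<in> carrier (Cg q)" "slice q c [] = f" "gM.d q c \<in> Fil 1 (Suc q)"
    using cocycle_extension[OF f] by blast
  have v: "[x] \<in> vecs g 1" using x by (simp add: vecs_iff)
  let ?s = "slice q (gM.d q c) [x]"
  have sc: "?s \<in> carrier (Ch q)" using slice_closed'[of "gM.d q c" 1 q "[x]"] gM.d_closed[OF c(1)] v by simp
  have "hM.d q ?s = slice (Suc q) (gM.d (Suc q) (gM.d q c)) [x]"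
    using slice_d[of "gM.d q c" 1 q "[x]"] c(3) v by simp
  also have "\<dots> = \<zero>\<^bsub>Ch (Suc q)\<^esub>"
    unfolding gM.d_d[OF c(1)] slice_zero_iff using x by (auto simp: CS_simps vecs_iff)
  finally have "?s \<in> Zh q" using sc by (simp add: cocycles_def)
  moreover have "?s \<oplus>\<^bsub>Ch q\<^esub> \<l> q x f \<in> Zh q"
    by (rule Bh_Zh) (use lie_derivative_slice[OF c(1) x] c(2) in simp)
  moreover have "\<l> q x f \<in> carrier (Ch q)"
    by (rule lie_derivative_closed[OF _ x]) (use f in \<open>simp add: cocycles_def\<close>)
  ultimately show ?thesis
    using C.submoduleD(3)[OF hM.cocycles_submodule, of ?s "?s \<oplus>\<^bsub>Ch q\<^esub> \<l> q x f"] sc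
    by (simp add: C.add_self_left)
qed

text \<open>If \<open>c\<close> extends the cocycle \<open>f\<close>, the slices of \<open>d c\<close> at single letters depend only on the images of these
  letters in \<open>\<qq>\<close>. The claim contains the triviality of the action of the ideal on cohomology.\<close>

lemma lie_derivative_congruent:
  assumes f: "f \<in> Zh q" and x: "x \<in> carrier g" and y: "y \<in> carrier g" and eq: "\<pi> x = \<pi> y"
  shows "\<l> q x f \<oplus>\<^bsub>Ch q\<^esub> \<l> q y f \<in> Bh q"
proof -
  interpret C: char2_space F "Ch q" by (rule hM.C_space)
  obtain c where c: "c \<in> carrier (Cg q)" "slice q c [] = f" "gM.d q c \<in> Fil 1 (Suc q)"
    using cocycle_extension[OF f] by blast
  let ?s = "\<lambda>x. slice q (gM.d q c) [x]"
  have sc: "?s x \<in> carrier (Ch q)" if "x \<in> carrier g" for x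
    using slice_closed'[of "gM.d q c" 1 q "[x]"] gM.d_closed[OF c(1)] that by (simp add: vecs_iff)
  have lc: "\<l> q x f \<in> carrier (Ch q)" if "x \<in> carrier g" for x
    by (rule lie_derivative_closed[OF _ that]) (use f in \<open>simp add: cocycles_def\<close>)
  have "?s x = ?s y"
    by (rule slice_map_proj[of _ 1]) (use c(3) x y eq in \<open>simp_all add: vecs_iff\<close>)
  moreover have "(?s x \<oplus>\<^bsub>Ch q\<^esub> \<l> q x f) \<oplus>\<^bsub>Ch q\<^esub> (?s y \<oplus>\<^bsub>Ch q\<^esub> \<l> q y f) \<in> Bh q"
    using C.submoduleD(3)[OF hM.coboundaries_submodule] lie_derivative_slice[OF c(1)] c(2) x y by simp
  ultimately show ?thesis using sc lc x y by (simp add: C.char2_simps)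
qed

end

context comm_lie_extension_module
begin

abbreviation "Zspace q \<equiv> (Ch q)\<lparr>carrier := Zh q\<rparr>"
abbreviation "HSh q \<equiv> HS F h M (\<lambda>y. \<rho> (\<iota> y)) q"
abbreviation "\<kappa> q f \<equiv> Bh q +>\<^bsub>Ch q\<^esub> f"
abbreviation "\<sigma> q \<equiv> HS_action F h g \<iota> \<pi> M \<rho> q"
abbreviation "dq p q \<equiv> CS_diff \<qq> (HSh q) (\<sigma> q) p"
abbreviation "Cq p q \<equiv> CS F \<qq> (HSh q) p"

lemma Zspace_space: "char2_space F (Zspace q)"
  by (rule char2_space.char2_space_submodule[OF hM.C_space hM.cocycles_submodule])

lemma Bh_submodule_Zspace: "submodule (Bh q) F (Zspace q)"
  by (rule char2_space.submodule_sub[OF hM.C_space hM.cocycles_submodule hM.coboundaries_submodule hM.coboundaries_subset])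

lemma HSh_eq: "HSh q = quot_module (Zspace q) (Bh q)"
  by (simp add: HS_def cohomology_def)

lemma HSh_space: "char2_space F (HSh q)"
  unfolding HSh_eq by (rule char2_space.char2_space_quot[OF Zspace_space Bh_submodule_Zspace])

lemma HSh_module: "module F (HSh q)"
  by (rule char2_space.module_V[OF HSh_space])

lemma Zh_closed: "f \<in> Zh q \<Longrightarrow> f \<in> carrier (Ch q)"
  by (simp add: cocycles_def)

lemma Zh_add: "f \<in> Zh q \<Longrightarrow> f' \<in> Zh q \<Longrightarrow> f \<oplus>\<^bsub>Ch q\<^esub> f' \<in> Zh q"
  by (rule char2_space.submoduleD(3)[OF hM.C_space hM.cocycles_submodule])

lemma HSh_carrier: "carrier (HSh q) = \<kappa> q ` Zh q"
  using quot_module_carrier[OF char2_space.module_V[OF Zspace_space] Bh_submodule_Zspace] by (auto simp: HSh_eq)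

lemma coset_linear: "\<kappa> q \<in> linear_maps F (Zspace q) (HSh q)"
proof (rule linear_mapsI)
  note m = char2_space.module_V[OF Zspace_space] Bh_submodule_Zspace
  show "\<kappa> q u \<in> carrier (HSh q)" if "u \<in> carrier (Zspace q)" for u using that by (simp add: HSh_carrier)
  show "\<kappa> q (u \<oplus>\<^bsub>Zspace q\<^esub> v) = \<kappa> q u \<oplus>\<^bsub>HSh q\<^esub> \<kappa> q v" if "u \<in> carrier (Zspace q)" "v \<in> carrier (Zspace q)" for u v
    using quot_module_add[OF m that] by (simp add: HSh_eq)
  show "\<kappa> q (a \<odot>\<^bsub>Zspace q\<^esub> u) = a \<odot>\<^bsub>HSh q\<^esub> \<kappa> q u" if "a \<in> carrier F" "u \<in> carrier (Zspace q)" for a u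
    using quot_module_smult[OF m that] by (simp add: HSh_eq)
qed

lemma coset_add: "f \<in> Zh q \<Longrightarrow> f' \<in> Zh q \<Longrightarrow> \<kappa> q f \<oplus>\<^bsub>HSh q\<^esub> \<kappa> q f' = \<kappa> q (f \<oplus>\<^bsub>Ch q\<^esub> f')"
  using linear_mapsD(2)[OF coset_linear, of f q f'] by simp

lemma coset_eq_iff: "f \<in> Zh q \<Longrightarrow> f' \<in> Zh q \<Longrightarrow> \<kappa> q f = \<kappa> q f' \<longleftrightarrow> f \<oplus>\<^bsub>Ch q\<^esub> f' \<in> Bh q"
  using char2_space.coset_eq_iff[OF Zspace_space Bh_submodule_Zspace, of f q f'] by simp

lemma coset_zero_iff: "f \<in> Zh q \<Longrightarrow> \<kappa> q f = \<zero>\<^bsub>HSh q\<^esub> \<longleftrightarrow> f \<in> Bh q"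
  using char2_space.coset_eq_zero_iff[OF Zspace_space Bh_submodule_Zspace, of f q] by (simp add: HSh_eq)

text \<open>The union in the definition of the action consists of equal cosets, since replacing the lift \<open>x\<close> or the
  representative \<open>f\<close> changes the Lie derivative by a coboundary.\<close>

lemma action_coset:
  assumes f: "f \<in> Zh q" and x: "x \<in> carrier g"
  shows "\<sigma> q (\<pi> x) (\<kappa> q f) = \<kappa> q (\<l> q x f)"
proof -
  interpret C: char2_space F "Ch q" by (rule hM.C_space)
  have mem: "f' \<in> \<kappa> q f \<longleftrightarrow> f' \<in> Zh q \<and> f' \<oplus>\<^bsub>Ch q\<^esub> f \<in> Bh q" for f'
    using char2_space.mem_coset_iff[OF Zspace_space Bh_submodule_Zspace, of f q f'] f by simp
  have eq: "\<kappa> q (\<l> q y f') = \<kappa> q (\<l> q x f)" if y: "y \<in> carrier g" "\<pi> y = \<pi> x" and f': "f' \<in> \<kappa> q f" for y f'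
  proof -
    note l = lie_derivative_cocycle[OF f x] lie_derivative_cocycle[OF f y(1)]
    have f'Z: "f' \<in> Zh q" and B: "f' \<oplus>\<^bsub>Ch q\<^esub> f \<in> Bh q" using f' mem by auto
    have "\<kappa> q (\<l> q y f) = \<kappa> q (\<l> q x f)"
      using lie_derivative_congruent[OF f y(1) x y(2)] l by (simp add: coset_eq_iff)
    moreover have "\<l> q y (f' \<oplus>\<^bsub>Ch q\<^esub> f) = \<l> q y f' \<oplus>\<^bsub>Ch q\<^esub> \<l> q y f"
      by (rule linear_mapsD(2)[OF lie_derivative_linear[OF y(1)] Zh_closed[OF f'Z] Zh_closed[OF f]])
    then have "\<kappa> q (\<l> q y f') = \<kappa> q (\<l> q y f)"
      using lie_derivative_coboundary[OF B y(1)] lie_derivative_cocycle[OF f'Z y(1)] l by (simp add: coset_eq_iff)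
    ultimately show ?thesis by simp
  qed
  have self: "f \<in> \<kappa> q f"
    using f char2_space.submoduleD(2)[OF hM.C_space hM.coboundaries_submodule] by (simp add: mem C.add_self Zh_closed)
  have "\<sigma> q (\<pi> x) (\<kappa> q f) = (\<Union>y\<in>{y \<in> carrier g. \<pi> y = \<pi> x}. \<Union>f'\<in>\<kappa> q f. \<kappa> q (\<l> q y f'))"
    by (simp add: HS_action_def)
  also have "\<dots> = (\<Union>y\<in>{y \<in> carrier g. \<pi> y = \<pi> x}. \<Union>f'\<in>\<kappa> q f. \<kappa> q (\<l> q x f))"
    using eq by (intro SUP_cong refl) auto
  also have "\<dots> = \<kappa> q (\<l> q x f)" using self x by auto
  finally show ?thesis .
qed

lemma action_Pi: "\<sigma> q \<in> carrier \<qq> \<rightarrow> carrier (HSh q) \<rightarrow> carrier (HSh q)"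
proof (intro Pi_I)
  fix z A assume "z \<in> carrier \<qq>" "A \<in> carrier (HSh q)"
  then obtain f where "f \<in> Zh q" "A = \<kappa> q f" "z = \<pi> (sec z)" "sec z \<in> carrier g"
    by (auto simp: HSh_carrier proj_sec)
  then show "\<sigma> q z A \<in> carrier (HSh q)"
    using action_coset[of f q "sec z"] lie_derivative_cocycle[of f q "sec z"] by (simp add: HSh_carrier)
qed

lemma word_lie_coset:
  assumes "\<And>us. us \<in> gwords g \<Longrightarrow> length us = length xs \<Longrightarrow> C us \<in> Zh q \<and> f (map \<pi> us) = \<kappa> q (C us)"
    and x: "x \<in> carrier g" and "xs \<in> gwords g"
  shows "word_lie (Ch q) (\<l> q x) (bracket g x) C xs \<in> Zh q \<and>
    word_lie (HSh q) (\<sigma> q (\<pi> x)) (bracket \<qq> (\<pi> x)) f (map \<pi> xs) = \<kappa> q (word_lie (Ch q) (\<l> q x) (bracket g x) C xs)"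
  using assms(1,3)
proof (induction xs arbitrary: f C)
  case Nil
  then show ?case using lie_derivative_cocycle[OF _ x] action_coset[OF _ x] by simp
next
  case (Cons z xs)
  have z: "z \<in> carrier g" "xs \<in> gwords g" "bracket g x z \<in> carrier g"
    using Cons.prems(2) x g.bracket_closed by auto
  have 1: "C (bracket g x z # xs) \<in> Zh q \<and> f (map \<pi> (bracket g x z # xs)) = \<kappa> q (C (bracket g x z # xs))"
    by (rule Cons.prems(1)) (use z in simp_all)
  have 2: "word_lie (Ch q) (\<l> q x) (bracket g x) (\<lambda>zs. C (z # zs)) xs \<in> Zh q \<and>
    word_lie (HSh q) (\<sigma> q (\<pi> x)) (bracket \<qq> (\<pi> x)) (\<lambda>zs. f (\<pi> z # zs)) (map \<pi> xs) =
    \<kappa> q (word_lie (Ch q) (\<l> q x) (bracket g x) (\<lambda>zs. C (z # zs)) xs)"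
  proof (rule Cons.IH[OF _ z(2)])
    show "C (z # us) \<in> Zh q \<and> f (\<pi> z # map \<pi> us) = \<kappa> q (C (z # us))"
      if "us \<in> gwords g" "length us = length xs" for us
      using Cons.prems(1)[of "z # us"] that z by simp
  qed
  show ?case using 1 2 x z by (simp add: Zh_add coset_add proj_bracket)
qed

text \<open>Passing to classes is additive and turns Lie derivatives into the action of \<open>\<qq>\<close>; so it commutes with
  the recursion that defines the differential.\<close>

lemma word_diff_coset:
  assumes "\<And>us. us \<in> gwords g \<Longrightarrow> Suc (length us) = length xs \<Longrightarrow> C us \<in> Zh q \<and> f (map \<pi> us) = \<kappa> q (C us)"
    and "xs \<in> gwords g"
  shows "word_diff (Ch q) (\<l> q) (bracket g) C xs \<in> Zh q \<and>
    word_diff (HSh q) (\<sigma> q) (bracket \<qq>) f (map \<pi> xs) = \<kappa> q (word_diff (Ch q) (\<l> q) (bracket g) C xs)"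
  using assms
proof (induction xs arbitrary: f C)
  case Nil
  have "\<zero>\<^bsub>Ch q\<^esub> \<in> Bh q" by (rule char2_space.submoduleD(2)[OF hM.C_space hM.coboundaries_submodule])
  then show ?case using coset_zero_iff[of "\<zero>\<^bsub>Ch q\<^esub>" q] Bh_Zh by simp
next
  case (Cons x xs)
  have x: "x \<in> carrier g" "xs \<in> gwords g" using Cons.prems(2) by auto
  have 1: "word_lie (Ch q) (\<l> q x) (bracket g x) C xs \<in> Zh q \<and>
    word_lie (HSh q) (\<sigma> q (\<pi> x)) (bracket \<qq> (\<pi> x)) f (map \<pi> xs) = \<kappa> q (word_lie (Ch q) (\<l> q x) (bracket g x) C xs)"
    by (rule word_lie_coset[OF _ x], rule Cons.prems(1)) simp_all
  have 2: "word_diff (Ch q) (\<l> q) (bracket g) (\<lambda>zs. C (x # zs)) xs \<in> Zh q \<and>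
    word_diff (HSh q) (\<sigma> q) (bracket \<qq>) (\<lambda>zs. f (\<pi> x # zs)) (map \<pi> xs) =
    \<kappa> q (word_diff (Ch q) (\<l> q) (bracket g) (\<lambda>zs. C (x # zs)) xs)"
  proof (rule Cons.IH[OF _ x(2)])
    show "C (x # us) \<in> Zh q \<and> f (\<pi> x # map \<pi> us) = \<kappa> q (C (x # us))"
      if "us \<in> gwords g" "Suc (length us) = length xs" for us
      using Cons.prems(1)[of "x # us"] that x by simp
  qed
  show ?case using 1 2 by (simp add: Zh_add coset_add)
qed

section \<open>The comparison map\<close>

lemma sym_multilin_slice:
  assumes c: "gM.sm c"
  shows "sym_multilin F g (Ch q) (slice q c)"
proof (rule sym_multilinI)
  note c' = sym_multilinD[OF c]
  show "slice q c xs \<in> carrier (Ch q)" if "xs \<in> gwords g" for xs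
    by (rule slice_closed[OF c that])
  show "slice q c xs = slice q c ys" if "xs \<in> gwords g" "mset xs = mset ys" for xs ys
    unfolding slice_def by (rule restrict_ext, rule c'(2)) (use that in \<open>simp_all add: vecs_words\<close>)
  show "slice q c ((x \<oplus>\<^bsub>g\<^esub> y) # xs) = slice q c (x # xs) \<oplus>\<^bsub>Ch q\<^esub> slice q c (y # xs)"
    if "xs \<in> gwords g" "x \<in> carrier g" "y \<in> carrier g" for xs x y
    unfolding CS_simps slice_def by (rule restrict_ext) (use that c'(3) in \<open>simp add: vecs_words\<close>)
  show "slice q c ((a \<odot>\<^bsub>g\<^esub> x) # xs) = a \<odot>\<^bsub>Ch q\<^esub> slice q c (x # xs)"
    if "xs \<in> gwords g" "a \<in> carrier F" "x \<in> carrier g" for xs a x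
    unfolding CS_simps slice_def by (rule restrict_ext) (use that c'(4) in \<open>simp add: vecs_words\<close>)
qed

lemma sec_vecs: "zs \<in> vecs \<qq> p \<Longrightarrow> map sec zs \<in> vecs g p"
  by (auto simp: vecs_iff in_words_iff)

lemma proj_vecs: "xs \<in> vecs g p \<Longrightarrow> map \<pi> xs \<in> vecs \<qq> p"
  by (auto simp: vecs_iff)

lemma proj_sec_vecs: "zs \<in> vecs \<qq> p \<Longrightarrow> map \<pi> (map sec zs) = zs"
  unfolding map_map by (rule map_idI) (auto simp: vecs_iff in_words_iff proj_sec)

text \<open>The class of \<open>c\<close> in \<open>E\<^sub>0\<close>. The section only serves to choose preimages of the letters, see
  \<open>reduce_proj\<close>.\<close>

definition reduce :: "nat \<Rightarrow> nat \<Rightarrow> ('g list \<Rightarrow> 'm) \<Rightarrow> 'q list \<Rightarrow> 'h list \<Rightarrow> 'm" where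
  "reduce p q c = (\<lambda>zs\<in>vecs \<qq> p. slice q c (map sec zs))"

lemma reduce_closed:
  assumes c: "c \<in> carrier (Cg (p + q))"
  shows "reduce p q c \<in> carrier (CS F \<qq> (Ch q) p)"
proof -
  have "reduce p q c = (\<lambda>zs\<in>vecs \<qq> p. slice q (extend_zero g M (p + q) c) (map sec zs))"
    unfolding reduce_def by (rule restrict_ext) (simp add: slice_extend_zero[OF sec_vecs])
  also have "\<dots> \<in> carrier (CS F \<qq> (Ch q) p)"
    by (rule restrict_CS[OF q.A.module_V sym_multilin_map[OF sec_linear sym_multilin_slice[OF gM.sm_extend_zero[OF c]]]])
  finally show ?thesis .
qed

lemma reduce_proj:
  assumes "c \<in> Fil (int p) (p + q)" "xs \<in> vecs g p"
  shows "reduce p q c (map \<pi> xs) = slice q c xs"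
  unfolding reduce_def restrict_apply'[OF proj_vecs[OF assms(2)]]
  by (rule slice_map_proj[OF assms(1) sec_vecs[OF proj_vecs[OF assms(2)]] assms(2)])
    (rule proj_sec_vecs[OF proj_vecs[OF assms(2)]])

text \<open>The numerator of \<open>E\<^sub>1\<close>, see \<open>Z1_iff\<close>.\<close>

definition Z1 :: "nat \<Rightarrow> nat \<Rightarrow> ('g list \<Rightarrow> 'm) set" where
  "Z1 p q = {c \<in> Fil (int p) (p + q). \<forall>us\<in>vecs g p. slice q c us \<in> Zh q}"

text \<open>The map that induces the isomorphisms on \<open>E\<^sub>1\<close> and \<open>E\<^sub>2\<close>.\<close>

definition \<theta> :: "nat \<Rightarrow> nat \<Rightarrow> ('g list \<Rightarrow> 'm) \<Rightarrow> 'q list \<Rightarrow> ('h list \<Rightarrow> 'm) set" where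
  "\<theta> p q c = (\<lambda>zs\<in>vecs \<qq> p. \<kappa> q (slice q c (map sec zs)))"

lemma Z1_iff: "c \<in> Z1 p q \<longleftrightarrow> c \<in> Fil (int p) (p + q) \<and> gM.d (p + q) c \<in> Fil (int (Suc p)) (Suc (p + q))"
  using d_Fil_Suc_iff unfolding Z1_def by blast

lemma Z1_Fil: "c \<in> Z1 p q \<Longrightarrow> c \<in> Fil (int p) (p + q)"
  by (simp add: Z1_def)

lemma Z1_closed: "c \<in> Z1 p q \<Longrightarrow> c \<in> carrier (Cg (p + q))"
  by (rule Fil_closed[OF Z1_Fil])

lemma Z1_slice: "c \<in> Z1 p q \<Longrightarrow> us \<in> vecs g p \<Longrightarrow> slice q c us \<in> Zh q"
  by (simp add: Z1_def)

lemma \<theta>_closed: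
  assumes c: "c \<in> Z1 p q"
  shows "\<theta> p q c \<in> carrier (Cq p q)"
proof -
  have "reduce p q c \<in> carrier (CS F \<qq> (Zspace q) p)"
    by (rule CS_subspace[OF q.A.module_V _ _ reduce_closed[OF Z1_closed[OF c]]])
      (simp_all add: reduce_def Z1_slice[OF c sec_vecs] char2_space.module_V[OF hM.C_space]
        char2_space.submoduleD(2)[OF hM.C_space hM.cocycles_submodule])
  from CS_composition[OF q.A.module_V char2_space.module_V[OF Zspace_space] HSh_module coset_linear this]
  show ?thesis by (simp add: \<theta>_def reduce_def cong: restrict_cong)
qed

lemma \<theta>_proj:
  assumes "c \<in> Z1 p q" "xs \<in> vecs g p"
  shows "\<theta> p q c (map \<pi> xs) = \<kappa> q (slice q c xs)"
  using reduce_proj[OF Z1_Fil[OF assms(1)] assms(2)]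
  unfolding \<theta>_def reduce_def restrict_apply'[OF proj_vecs[OF assms(2)]] by (rule arg_cong)

lemma slice_linear:
  assumes "us \<in> vecs g p"
  shows "slice q (c \<oplus>\<^bsub>Cg (p + q)\<^esub> c') us = slice q c us \<oplus>\<^bsub>Ch q\<^esub> slice q c' us"
    and "slice q (a \<odot>\<^bsub>Cg (p + q)\<^esub> c) us = a \<odot>\<^bsub>Ch q\<^esub> slice q c us"
proof -
  have v: "us @ map \<iota> ys \<in> vecs g (p + q)" if "ys \<in> vecs h q" for ys using that assms by (auto simp: vecs_iff)
  show "slice q (c \<oplus>\<^bsub>Cg (p + q)\<^esub> c') us = slice q c us \<oplus>\<^bsub>Ch q\<^esub> slice q c' us"
    "slice q (a \<odot>\<^bsub>Cg (p + q)\<^esub> c) us = a \<odot>\<^bsub>Ch q\<^esub> slice q c us"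
    unfolding CS_simps slice_def by (rule restrict_ext, simp add: v)+
qed

lemma Z1_submodule: "submodule (Z1 p q) F (Cg (p + q))"
proof -
  interpret C: char2_space F "Cg (p + q)" by (rule gM.C_space)
  note Fi = C.submoduleD[OF Fil_submodule] and Zi = char2_space.submoduleD[OF hM.C_space hM.cocycles_submodule]
  show ?thesis
  proof (rule C.submoduleI_char2)
    show "Z1 p q \<subseteq> carrier (Cg (p + q))" using Z1_closed by blast
    have "slice q \<zero>\<^bsub>Cg (p + q)\<^esub> us = \<zero>\<^bsub>Ch q\<^esub>" if "us \<in> vecs g p" for us
      unfolding slice_zero_iff using that by (auto simp: CS_simps vecs_iff)
    then show "\<zero>\<^bsub>Cg (p + q)\<^esub> \<in> Z1 p q" using Fi(2) Zi(2) by (simp add: Z1_def)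
  qed (use Fi(3,4) Zi(3,4) in \<open>simp_all add: Z1_def slice_linear\<close>)
qed

lemma \<theta>_add:
  assumes "c \<in> Z1 p q" "c' \<in> Z1 p q"
  shows "\<theta> p q (c \<oplus>\<^bsub>Cg (p + q)\<^esub> c') = \<theta> p q c \<oplus>\<^bsub>Cq p q\<^esub> \<theta> p q c'"
  unfolding CS_simps(2)[where F = F and g = \<qq>] \<theta>_def
  by (rule restrict_ext) (simp add: slice_linear[OF sec_vecs] coset_add Z1_slice[OF assms(1) sec_vecs] Z1_slice[OF assms(2) sec_vecs])

lemma \<theta>_smult:
  assumes "a \<in> carrier F" "c \<in> Z1 p q"
  shows "\<theta> p q (a \<odot>\<^bsub>Cg (p + q)\<^esub> c) = a \<odot>\<^bsub>Cq p q\<^esub> \<theta> p q c"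
  unfolding CS_simps(3)[where F = F and g = \<qq>] \<theta>_def
proof (rule restrict_ext)
  fix zs assume zs: "zs \<in> vecs \<qq> p"
  show "\<kappa> q (slice q (a \<odot>\<^bsub>Cg (p + q)\<^esub> c) (map sec zs)) =
    a \<odot>\<^bsub>HSh q\<^esub> (\<lambda>zs\<in>vecs \<qq> p. \<kappa> q (slice q c (map sec zs))) zs"
    using linear_mapsD(3)[OF coset_linear assms(1), of "slice q c (map sec zs)" q] Z1_slice[OF assms(2) sec_vecs[OF zs]] zs
    by (simp add: slice_linear[OF sec_vecs])
qed

lemma \<theta>_eq_zero_iff:
  assumes c: "c \<in> Z1 p q"
  shows "\<theta> p q c = \<zero>\<^bsub>Cq p q\<^esub> \<longleftrightarrow> (\<forall>us\<in>vecs g p. slice q c us \<in> Bh q)"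
proof
  assume z: "\<theta> p q c = \<zero>\<^bsub>Cq p q\<^esub>"
  show "\<forall>us\<in>vecs g p. slice q c us \<in> Bh q"
  proof
    fix us assume us: "us \<in> vecs g p"
    have "\<kappa> q (slice q c us) = \<zero>\<^bsub>HSh q\<^esub>"
      using \<theta>_proj[OF c us] proj_vecs[OF us] unfolding z by (simp add: CS_simps)
    then show "slice q c us \<in> Bh q" by (simp add: coset_zero_iff Z1_slice[OF c us])
  qed
next
  assume "\<forall>us\<in>vecs g p. slice q c us \<in> Bh q"
  then show "\<theta> p q c = \<zero>\<^bsub>Cq p q\<^esub>"
    unfolding CS_simps(1)[where F = F and g = \<qq>] \<theta>_def
    by (intro restrict_ext) (simp add: coset_zero_iff Z1_slice[OF c sec_vecs] sec_vecs)
qed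

text \<open>Compose \<open>f\<close> with a linear section of the projection from cocycles to classes, and extend the result
  to \<open>g\<close>.\<close>

lemma \<theta>_surj:
  assumes f: "f \<in> carrier (Cq p q)"
  shows "\<exists>c\<in>Z1 p q. \<theta> p q c = f"
proof -
  have onto: "\<exists>f\<in>carrier (Zspace q). \<kappa> q f = A" if "A \<in> carrier (HSh q)" for A
    using that by (auto simp: HSh_carrier)
  obtain s where s: "s \<in> linear_maps F (HSh q) (Zspace q)" "\<And>A. A \<in> carrier (HSh q) \<Longrightarrow> \<kappa> q (s A) = A"
    using linear_section[OF Zspace_space HSh_space coset_linear onto] by blast
  have incl: "(\<lambda>f. f) \<in> linear_maps F (Zspace q) (Ch q)"
    by (rule linear_mapsI) (simp_all add: Zh_closed)
  have 1: "(\<lambda>zs\<in>vecs \<qq> p. s (f zs)) \<in> carrier (CS F \<qq> (Zspace q) p)"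
    by (rule CS_composition[OF q.A.module_V HSh_module char2_space.module_V[OF Zspace_space] s(1) f])
  from CS_composition[OF q.A.module_V char2_space.module_V[OF Zspace_space] char2_space.module_V[OF hM.C_space] incl 1]
  have "(\<lambda>zs\<in>vecs \<qq> p. s (f zs)) \<in> carrier (CS F \<qq> (Ch q) p)" by (simp cong: restrict_cong)
  from ex_slice_eq[OF this] obtain c where c: "c \<in> Fil (int p) (p + q)"
    and sl: "\<And>us. us \<in> vecs g p \<Longrightarrow> slice q c us = s (f (map \<pi> us))"
    by (auto simp: proj_vecs)
  have fc: "f zs \<in> carrier (HSh q)" if "zs \<in> vecs \<qq> p" for zs by (rule CS_closed[OF f that])
  have cZ: "c \<in> Z1 p q"
    using c linear_mapsD(1)[OF s(1) fc[OF proj_vecs]] by (simp add: Z1_def sl)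
  moreover have "\<theta> p q c = f"
  proof (rule CS_eqI[OF \<theta>_closed[OF cZ] f])
    fix zs assume zs: "zs \<in> vecs \<qq> p"
    then show "\<theta> p q c zs = f zs"
      by (simp add: \<theta>_def sl[OF sec_vecs[OF zs]] proj_sec_vecs[OF zs, unfolded map_map] s(2)[OF fc[OF zs]])
  qed
  ultimately show ?thesis by blast
qed

lemma d_Z1:
  assumes c: "c \<in> Z1 p q"
  shows "gM.d (p + q) c \<in> Z1 (Suc p) q"
proof -
  have "gM.d (p + q) c \<in> Fil (int (Suc p)) (Suc p + q)" using c by (simp add: Z1_iff)
  moreover have "\<zero>\<^bsub>Cg (Suc (Suc (p + q)))\<^esub> \<in> Fil (int (Suc (Suc p))) (Suc (Suc (p + q)))"
    by (rule char2_space.submoduleD(2)[OF gM.C_space Fil_submodule])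
  ultimately show ?thesis unfolding Z1_iff using gM.d_d[OF Z1_closed[OF c]] by simp
qed

text \<open>Under \<open>\<theta>\<close> the differential of \<open>E\<^sub>1\<close> is the differential of \<open>\<qq>\<close>: by \<open>word_diff_coset\<close> the latter is the
  class of the outer differential, to which \<open>slice_d_outer_diff\<close> applies.\<close>

lemma dq_\<theta>:
  assumes c: "c \<in> Z1 p q"
  shows "dq p q (\<theta> p q c) = \<theta> (Suc p) q (gM.d (p + q) c)"
proof -
  have "dq p q (\<theta> p q c) = (\<lambda>zs\<in>vecs \<qq> (Suc p). word_diff (HSh q) (\<sigma> q) (bracket \<qq>) (extend_zero \<qq> (HSh q) p (\<theta> p q c)) zs)"
    by (rule CS_diff_eq[OF q.A.module_V HSh_module \<theta>_closed[OF c] action_Pi q.bracket_Pi])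
  also have "\<dots> = \<theta> (Suc p) q (gM.d (p + q) c)"
    unfolding \<theta>_def[of "Suc p"]
  proof (rule restrict_ext)
    fix zs assume zs: "zs \<in> vecs \<qq> (Suc p)"
    let ?xs = "map sec zs" and ?e = "extend_zero g M (p + q) c"
    have xs: "?xs \<in> vecs g (Suc p)" by (rule sec_vecs[OF zs])
    have "outer_diff q ?e ?xs \<in> Zh q \<and>
      word_diff (HSh q) (\<sigma> q) (bracket \<qq>) (extend_zero \<qq> (HSh q) p (\<theta> p q c)) (map \<pi> ?xs) = \<kappa> q (outer_diff q ?e ?xs)"
    proof (rule word_diff_coset[OF _ vecs_words[OF xs]])
      fix us assume "us \<in> gwords g" "Suc (length us) = length ?xs"
      then have us: "us \<in> vecs g p" using xs by (simp add: vecs_iff)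
      show "slice q ?e us \<in> Zh q \<and> extend_zero \<qq> (HSh q) p (\<theta> p q c) (map \<pi> us) = \<kappa> q (slice q ?e us)"
        using Z1_slice[OF c us] \<theta>_proj[OF c us] proj_vecs[OF us] by (simp add: slice_extend_zero[OF us])
    qed
    moreover have "\<kappa> q (slice q (gM.d (p + q) c) ?xs) = \<kappa> q (outer_diff q ?e ?xs)"
      using slice_d_outer_diff[OF Z1_closed[OF c] xs] Z1_slice[OF d_Z1[OF c] xs] calculation
        by (simp add: coset_eq_iff)
    ultimately show "word_diff (HSh q) (\<sigma> q) (bracket \<qq>) (extend_zero \<qq> (HSh q) p (\<theta> p q c)) zs =
      \<kappa> q (slice q (gM.d (p + q) c) ?xs)"
      unfolding proj_sec_vecs[OF zs] by simp
  qed
  finally show ?thesis .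
qed

end

section \<open>The second page\<close>

context comm_lie_extension_module
begin

lemma Cq_space: "char2_space F (Cq p q)"
  by (rule char2_space_CS[OF q.A.module_V HSh_space])

text \<open>The cochains of \<open>\<qq>\<close> are the values of \<open>\<theta>\<close>, and on these the differential comes from the linear
  differential of \<open>g\<close>.\<close>

lemma dq_linear: "dq p q \<in> linear_maps F (Cq p q) (Cq (Suc p) q)"
proof (rule linear_mapsI)
  note di = linear_mapsD[OF gM.d_linear] and Z1i = char2_space.submoduleD[OF gM.C_space Z1_submodule]
  have lift: thesis if "f \<in> carrier (Cq p q)" "\<And>c. c \<in> Z1 p q \<Longrightarrow> f = \<theta> p q c \<Longrightarrow> thesis" for f thesis
    using \<theta>_surj[OF that(1)] that(2) by blast
  show "dq p q f \<in> carrier (Cq (Suc p) q)" if f: "f \<in> carrier (Cq p q)" for f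
    by (rule lift[OF f]) (simp add: dq_\<theta> \<theta>_closed d_Z1)
  show "dq p q (f \<oplus>\<^bsub>Cq p q\<^esub> f') = dq p q f \<oplus>\<^bsub>Cq (Suc p) q\<^esub> dq p q f'"
    if f: "f \<in> carrier (Cq p q)" and f': "f' \<in> carrier (Cq p q)" for f f'
  proof (rule lift[OF f], rule lift[OF f'])
    fix c c' assume c: "c \<in> Z1 p q" "f = \<theta> p q c" and c': "c' \<in> Z1 p q" "f' = \<theta> p q c'"
    have "dq p q (f \<oplus>\<^bsub>Cq p q\<^esub> f') = \<theta> (Suc p) q (gM.d (p + q) (c \<oplus>\<^bsub>Cg (p + q)\<^esub> c'))"
      unfolding c(2) c'(2) \<theta>_add[OF c(1) c'(1), symmetric] by (rule dq_\<theta>[OF Z1i(3)[OF c(1) c'(1)]])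
    also have "\<dots> = dq p q f \<oplus>\<^bsub>Cq (Suc p) q\<^esub> dq p q f'"
      using \<theta>_add[OF d_Z1[OF c(1)] d_Z1[OF c'(1)]] c c' by (simp add: di(2) Z1_closed dq_\<theta>)
    finally show ?thesis .
  qed
  show "dq p q (a \<odot>\<^bsub>Cq p q\<^esub> f) = a \<odot>\<^bsub>Cq (Suc p) q\<^esub> dq p q f"
    if a: "a \<in> carrier F" and f: "f \<in> carrier (Cq p q)" for a f
  proof (rule lift[OF f])
    fix c assume c: "c \<in> Z1 p q" "f = \<theta> p q c"
    have "dq p q (a \<odot>\<^bsub>Cq p q\<^esub> f) = \<theta> (Suc p) q (gM.d (p + q) (a \<odot>\<^bsub>Cg (p + q)\<^esub> c))"
      unfolding c(2) \<theta>_smult[OF a c(1), symmetric] by (rule dq_\<theta>[OF Z1i(4)[OF a c(1)]])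
    also have "\<dots> = a \<odot>\<^bsub>Cq (Suc p) q\<^esub> dq p q f"
      using \<theta>_smult[OF a d_Z1[OF c(1)]] c by (simp add: di(3) a Z1_closed dq_\<theta>)
    finally show ?thesis .
  qed
qed

abbreviation "Zq p q \<equiv> HS_cocycles F \<qq> (HSh q) (\<sigma> q) p"
abbreviation "Bq p q \<equiv> HS_coboundaries F \<qq> (HSh q) (\<sigma> q) p"

lemma Zq_submodule: "submodule (Zq p q) F (Cq p q)"
  unfolding cocycles_def by (rule submodule_kernel[OF Cq_space char2_space.module_V[OF Cq_space] dq_linear])

lemma \<theta>_Fil_Suc:
  assumes "c \<in> Fil (int (Suc p)) (p + q)" "c \<in> Z1 p q"
  shows "\<theta> p q c = \<zero>\<^bsub>Cq p q\<^esub>"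
  using assms(1) char2_space.submoduleD(2)[OF hM.C_space hM.coboundaries_submodule]
  unfolding \<theta>_eq_zero_iff[OF assms(2)] Fil_Suc_iff by simp

lemma coboundary_Suc: "f \<in> Bq (Suc p) q \<longleftrightarrow> (\<exists>b\<in>Z1 p q. f = \<theta> (Suc p) q (gM.d (p + q) b))"
proof -
  have "f \<in> Bq (Suc p) q \<longleftrightarrow> (\<exists>f'\<in>carrier (Cq p q). f = dq p q f')"
    by (auto simp: coboundaries_def)
  also have "\<dots> \<longleftrightarrow> (\<exists>b\<in>Z1 p q. f = dq p q (\<theta> p q b))"
    using \<theta>_surj \<theta>_closed by metis
  finally show ?thesis by (simp add: dq_\<theta>)
qed

lemma coboundary_0: "f \<in> Bq 0 q \<longleftrightarrow> f = \<zero>\<^bsub>Cq 0 q\<^esub>"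
  by (simp add: coboundaries_def)

lemma Bq_submodule: "submodule (Bq p q) F (Cq p q)"
proof (cases p)
  case 0
  interpret C: char2_space F "Cq 0 q" by (rule Cq_space)
  show ?thesis unfolding 0 coboundaries_def by (auto intro: C.submoduleI_char2)
next
  case (Suc r)
  interpret C: char2_space F "Cq r q" by (rule Cq_space)
  show ?thesis unfolding Suc coboundaries_def nat.case
    by (rule submodule_image[OF Cq_space Cq_space dq_linear C.carrier_is_submodule])
qed

lemma d_zero: "gM.d n \<zero>\<^bsub>Cg n\<^esub> = \<zero>\<^bsub>Cg (Suc n)\<^esub>"
  by (rule linear_maps_zero[OF char2_space.module_V[OF gM.C_space] char2_space.module_V[OF gM.C_space] gM.d_linear])

lemma Fil_zero: "\<zero>\<^bsub>Cg n\<^esub> \<in> Fil k n"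
  by (rule char2_space.submoduleD(2)[OF gM.C_space Fil_submodule])

lemma Fil_add: "c \<in> Fil k n \<Longrightarrow> c' \<in> Fil k n \<Longrightarrow> c \<oplus>\<^bsub>Cg n\<^esub> c' \<in> Fil k n"
  by (rule char2_space.submoduleD(3)[OF gM.C_space Fil_submodule])

lemma d_add: "c \<in> carrier (Cg n) \<Longrightarrow> c' \<in> carrier (Cg n) \<Longrightarrow>
    gM.d n (c \<oplus>\<^bsub>Cg n\<^esub> c') = gM.d n c \<oplus>\<^bsub>Cg (Suc n)\<^esub> gM.d n c'"
  by (rule linear_mapsD(2)[OF gM.d_linear])

text \<open>Again a consequence of \<open>d d = 0\<close> for \<open>g\<close>, through \<open>\<theta>\<close>.\<close>

lemma Bq_subset: "Bq p q \<subseteq> Zq p q"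
proof
  fix f assume f: "f \<in> Bq p q"
  show "f \<in> Zq p q"
  proof (cases p)
    case 0
    then show ?thesis
      using f char2_space.submoduleD(2)[OF Cq_space Zq_submodule] by (simp add: coboundary_0)
  next
    case (Suc r)
    then obtain b where b: "b \<in> Z1 r q" "f = \<theta> p q (gM.d (r + q) b)" using f coboundary_Suc by auto
    note c = d_Z1[OF b(1)]
    have "dq p q f = \<theta> (Suc p) q (gM.d (Suc (r + q)) (gM.d (r + q) b))"
      using dq_\<theta>[OF c] b(2) Suc by simp
    also have "\<dots> = \<zero>\<^bsub>Cq (Suc p) q\<^esub>"
      unfolding gM.d_d[OF Z1_closed[OF b(1)]]
      by (rule \<theta>_Fil_Suc) (use Fil_zero d_zero Suc in \<open>simp_all add: Z1_iff\<close>)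
    finally show ?thesis using \<theta>_closed[OF c] b(2) Suc by (simp add: cocycles_def)
  qed
qed

definition dFil :: "int \<Rightarrow> nat \<Rightarrow> ('g list \<Rightarrow> 'm) set" where
  "dFil k n = (case n of 0 \<Rightarrow> {\<zero>\<^bsub>Cg 0\<^esub>} | Suc m \<Rightarrow> gM.d m ` Fil k m)"

lemma dFil_zero: "\<zero>\<^bsub>Cg n\<^esub> \<in> dFil k n"
proof (cases n)
  case (Suc m)
  then show ?thesis using d_zero[of m] Fil_zero[of m k] by (force simp: dFil_def)
qed (simp add: dFil_def)

text \<open>A linear section of \<open>d\<close> from cochains of \<open>h\<close> to coboundaries turns the slices of \<open>b\<close> into a cochain of \<open>\<qq>\<close>
  with values in \<open>CS\<^sup>q\<^sup>-\<^sup>1(h, M)\<close>. It is the slicing of some \<open>e\<close> of filtration degree \<open>p\<close>, and \<open>d e\<close> has the same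
  slices as \<open>b\<close> by \<open>slice_d\<close>. For \<open>q = 0\<close> the only coboundary is zero, and \<open>b\<close> has zero slices already.\<close>

lemma ex_correction:
  assumes b: "b \<in> Fil (int p) (p + q)" and B: "\<And>us. us \<in> vecs g p \<Longrightarrow> slice q b us \<in> Bh q"
  shows "\<exists>\<beta>\<in>dFil (int p) (p + q). b \<oplus>\<^bsub>Cg (p + q)\<^esub> \<beta> \<in> Fil (int (Suc p)) (p + q)"
proof (cases q)
  case 0
  interpret C: char2_space F "Cg (p + q)" by (rule gM.C_space)
  have "b \<in> Fil (int (Suc p)) (p + q)"
    unfolding Fil_Suc_iff using Fil_closed[OF b] B by (simp add: 0 coboundaries_def)
  then show ?thesis using dFil_zero Fil_closed[OF b] by (intro bexI[of _ "\<zero>\<^bsub>Cg (p + q)\<^esub>"]) simp_all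
next
  case (Suc r)
  let ?BS = "(Ch (Suc r))\<lparr>carrier := Bh (Suc r)\<rparr>"
  have BS: "char2_space F ?BS"
    by (rule char2_space.char2_space_submodule[OF hM.C_space hM.coboundaries_submodule])
  have "hM.d r \<in> linear_maps F (Ch r) ?BS"
    by (rule linear_mapsI) (simp_all add: linear_mapsD[OF hM.d_linear] coboundaries_def)
  then obtain s where s: "s \<in> linear_maps F ?BS (Ch r)" "\<And>w. w \<in> Bh (Suc r) \<Longrightarrow> hM.d r (s w) = w"
    using linear_section[OF hM.C_space BS] by (fastforce simp: coboundaries_def)
  have B': "slice (Suc r) b us \<in> Bh (Suc r)" if "us \<in> vecs g p" for us
    using B[OF that] Suc by simp
  have bF: "b \<in> Fil (int p) (p + Suc r)" using b Suc by simp
  have "reduce p (Suc r) b \<in> carrier (CS F \<qq> ?BS p)"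
    by (rule CS_subspace[OF q.A.module_V _ _ reduce_closed[OF Fil_closed[OF bF]]])
      (simp_all add: reduce_def B' sec_vecs char2_space.module_V[OF hM.C_space]
        char2_space.submoduleD(2)[OF hM.C_space hM.coboundaries_submodule])
  from ex_slice_eq[OF CS_composition[OF q.A.module_V char2_space.module_V[OF BS] char2_space.module_V[OF hM.C_space] s(1) this]]
  obtain e where e: "e \<in> Fil (int p) (p + r)"
    and sl: "\<And>us. us \<in> vecs g p \<Longrightarrow> slice r e us = s (reduce p (Suc r) b (map \<pi> us))"
    by (auto simp: proj_vecs)
  interpret C: char2_space F "Ch (Suc r)" by (rule hM.C_space)
  have "b \<oplus>\<^bsub>Cg (p + Suc r)\<^esub> gM.d (p + r) e \<in> Fil (int (Suc p)) (p + Suc r)"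
    unfolding Fil_Suc_iff
  proof (intro conjI ballI)
    show "b \<oplus>\<^bsub>Cg (p + Suc r)\<^esub> gM.d (p + r) e \<in> carrier (Cg (p + Suc r))"
      using Fil_closed[OF Fil_add[OF bF, of "gM.d (p + r) e"]] d_Fil[OF e] by simp
    fix us assume us: "us \<in> vecs g p"
    have "slice (Suc r) (gM.d (p + r) e) us = slice (Suc r) b us"
      unfolding slice_d[OF e us] sl[OF us] reduce_proj[OF bF us] by (rule s(2)[OF B'[OF us]])
    then show "slice (Suc r) (b \<oplus>\<^bsub>Cg (p + Suc r)\<^esub> gM.d (p + r) e) us = \<zero>\<^bsub>Ch (Suc r)\<^esub>"
      using slice_closed'[OF Fil_closed[OF bF] us] by (simp only: slice_linear[OF us] C.add_self)
  qed
  moreover have "gM.d (p + r) e \<in> dFil (int p) (p + Suc r)" using e by (simp add: dFil_def)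
  ultimately show ?thesis unfolding Suc by blast
qed

text \<open>Beyond the range of \<open>d_Fil\<close> the filtration is everything (\<open>k \<le> 0\<close>) or zero (\<open>k > n\<close>).\<close>

lemma d_Fil_general:
  assumes c: "c \<in> Fil k n"
  shows "gM.d n c \<in> Fil k (Suc n)"
proof (cases "k \<le> 0")
  case True
  then show ?thesis using gM.d_closed[OF Fil_closed[OF c]] by (simp add: Fil_nonpos)
next
  case False
  then obtain p where k: "k = int p" by (metis nat_0_le linorder_le_cases)
  show ?thesis
  proof (cases "p \<le> n")
    case True
    then obtain q where "n = p + q" using le_Suc_ex by blast
    then show ?thesis using d_Fil c k by blast
  next
    case False
    have "c = \<zero>\<^bsub>Cg n\<^esub>"
    proof (rule CS_eqI[OF Fil_closed[OF c] Fil_closed[OF Fil_zero]])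
      fix xs assume xs: "xs \<in> vecs g n"
      have "c (xs @ map \<iota> []) = \<zero>\<^bsub>M\<^esub>"
        by (rule c[unfolded mem_Fil_iff, THEN conjunct2, rule_format]) (use xs False k in \<open>simp_all add: vecs_iff\<close>)
      then show "c xs = \<zero>\<^bsub>Cg n\<^esub> xs" using xs by (simp add: CS_simps)
    qed
    then show ?thesis using d_zero Fil_zero by metis
  qed
qed

abbreviation "ssZ r k n \<equiv> ss_Z (CS_diff g M \<rho>) Fil r k n"

lemma ssZ_submodule: "submodule (ssZ r k n) F (Cg n)"
proof -
  interpret C: char2_space F "Cg n" by (rule gM.C_space)
  note di = linear_mapsD[OF gM.d_linear]
  note Fi = C.submoduleD[OF Fil_submodule] and Fi' = char2_space.submoduleD[OF gM.C_space Fil_submodule]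
  show ?thesis
    by (rule C.submoduleI_char2)
      (use Fi Fi' in \<open>auto simp: ss_Z_def di(2,3) Fil_closed d_zero\<close>)
qed

lemma ssZ_Z1: "c \<in> ssZ 1 (int p) (p + q) \<longleftrightarrow> c \<in> Z1 p q"
  by (simp add: ss_Z_def Z1_iff add.commute)

text \<open>The summand \<open>d Z\<^sub>1\<^sup>p\<^sup>-\<^sup>1\<close> of the denominator of \<open>E\<^sub>2\<close>.\<close>

definition page_bnd :: "nat \<Rightarrow> nat \<Rightarrow> ('g list \<Rightarrow> 'm) set" where
  "page_bnd p n = (case n of 0 \<Rightarrow> {\<zero>\<^bsub>Cg 0\<^esub>} | Suc m \<Rightarrow> gM.d m ` ssZ 1 (int p - 1) m)"

lemma page_bnd_submodule: "submodule (page_bnd p n) F (Cg n)"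
proof (cases n)
  case 0
  interpret C: char2_space F "Cg 0" by (rule gM.C_space)
  show ?thesis unfolding 0 page_bnd_def by (auto intro: C.submoduleI_char2)
next
  case (Suc m)
  show ?thesis unfolding Suc page_bnd_def nat.case
    by (rule submodule_image[OF gM.C_space gM.C_space gM.d_linear ssZ_submodule])
qed

lemma dFil_page_bnd: "\<beta> \<in> dFil (int p) n \<Longrightarrow> \<beta> \<in> page_bnd p n"
proof (cases n)
  case (Suc m)
  assume "\<beta> \<in> dFil (int p) n"
  then obtain e where e: "e \<in> Fil (int p) m" "\<beta> = gM.d m e" by (auto simp: dFil_def Suc)
  then have "e \<in> ssZ 1 (int p - 1) m"
    using Fil_antimono[of "int p - 1" "int p" e m] d_Fil_general by (simp add: ss_Z_def)
  then show ?thesis using e by (auto simp: page_bnd_def Suc)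
qed (simp add: dFil_def page_bnd_def)

lemma page_bnd_cycle:
  assumes "\<beta> \<in> page_bnd p n"
  shows "\<beta> \<in> Fil (int p) n" "gM.d n \<beta> = \<zero>\<^bsub>Cg (Suc n)\<^esub>"
proof -
  have "\<beta> \<in> Fil (int p) n \<and> gM.d n \<beta> = \<zero>\<^bsub>Cg (Suc n)\<^esub>"
  proof (cases n)
    case 0
    then show ?thesis using assms Fil_zero d_zero by (simp add: page_bnd_def)
  next
    case (Suc m)
    then obtain b where "b \<in> Fil (int p - 1) m" "gM.d m b \<in> Fil (int p) n" "\<beta> = gM.d m b"
      using assms by (auto simp: page_bnd_def ss_Z_def)
    then show ?thesis using gM.d_d[OF Fil_closed] Suc by blast
  qed
  then show "\<beta> \<in> Fil (int p) n" "gM.d n \<beta> = \<zero>\<^bsub>Cg (Suc n)\<^esub>" by auto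
qed

lemma page_bnd_Z1: "\<beta> \<in> page_bnd p (p + q) \<Longrightarrow> \<beta> \<in> Z1 p q"
  using page_bnd_cycle[of \<beta> p "p + q"] Fil_zero by (simp add: Z1_iff)

lemma ss_B_eq: "ss_B Cg (CS_diff g M \<rho>) Fil 2 (int p) n = ssZ 1 (int p + 1) n <+>\<^bsub>Cg n\<^esub> page_bnd p n"
proof -
  have "(2::int) - 1 = 1" "int p - 2 + 1 = int p - 1" by simp_all
  then show ?thesis by (simp only: ss_B_def page_bnd_def)
qed

abbreviation "Z2 p q \<equiv> ssZ 2 (int p) (p + q)"
abbreviation "B2 p q \<equiv> ss_B Cg (CS_diff g M \<rho>) Fil 2 (int p) (p + q)"

text \<open>For \<open>p > 0\<close> this is \<open>dq_\<theta>\<close>. For \<open>p = 0\<close> the element is zero or the differential of an arbitrary cochain;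
  its slices are coboundaries of \<open>h\<close>, and \<open>\<theta>\<close> sends it to zero.\<close>

lemma \<theta>_page_bnd:
  assumes "\<beta> \<in> page_bnd p (p + q)"
  shows "\<theta> p q \<beta> \<in> Bq p q"
proof (cases p)
  case 0
  have "slice q \<beta> us \<in> Bh q" if us: "us \<in> vecs g p" for us
  proof (cases q)
    case 0
    then have "\<beta> = \<zero>\<^bsub>Cg 0\<^esub>" using assms \<open>p = 0\<close> by (simp add: page_bnd_def)
    then have "slice q \<beta> us = \<zero>\<^bsub>Ch q\<^esub>"
      unfolding slice_zero_iff using us 0 \<open>p = 0\<close> by (auto simp: CS_simps vecs_iff)
    then show ?thesis by (simp add: coboundaries_def 0)
  next
    case (Suc r)
    then obtain b where b: "b \<in> carrier (Cg r)" "\<beta> = gM.d r b"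
      using assms \<open>p = 0\<close> Fil_closed by (auto simp: page_bnd_def ss_Z_def)
    have "slice (Suc r) \<beta> us = hM.d r (slice r b us)"
      using slice_d[of b 0 r us] b us \<open>p = 0\<close> by (simp add: Fil_nonpos)
    moreover have "slice r b us \<in> carrier (Ch r)"
      using slice_closed'[of b 0 r us] b us \<open>p = 0\<close> by simp
    ultimately show ?thesis by (auto simp: coboundaries_def Suc)
  qed
  then have "\<theta> p q \<beta> = \<zero>\<^bsub>Cq p q\<^esub>" by (simp add: \<theta>_eq_zero_iff[OF page_bnd_Z1[OF assms]])
  then show ?thesis by (simp add: 0 coboundary_0)
next
  case (Suc r)
  then obtain b where b: "b \<in> ssZ 1 (int r) (r + q)" "\<beta> = gM.d (r + q) b"
    using assms by (auto simp: page_bnd_def)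
  then show ?thesis unfolding Suc coboundary_Suc ssZ_Z1 by blast
qed

lemma ssZ_2_iff: "c \<in> Z2 p q \<longleftrightarrow> c \<in> Z1 p q \<and> gM.d (p + q) c \<in> Fil (int (Suc (Suc p))) (Suc (p + q))"
proof -
  have "int p + 2 = int (Suc (Suc p))" by simp
  then show ?thesis
    using Fil_antimono[of "int (Suc p)" "int (Suc (Suc p))" "gM.d (p + q) c" "Suc (p + q)"]
    by (auto simp only: ss_Z_def Z1_iff)
qed

lemma ssZ_1_iff: "a \<in> ssZ 1 (int p + 1) n \<longleftrightarrow> a \<in> Fil (int (Suc p)) n \<and> gM.d n a \<in> Fil (int (Suc (Suc p))) (Suc n)"
proof -
  have "int p + 1 = int (Suc p)" "int (Suc p) + 1 = int (Suc (Suc p))" by simp_all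
  then show ?thesis by (simp only: ss_Z_def mem_Collect_eq)
qed

lemma ssZ_1_Z1: "a \<in> ssZ 1 (int p + 1) (p + q) \<Longrightarrow> a \<in> Z1 p q"
  using Fil_antimono[of "int p" "int (Suc p)" a "p + q"]
    Fil_antimono[of "int (Suc p)" "int (Suc (Suc p))" "gM.d (p + q) a" "Suc (p + q)"]
  by (simp only: ssZ_1_iff Z1_iff)

lemma \<theta>_cocycle:
  assumes "c \<in> Z2 p q"
  shows "\<theta> p q c \<in> Zq p q"
proof -
  have c: "c \<in> Z1 p q" "gM.d (p + q) c \<in> Fil (int (Suc (Suc p))) (Suc p + q)" using assms by (simp_all add: ssZ_2_iff)
  show ?thesis using \<theta>_Fil_Suc[OF c(2) d_Z1[OF c(1)]] \<theta>_closed[OF c(1)] dq_\<theta>[OF c(1)] by (simp add: cocycles_def)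
qed

text \<open>Let \<open>f = \<theta> c\<close>. As \<open>\<theta> (d c) = 0\<close>, adding some \<open>d e\<close> with \<open>e\<close> of filtration degree \<open>p + 1\<close> moves \<open>d c\<close> into
  filtration degree \<open>p + 2\<close>. Then \<open>c + e\<close> is a preimage of \<open>f\<close> in the numerator of \<open>E\<^sub>2\<close>.\<close>

lemma \<theta>_onto_cocycles:
  assumes f: "f \<in> Zq p q"
  shows "\<exists>c\<in>Z2 p q. \<theta> p q c = f"
proof -
  obtain c where c: "c \<in> Z1 p q" "\<theta> p q c = f" using \<theta>_surj f unfolding cocycles_def by blast
  let ?dc = "gM.d (p + q) c"
  have "\<theta> (Suc p) q ?dc = \<zero>\<^bsub>Cq (Suc p) q\<^esub>" using f dq_\<theta>[OF c(1)] c(2) by (simp add: cocycles_def)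
  then have "slice q ?dc us \<in> Bh q" if "us \<in> vecs g (Suc p)" for us
    using that by (simp add: \<theta>_eq_zero_iff[OF d_Z1[OF c(1)]])
  from ex_correction[OF Z1_Fil[OF d_Z1[OF c(1)]] this]
  obtain e where e: "e \<in> Fil (int (Suc p)) (p + q)"
    and dce: "?dc \<oplus>\<^bsub>Cg (Suc (p + q))\<^esub> gM.d (p + q) e \<in> Fil (int (Suc (Suc p))) (Suc (p + q))"
    by (auto simp: dFil_def)
  have eF: "e \<in> Fil (int p) (p + q)" by (rule Fil_antimono[OF _ e]) simp
  have eZ: "e \<in> Z1 p q" using eF d_Fil_general[OF e] by (simp add: Z1_iff)
  interpret C: char2_space F "Cq p q" by (rule Cq_space)
  have "c \<oplus>\<^bsub>Cg (p + q)\<^esub> e \<in> Z1 p q"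
    by (rule char2_space.submoduleD(3)[OF gM.C_space Z1_submodule c(1) eZ])
  then have "c \<oplus>\<^bsub>Cg (p + q)\<^esub> e \<in> Z2 p q"
    unfolding ssZ_2_iff using dce by (simp add: d_add Z1_closed c eZ)
  moreover have "\<theta> p q (c \<oplus>\<^bsub>Cg (p + q)\<^esub> e) = f"
    using \<theta>_closed[OF c(1)] by (simp add: \<theta>_add[OF c(1) eZ] \<theta>_Fil_Suc[OF e eZ] c(2))
  ultimately show ?thesis by blast
qed

text \<open>If \<open>\<theta> c\<close> is a coboundary, then by \<open>coboundary_Suc\<close> some \<open>\<gamma>\<close> in \<open>d Z\<^sub>1\<^sup>p\<^sup>-\<^sup>1\<close> satisfies \<open>\<theta> (c + \<gamma>) = 0\<close>. By
  \<open>ex_correction\<close> a further boundary \<open>\<beta>\<close> moves \<open>c + \<gamma>\<close> into filtration degree \<open>p + 1\<close>, and \<open>c\<close> is the sum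
  of \<open>c + \<gamma> + \<beta>\<close> and \<open>\<gamma> + \<beta>\<close>. Conversely, \<open>\<theta>\<close> kills the first summand of the denominator
  (\<open>\<theta>_Fil_Suc\<close>) and maps the second one to coboundaries (\<open>\<theta>_page_bnd\<close>).\<close>

lemma \<theta>_coboundary_iff:
  assumes c: "c \<in> Z2 p q"
  shows "\<theta> p q c \<in> Bq p q \<longleftrightarrow> c \<in> B2 p q"
proof
  interpret C: char2_space F "Cg (p + q)" by (rule gM.C_space)
  interpret Q: char2_space F "Cq p q" by (rule Cq_space)
  have cZ: "c \<in> Z1 p q" and dc: "gM.d (p + q) c \<in> Fil (int (Suc (Suc p))) (Suc (p + q))"
    using c by (simp_all add: ssZ_2_iff)
  note page_bndD = C.submoduleD[OF page_bnd_submodule]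
  show "\<theta> p q c \<in> Bq p q" if B: "c \<in> B2 p q"
  proof -
    obtain a \<beta> where a: "a \<in> ssZ 1 (int p + 1) (p + q)" and \<beta>: "\<beta> \<in> page_bnd p (p + q)" and eq: "c = a
        \<oplus>\<^bsub>Cg (p + q)\<^esub> \<beta>"
      using B by (auto simp: ss_B_eq set_add_def')
    note aZ = ssZ_1_Z1[OF a] and \<beta>Z = page_bnd_Z1[OF \<beta>]
    have "\<theta> p q a = \<zero>\<^bsub>Cq p q\<^esub>" by (rule \<theta>_Fil_Suc[OF _ aZ]) (use a in \<open>simp add: ssZ_1_iff\<close>)
    then show ?thesis using \<theta>_page_bnd[OF \<beta>] \<theta>_closed[OF \<beta>Z] by (simp add: eq \<theta>_add[OF aZ \<beta>Z])
  qed
  assume B: "\<theta> p q c \<in> Bq p q"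
  \<comment> \<open>In degree \<open>p = 0\<close> the only coboundary of \<open>\<qq>\<close> is zero, and no \<open>\<gamma>\<close> is needed.\<close>
  have "\<exists>\<gamma>\<in>page_bnd p (p + q). \<theta> p q (c \<oplus>\<^bsub>Cg (p + q)\<^esub> \<gamma>) = \<zero>\<^bsub>Cq p q\<^esub>"
  proof (cases p)
    case 0
    have "\<theta> p q c = \<zero>\<^bsub>Cq p q\<^esub>" using B by (simp add: 0 coboundary_0)
    then have "\<theta> p q (c \<oplus>\<^bsub>Cg (p + q)\<^esub> \<zero>\<^bsub>Cg (p + q)\<^esub>) = \<zero>\<^bsub>Cq p q\<^esub>"
      using Z1_closed[OF cZ] by (simp only: C.M.r_zero)
    then show ?thesis using page_bndD(2) by blast
  next
    case (Suc r)
    then obtain b where b: "b \<in> Z1 r q" "\<theta> p q c = \<theta> p q (gM.d (r + q) b)" using B coboundary_Suc by auto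
    have \<gamma>: "gM.d (r + q) b \<in> page_bnd p (p + q)" using b(1) by (auto simp: page_bnd_def Suc ssZ_Z1[symmetric])
    then show ?thesis
      using \<theta>_add[OF cZ page_bnd_Z1[OF \<gamma>]] b(2) \<theta>_closed[OF cZ]
        by (intro bexI[of _ "gM.d (r + q) b"]) (simp_all add: Q.add_self)
  qed
  then obtain \<gamma> where \<gamma>: "\<gamma> \<in> page_bnd p (p + q)" and z: "\<theta> p q (c \<oplus>\<^bsub>Cg (p + q)\<^esub> \<gamma>) = \<zero>\<^bsub>Cq p q\<^esub>" by blast
  let ?c = "c \<oplus>\<^bsub>Cg (p + q)\<^esub> \<gamma>"
  have c'Z: "?c \<in> Z1 p q" by (rule C.submoduleD(3)[OF Z1_submodule cZ page_bnd_Z1[OF \<gamma>]])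
  have "slice q ?c us \<in> Bh q" if "us \<in> vecs g p" for us
    using z that by (simp add: \<theta>_eq_zero_iff[OF c'Z])
  from ex_correction[OF Z1_Fil[OF c'Z] this] obtain \<beta> where \<beta>: "\<beta> \<in> page_bnd p (p + q)"
    and F: "?c \<oplus>\<^bsub>Cg (p + q)\<^esub> \<beta> \<in> Fil (int (Suc p)) (p + q)" using dFil_page_bnd by blast
  note cl = Z1_closed[OF cZ] Z1_closed[OF page_bnd_Z1[OF \<gamma>]] Z1_closed[OF page_bnd_Z1[OF \<beta>]]
  let ?a = "?c \<oplus>\<^bsub>Cg (p + q)\<^esub> \<beta>"
  have "gM.d (p + q) ?a = gM.d (p + q) c"
    using cl gM.d_closed[OF cl(1)] char2_space.axioms(2)[OF gM.C_space, of "Suc (p + q)"]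
    by (simp add: d_add page_bnd_cycle(2)[OF \<gamma>] page_bnd_cycle(2)[OF \<beta>] module_def abelian_group_def abelian_monoid.r_zero)
  then have a: "?a \<in> ssZ 1 (int p + 1) (p + q)" using F dc by (simp add: ssZ_1_iff)
  have s: "\<gamma> \<oplus>\<^bsub>Cg (p + q)\<^esub> \<beta> \<in> page_bnd p (p + q)" by (rule page_bndD(3)[OF \<gamma> \<beta>])
  have "c = ?a \<oplus>\<^bsub>Cg (p + q)\<^esub> (\<gamma> \<oplus>\<^bsub>Cg (p + q)\<^esub> \<beta>)"
    using cl by (simp add: C.char2_simps)
  then show "c \<in> B2 p q"
    using a s unfolding ss_B_eq set_add_def' by blast
qed

lemma ss_B_subset: "B2 p q \<subseteq> Z2 p q"
proof
  fix c assume "c \<in> B2 p q"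
  then obtain a \<beta> where a: "a \<in> ssZ 1 (int p + 1) (p + q)" and \<beta>: "\<beta> \<in> page_bnd p (p + q)" and eq: "c = a
      \<oplus>\<^bsub>Cg (p + q)\<^esub> \<beta>"
    by (auto simp: ss_B_eq set_add_def')
  have "a \<in> Z2 p q" using a ssZ_1_Z1[OF a] by (simp add: ssZ_2_iff ssZ_1_iff)
  moreover have "\<beta> \<in> Z2 p q"
    using page_bnd_Z1[OF \<beta>] page_bnd_cycle(2)[OF \<beta>] Fil_zero by (simp add: ssZ_2_iff)
  ultimately show "c \<in> Z2 p q"
    unfolding eq by (rule char2_space.submoduleD(3)[OF gM.C_space ssZ_submodule])
qed

theorem second_page:
  "\<exists>\<Phi>\<in>linear_isos F (ss_E Cg (CS_diff g M \<rho>) Fil 2 (int p) (p + q)) (HS F \<qq> (HSh q) (\<sigma> q) p).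
     \<forall>c\<in>Z2 p q. \<exists>f\<in>Zq p q.
       (\<forall>xs\<in>vecs g p. f (map \<pi> xs) = \<kappa> q (\<lambda>ys\<in>vecs h q. c (xs @ map \<iota> ys))) \<and>
       \<Phi> (B2 p q +>\<^bsub>Cg (p + q)\<^esub> c) =
         Bq p q +>\<^bsub>Cq p q\<^esub> f"
proof -
  let ?V = "(Cg (p + q))\<lparr>carrier := Z2 p q\<rparr>" and ?W = "(Cq p q)\<lparr>carrier := Zq p q\<rparr>"
  let ?N = "B2 p q"
  interpret C: char2_space F "Cg (p + q)" by (rule gM.C_space)
  have N: "submodule ?N F (Cg (p + q))"
    unfolding ss_B_eq by (rule C.sum_submodule[OF ssZ_submodule page_bnd_submodule])
  have Z: "c \<in> Z1 p q" if "c \<in> Z2 p q" for c using that by (simp add: ssZ_2_iff)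
  have "\<exists>\<Phi>\<in>linear_isos F (quot_module ?V ?N) (quot_module ?W (Bq p q)).
    \<forall>c\<in>carrier ?V. \<Phi> (?N +>\<^bsub>?V\<^esub> c) = Bq p q +>\<^bsub>?W\<^esub> \<theta> p q c"
  proof (rule quot_iso_of_surjective)
    show "char2_space F ?V" by (rule C.char2_space_submodule[OF ssZ_submodule])
    show "char2_space F ?W" by (rule char2_space.char2_space_submodule[OF Cq_space Zq_submodule])
    show "submodule ?N F ?V" by (rule C.submodule_sub[OF ssZ_submodule N ss_B_subset])
    show "submodule (Bq p q) F ?W"
      by (rule char2_space.submodule_sub[OF Cq_space Zq_submodule Bq_submodule Bq_subset])
    show "\<theta> p q \<in> linear_maps F ?V ?W"
      by (rule linear_mapsI) (simp_all add: \<theta>_cocycle \<theta>_add \<theta>_smult Z)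
    show "\<exists>v\<in>carrier ?V. \<theta> p q v = w" if "w \<in> carrier ?W" for w using \<theta>_onto_cocycles that by simp
    show "\<theta> p q v \<in> Bq p q \<longleftrightarrow> v \<in> ?N" if "v \<in> carrier ?V" for v using \<theta>_coboundary_iff that by simp
  qed
  then obtain \<Phi> where \<Phi>: "\<Phi> \<in> linear_isos F (quot_module ?V ?N) (quot_module ?W (Bq p q))"
    and eval: "\<And>c. c \<in> Z2 p q \<Longrightarrow> \<Phi> (?N +>\<^bsub>Cg (p + q)\<^esub> c) = Bq p q +>\<^bsub>Cq p q\<^esub> \<theta> p q c"
    by auto
  show ?thesis
  proof (intro bexI[of _ \<Phi>] ballI)
    show "\<Phi> \<in> linear_isos F (ss_E Cg (CS_diff g M \<rho>) Fil 2 (int p) (p + q)) (HS F \<qq> (HSh q) (\<sigma> q) p)"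
      using \<Phi> unfolding ss_E_def HS_def[of F \<qq>] cohomology_def .
    fix c assume c: "c \<in> Z2 p q"
    show "\<exists>f\<in>Zq p q. (\<forall>xs\<in>vecs g p. f (map \<pi> xs) = \<kappa> q (\<lambda>ys\<in>vecs h q. c (xs @ map \<iota> ys))) \<and>
       \<Phi> (?N +>\<^bsub>Cg (p + q)\<^esub> c) = Bq p q +>\<^bsub>Cq p q\<^esub> f"
      using \<theta>_proj[OF Z[OF c]] unfolding slice_def
      by (intro bexI[OF _ \<theta>_cocycle[OF c]] conjI ballI eval[OF c])
  qed
qed

end

theorem corollary3p2:
  fixes F :: "('f, 'x) ring_scheme"
    and h :: "('f, 'h, 'y1) lie_algebra_scheme"
    and g :: "('f, 'g, 'y2) lie_algebra_scheme"
    and \<qq> :: "('f, 'q, 'y3) lie_algebra_scheme"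
    and \<iota> :: "'h \<Rightarrow> 'g" and \<pi> :: "'g \<Rightarrow> 'q"
    and M :: "('f, 'm, 'z) module_scheme" and \<rho> :: "'g \<Rightarrow> 'm \<Rightarrow> 'm"
    and p q :: nat
  defines "C \<equiv> CS F g M" and "d \<equiv> CS_diff g M \<rho>" and "Fil \<equiv> CS_filt F g M (\<iota> ` carrier h)"
    and "\<rho>h \<equiv> (\<lambda>y. \<rho> (\<iota> y))"
  defines "HSh \<equiv> HS F h M \<rho>h q"
    and "\<sigma> \<equiv> HS_action F h g \<iota> \<pi> M \<rho> q"
  assumes "comm_lie_short_exact F h g \<qq> \<iota> \<pi>" and "comm_lie_module F g M \<rho>"
  shows "\<exists>\<Phi> \<in> linear_isos F (ss_E C d Fil 2 (int p) (p + q)) (HS F \<qq> HSh \<sigma> p).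
    \<forall>c \<in> ss_Z d Fil 2 (int p) (p + q).
      \<exists>f \<in> HS_cocycles F \<qq> HSh \<sigma> p.
        (\<forall>xs \<in> vecs g p. f (map \<pi> xs) =
           HS_coboundaries F h M \<rho>h q +>\<^bsub>CS F h M q\<^esub> (\<lambda>ys\<in>vecs h q. c (xs @ map \<iota> ys))) \<and>
        \<Phi> (ss_B C d Fil 2 (int p) (p + q) +>\<^bsub>C (p + q)\<^esub> c) =
          HS_coboundaries F \<qq> HSh \<sigma> p +>\<^bsub>CS F \<qq> HSh p\<^esub> f"
proof -
  have "comm_lie_extension_module F h g \<qq> \<iota> \<pi> M \<rho>"
    using assms(7,8) by (rule comm_lie_extension_module.intro)
  then show ?thesis
    unfolding C_def d_def Fil_def HSh_def \<sigma>_def \<rho>h_def by (rule comm_lie_extension_module.second_page)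
qed

end
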